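(* Let $p(x)=\sum_{|\alpha|\le n}p_\alpha x^\alpha$ and $q(x)=\sum_{|\alpha|\le m}q_\alpha x^\alpha$ be polynomials $\mathbb{R}^d\to\mathbb{R}$ (real coefficients) such that the rational function $z\mapsto q(iz)/p(iz)$ has a holomorphic extension to a strip $\{z\in\mathbb{C}^d:\|\Im z\|<\varepsilon\}$ for some $\varepsilon>0$. Let $\dot L$ be a Lévy white noise with characteristic triplet $(a,\gamma,\nu)$ such that $\int_{\mathbb{R}}\mathbf{1}_{|r|>1}\log(|r|)^d\nu(dr)<\infty$. Then there exists a stationary CARMA$(p,q)$ generalized process, i.e. a stationary generalized random process $s$ with $\langle s,p(-D)\varphi\rangle=\langle\dot L,q(-D)\varphi\rangle$ almost surely for every $\varphi\in\mathcal{D}(\mathbb{R}^d)$.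
   Context: $D^\alpha=\partial_{x_1}^{\alpha_1}\cdots\partial_{x_d}^{\alpha_d}$, $p(D)=\sum p_\alpha D^\alpha$, and $p(-D)$, $q(-D)$ are the formal adjoints of $p(D)$, $q(D)$. $\mathcal{D}(\mathbb{R}^d)$ is the space of smooth compactly supported real functions with its usual topology. A generalized random process is a linear (a.s.) map $s:\mathcal{D}(\mathbb{R}^d)\to L^0(\Omega)$ continuous with respect to convergence in probability; it is stationary if for all $t\in\mathbb{R}^d$, $\varphi\mapsto\langle s,\varphi(\cdot-t)\rangle$ has the same law as $s$. A Lévy white noise with characteristic triplet $(a,\gamma,\nu)$ is a generalized random process $\dot L$ with $\mathbb{E}\exp(i\langle\dot L,\varphi\rangle)=\exp\big(\int_{\mathbb{R}^d}\psi(\varphi(x))dx\big)$, $\psi(z)=i\gamma z-\tfrac12 az^2+\int(e^{ixz}-1-ixz\mathbf{1}_{|x|\le1})\nu(dx)$; it extends to a Lévy basis and acts on all functions integrable w.r.t. it in the sense of Rajput–Rosiński. *)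

theory Defs
  imports "HOL-Analysis.Analysis" "HOL-Probability.Probability"
begin

definition mindex_abs :: "('d::finite \<Rightarrow> nat) \<Rightarrow> nat" where
  "mindex_abs \<alpha> = (\<Sum>i\<in>UNIV. \<alpha> i)"

definition is_mpoly :: "(('d::finite \<Rightarrow> nat) \<Rightarrow> real) \<Rightarrow> bool" where
  "is_mpoly P \<longleftrightarrow> finite {\<alpha>. P \<alpha> \<noteq> 0}"

definition mpoly_eval_c :: "(('d::finite \<Rightarrow> nat) \<Rightarrow> real) \<Rightarrow> complex^'d \<Rightarrow> complex" where
  "mpoly_eval_c P z = (\<Sum>\<alpha>\<in>{\<alpha>. P \<alpha> \<noteq> 0}. complex_of_real (P \<alpha>) * (\<Prod>i\<in>UNIV. (z$i) ^ \<alpha> i))"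

definition partial :: "'d::finite \<Rightarrow> (real^'d \<Rightarrow> real) \<Rightarrow> (real^'d \<Rightarrow> real)" where
  "partial i f = (\<lambda>x. frechet_derivative f (at x) (axis i 1))"

fun iter_partial :: "'d::finite list \<Rightarrow> (real^'d \<Rightarrow> real) \<Rightarrow> (real^'d \<Rightarrow> real)" where
  "iter_partial [] f = f"
| "iter_partial (i # is) f = partial i (iter_partial is f)"

definition smooth_fun :: "(real^'d::finite \<Rightarrow> real) \<Rightarrow> bool" where
  "smooth_fun f \<longleftrightarrow> (\<forall>is x. iter_partial is f differentiable (at x))"

definition test_function :: "(real^'d::finite \<Rightarrow> real) \<Rightarrow> bool" where
  "test_function \<phi> \<longleftrightarrow> smooth_fun \<phi> \<and> compact (closure {x. \<phi> x \<noteq> 0})"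

text \<open>D^alpha = partial_1^alpha_1 ... partial_d^alpha_d (coordinates in an arbitrary fixed order; order irrelevant for smooth functions).\<close>
definition Dmulti :: "('d::finite \<Rightarrow> nat) \<Rightarrow> (real^'d \<Rightarrow> real) \<Rightarrow> (real^'d \<Rightarrow> real)" where
  "Dmulti \<alpha> f = iter_partial (concat (map (\<lambda>i. replicate (\<alpha> i) i) (SOME xs. distinct xs \<and> set xs = UNIV))) f"

text \<open>p(-D) phi = sum_alpha p_alpha (-1)^|alpha| D^alpha phi (formal adjoint of p(D)).\<close>
definition diff_op_neg :: "(('d::finite \<Rightarrow> nat) \<Rightarrow> real) \<Rightarrow> (real^'d \<Rightarrow> real) \<Rightarrow> (real^'d \<Rightarrow> real)" where
  "diff_op_neg P \<phi> = (\<lambda>x. \<Sum>\<alpha>\<in>{\<alpha>. P \<alpha> \<noteq> 0}. P \<alpha> * (-1) ^ mindex_abs \<alpha> * Dmulti \<alpha> \<phi> x)"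

definition test_conv :: "(nat \<Rightarrow> real^'d::finite \<Rightarrow> real) \<Rightarrow> (real^'d \<Rightarrow> real) \<Rightarrow> bool" where
  "test_conv \<phi>s \<phi> \<longleftrightarrow> (\<forall>n. test_function (\<phi>s n)) \<and> test_function \<phi> \<and>
     (\<exists>K. compact K \<and> (\<forall>n. {x. \<phi>s n x \<noteq> 0} \<subseteq> K) \<and> {x. \<phi> x \<noteq> 0} \<subseteq> K) \<and>
     (\<forall>\<alpha>. uniform_limit UNIV (\<lambda>n. Dmulti \<alpha> (\<phi>s n)) (Dmulti \<alpha> \<phi>) sequentially)"

definition conv_in_prob :: "'w measure \<Rightarrow> (nat \<Rightarrow> 'w \<Rightarrow> real) \<Rightarrow> ('w \<Rightarrow> real) \<Rightarrow> bool" where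
  "conv_in_prob M X Y \<longleftrightarrow>
     (\<forall>e>0. (\<lambda>n. measure M {w\<in>space M. \<bar>X n w - Y w\<bar> > e}) \<longlonglongrightarrow> 0)"

definition gen_random_process ::
  "'w measure \<Rightarrow> ((real^'d::finite \<Rightarrow> real) \<Rightarrow> 'w \<Rightarrow> real) \<Rightarrow> bool" where
  "gen_random_process M s \<longleftrightarrow>
     (\<forall>\<phi>. test_function \<phi> \<longrightarrow> s \<phi> \<in> borel_measurable M) \<and>
     (\<forall>\<phi> \<psi> a b. test_function \<phi> \<longrightarrow> test_function \<psi> \<longrightarrow>
        (AE w in M. s (\<lambda>x. a * \<phi> x + b * \<psi> x) w = a * s \<phi> w + b * s \<psi> w)) \<and>
     (\<forall>\<phi>s \<phi>. test_conv \<phi>s \<phi> \<longrightarrow> conv_in_prob M (\<lambda>n. s (\<phi>s n)) (s \<phi>))"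

definition stationary_grp ::
  "'w measure \<Rightarrow> ((real^'d::finite \<Rightarrow> real) \<Rightarrow> 'w \<Rightarrow> real) \<Rightarrow> bool" where
  "stationary_grp M s \<longleftrightarrow>
     (\<forall>t k (\<phi>s :: nat \<Rightarrow> real^'d \<Rightarrow> real). (\<forall>j<k. test_function (\<phi>s j)) \<longrightarrow>
        distr M (Pi\<^sub>M {..<k} (\<lambda>_. borel)) (\<lambda>w. \<lambda>j\<in>{..<k}. s (\<lambda>x. \<phi>s j (x - t)) w)
      = distr M (Pi\<^sub>M {..<k} (\<lambda>_. borel)) (\<lambda>w. \<lambda>j\<in>{..<k}. s (\<phi>s j) w))"

definition levy_measure :: "real measure \<Rightarrow> bool" where
  "levy_measure \<nu> \<longleftrightarrow> sets \<nu> = sets borel \<and> emeasure \<nu> {0} = 0 \<and>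
     (\<integral>\<^sup>+ r. ennreal (min 1 (r\<^sup>2)) \<partial>\<nu>) < \<infinity>"

definition levy_exponent :: "real \<Rightarrow> real \<Rightarrow> real measure \<Rightarrow> real \<Rightarrow> complex" where
  "levy_exponent a \<gamma> \<nu> z =
     \<i> * complex_of_real (\<gamma> * z) - complex_of_real (a * z\<^sup>2 / 2) +
     (LINT r|\<nu>. cis (r * z) - 1 - \<i> * complex_of_real (r * z * indicator {-1..1} r))"

definition levy_white_noise ::
  "'w measure \<Rightarrow> real \<Rightarrow> real \<Rightarrow> real measure \<Rightarrow> ((real^'d::finite \<Rightarrow> real) \<Rightarrow> 'w \<Rightarrow> real) \<Rightarrow> bool" where
  "levy_white_noise M a \<gamma> \<nu> L \<longleftrightarrow>
     a \<ge> 0 \<and> levy_measure \<nu> \<and> gen_random_process M L \<and>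
     (\<forall>\<phi>. test_function \<phi> \<longrightarrow>
        (LINT w|M. cis (L \<phi> w)) = exp (LINT x|lborel. levy_exponent a \<gamma> \<nu> (\<phi> x)))"

definition holomorphic_several :: "(complex^'d::finite \<Rightarrow> complex) \<Rightarrow> (complex^'d) set \<Rightarrow> bool" where
  "holomorphic_several F S \<longleftrightarrow> open S \<and>
     (\<forall>z\<in>S. \<exists>F'. (F has_derivative F') (at z) \<and> (\<forall>c v. F' (c *s v) = c * F' v))"

definition strip :: "real \<Rightarrow> (complex^'d::finite) set" where
  "strip \<epsilon> = {z. norm (\<chi> i. Im (z$i)) < \<epsilon>}"

end

(*
  Write F for the extension of q(iz)/p(iz) and R(z) = 1 + sum_i z_i^m with 4 | m. The maximum modulus
  principle on complex lines, applied to the reversed restriction of p, bounds F polynomially on a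
  smaller strip, so for large m the function F/R is integrable on horizontal shifts of R^d and a contour
  shift shows that its Fourier transform g decays like exp (- delta |x|_1). By Fourier inversion,
  g * (R(D) p(-D) phi) = q(-D) phi for test functions phi. Truncating g to boxes gives operators T_n on
  test functions which commute with translations, and the CARMA process is the limit in probability of
  L (T_n phi). The limit exists because the Levy exponent of a function bounded by C exp (- delta |x|_1)
  is dominated by an integrable function: the Lebesgue integral of min 2 (|r| C exp (- delta |x|_1)) over
  x is of order log(|r|)^d, which is where the logarithmic moment enters. Stationarity of the limit is
  read off its characteristic function.
*)
theory Submission
  imports Defs "HOL-Complex_Analysis.Complex_Analysis"
begin

no_notation fps_nth (infixl "$" 75)

section \<open>Joint laws and characteristic functions\<close>

text \<open>\<open>L\<close> is given on test functions only, while the convolution of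
  \<open>g\<close> with a test function need not have compact support. Cutting off \<open>g\<close>,
  and not the convolution, keeps every approximation a test function, and all of them lie under one
  exponential envelope that does not see the cutoff. The quotient F may grow polynomially, and then
  it has no integrable inverse transform; division by R repairs this, and the factor is paid back by
  derivatives of the test function. R has only pure powers because these can be differentiated in
  any order of the coordinates, and 4 divides m so that R is at least 1 on the real space. No bound
  on F can be read off the quotient near zeros of p; it comes from a direction in which the leading
  coefficient of p is the same nonzero number at every base point. Identities between values of the
  noise hold up to null sets that depend on the functions involved, so limits, linearity and laws
  are handled through the pseudometric \<open>prob_dist\<close> and through characteristic
  functions.\<close>

lemma real_distribution_weighted:
  fixes W X :: "'w \<Rightarrow> real"
  assumes "prob_space M" and [measurable]: "W \<in> borel_measurable M" "X \<in> borel_measurable M"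
    and W: "\<And>w. 0 \<le> W w" "\<And>w. W w \<le> B" and c: "c = (LINT w|M. W w)" "c > 0"
  defines "N \<equiv> distr (density M (\<lambda>w. ennreal (W w / c))) borel X"
  shows "real_distribution N"
    and "char N t = (LINT w|M. W w * cis (t * X w)) / c"
    and "A \<in> sets borel \<Longrightarrow> measure N A = (LINT w|M. W w * indicator A (X w)) / c"
proof -
  interpret prob_space M by fact
  have intW: "integrable M W"
    by (rule integrable_const_bound[where B=B]) (use W in auto)
  have "emeasure (density M (\<lambda>w. ennreal (W w / c))) (space M) = (\<integral>\<^sup>+w. ennreal (W w / c) \<partial>M)"
    by (subst emeasure_density) (auto intro!: nn_integral_cong)
  also have "\<dots> = ennreal (LINT w|M. W w / c)"
    by (rule nn_integral_eq_integral) (use intW W c in auto)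
  also have "\<dots> = 1" using c by simp
  finally have 1: "prob_space (density M (\<lambda>w. ennreal (W w / c)))"
    by (intro prob_spaceI) simp
  interpret D: prob_space "density M (\<lambda>w. ennreal (W w / c))" by fact
  show "real_distribution N" unfolding N_def real_distribution_def real_distribution_axioms_def
    by (auto intro!: D.prob_space_distr)
  have "char N t = (LINT w|density M (\<lambda>w. ennreal (W w / c)). iexp (t * X w))"
    unfolding N_def char_def by (subst integral_distr) auto
  also have "\<dots> = (LINT w|M. (W w / c) *\<^sub>R iexp (t * X w))"
    by (subst integral_density) (use W c in auto)
  also have "\<dots> = (LINT w|M. W w * cis (t * X w) / c)"
    by (intro Bochner_Integration.integral_cong) (auto simp: cis_conv_exp scaleR_conv_of_real)
  finally show "char N t = (LINT w|M. W w * cis (t * X w)) / c" by simp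
  assume A[measurable]: "A \<in> sets borel"
  have "measure N A = (LINT w|density M (\<lambda>w. ennreal (W w / c)). indicator A (X w))"
  proof -
    have "measure N A = (LINT x|N. indicator A x)" using A by (simp add: N_def)
    also have "\<dots> = (LINT w|density M (\<lambda>w. ennreal (W w / c)). indicator A (X w))"
      unfolding N_def by (subst integral_distr) auto
    finally show ?thesis .
  qed
  also have "\<dots> = (LINT w|M. (W w / c) *\<^sub>R indicator A (X w))"
    by (subst integral_density) (use W c in auto)
  also have "\<dots> = (LINT w|M. W w * indicator A (X w)) / c" by simp
  finally show "measure N A = (LINT w|M. W w * indicator A (X w)) / c" .
qed

text \<open>The hypothesis at \<open>t = 0\<close> says that both weights have the same total mass.
  Dividing by it gives two probability laws on the line with equal characteristic functions; if the
  mass is zero, both weights vanish almost everywhere.\<close>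

lemma weighted_char_unique:
  fixes W W' X Y :: "'w \<Rightarrow> real"
  assumes "prob_space M" and [measurable]: "W \<in> borel_measurable M" "X \<in> borel_measurable M"
    "W' \<in> borel_measurable M" "Y \<in> borel_measurable M"
    and W: "\<And>w. 0 \<le> W w" "\<And>w. W w \<le> B" and W': "\<And>w. 0 \<le> W' w" "\<And>w. W' w \<le> B"
    and eq: "\<And>t. (LINT w|M. W w * cis (t * X w)) = (LINT w|M. W' w * cis (t * Y w))"
    and A[measurable]: "A \<in> sets borel"
  shows "(LINT w|M. W w * indicator A (X w)) = (LINT w|M. W' w * indicator A (Y w))"
proof -
  interpret prob_space M by fact
  define c where "c = (LINT w|M. W w)"
  have intW: "integrable M W" "integrable M W'"
    by (rule integrable_const_bound[where B=B]; use W W' in auto)+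
  have c': "c = (LINT w|M. W' w)" using eq[of 0] by (simp add: c_def)
  show ?thesis
  proof (cases "c > 0")
    case True
    note N = real_distribution_weighted[OF \<open>prob_space M\<close> _ _ W c_def True, of X]
    note N' = real_distribution_weighted[OF \<open>prob_space M\<close> _ _ W' c' True, of Y]
    have "distr (density M (\<lambda>w. ennreal (W w / c))) borel X =
       distr (density M (\<lambda>w. ennreal (W' w / c))) borel Y"
      by (rule Levy_uniqueness) (use N N' eq in \<open>auto simp: fun_eq_iff\<close>)
    then show ?thesis using N(3)[OF _ _ A] N'(3)[OF _ _ A] True by simp
  next
    case False
    moreover have "c \<ge> 0" unfolding c_def using W by simp
    ultimately have "c = 0" by simp
    then have "AE w in M. W w = 0" "AE w in M. W' w = 0"
      using integral_nonneg_eq_0_iff_AE[of M W] integral_nonneg_eq_0_iff_AE[of M W'] W W' intW c'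
      by (auto simp: c_def)
    then have "(LINT w|M. W w * indicator A (X w)) = (LINT w|M. 0)" "(LINT w|M. W' w * indicator A (Y w)) = (LINT w|M. 0)"
      by (intro integral_cong_AE; auto)+
    then show ?thesis by simp
  qed
qed

text \<open>The weights \<open>V * (1 + cos \<theta>)\<close> and \<open>V * (1 + sin \<theta>)\<close> are nonnegative, so uniqueness for
  probability laws on the line applies to them; this replaces one coordinate at a time.\<close>
lemma joint_char_unique_step:
  fixes V V' \<theta> \<theta>' X Y :: "'w \<Rightarrow> real"
  assumes "prob_space M" and [measurable]: "V \<in> borel_measurable M" "X \<in> borel_measurable M"
    "V' \<in> borel_measurable M" "Y \<in> borel_measurable M"
    "\<theta> \<in> borel_measurable M" "\<theta>' \<in> borel_measurable M"
    and V: "\<And>w. 0 \<le> V w" "\<And>w. V w \<le> 1" and V': "\<And>w. 0 \<le> V' w" "\<And>w. V' w \<le> 1"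
    and eq: "\<And>r t. (LINT w|M. V w * cis (r * \<theta> w + t * X w)) = (LINT w|M. V' w * cis (r * \<theta>' w + t * Y w))"
    and A[measurable]: "A \<in> sets borel"
  shows "(LINT w|M. V w * indicator A (X w) * cis (\<theta> w)) = (LINT w|M. V' w * indicator A (Y w) * cis (\<theta>' w))"
proof -
  interpret prob_space M by fact
  have int: "integrable M (\<lambda>w. V w * cis (r * \<theta> w + t * X w))" "integrable M (\<lambda>w. V' w * cis (r * \<theta>' w + t * Y w))" for r t
    by (rule integrable_const_bound[where B=1]; use V V' in \<open>auto simp: norm_mult cis_conv_exp\<close>)+
  have int2: "integrable M (\<lambda>w. V w * f (\<theta> w) * indicator A (X w))" "integrable M (\<lambda>w. V' w * f (\<theta>' w) * indicator A (Y w))"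
    if [measurable]: "f \<in> borel_measurable borel" and f: "\<And>x. \<bar>f x\<bar> \<le> 1" for f :: "real \<Rightarrow> real"
    by (rule integrable_const_bound[where B=1]; use V V' f in \<open>auto simp: abs_mult indicator_def intro!: mult_le_one\<close>)+
  \<comment> \<open>When \<open>f\<close> is a combination of \<open>cis\<close> and its conjugate,
    the transform against the weight \<open>V * (1 + f \<theta>)\<close> combines the instances
    \<open>r = 0\<close>, \<open>r = 1\<close> and \<open>r = -1\<close> of the hypothesis.\<close>
  have key: "(LINT w|M. V w * (1 + f (\<theta> w)) * indicator A (X w)) = (LINT w|M. V' w * (1 + f (\<theta>' w)) * indicator A (Y w))"
    if [measurable]: "f \<in> borel_measurable borel" and f: "\<And>x. \<bar>f x\<bar> \<le> 1" 
     and ab: "\<And>x. complex_of_real (f x) = a * cis x + b * cis (- x)" for f :: "real \<Rightarrow> real" and a b :: complex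
  proof (rule weighted_char_unique[where B=2, OF \<open>prob_space M\<close>])
    have f': "- 1 \<le> f x" "f x \<le> 1" for x using f[of x] by auto
    then have f'': "0 \<le> 1 + f x" "1 + f x \<le> 2" for x by (smt (verit) f')+
    show "0 \<le> V w * (1 + f (\<theta> w))" "V w * (1 + f (\<theta> w)) \<le> 2" 
      "0 \<le> V' w * (1 + f (\<theta>' w))" "V' w * (1 + f (\<theta>' w)) \<le> 2" for w
      using V f'' V' mult_mono[of "V w" 1 "1 + f (\<theta> w)" 2] mult_mono[of "V' w" 1 "1 + f (\<theta>' w)" 2] by auto
    fix t
    have *: "complex_of_real (v * (1 + f x)) * cis (t * y) = 
      v * cis (0 * x + t * y) + a * (v * cis (1 * x + t * y)) + b * (v * cis ((-1) * x + t * y))" for v x y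
      by (simp only: of_real_mult of_real_add of_real_1 ab cis_mult[symmetric])
        (simp add: algebra_simps cis_mult)
    show "(LINT w|M. complex_of_real (V w * (1 + f (\<theta> w))) * cis (t * X w)) =
        (LINT w|M. complex_of_real (V' w * (1 + f (\<theta>' w))) * cis (t * Y w))"
      unfolding * using int
      by (simp only: Bochner_Integration.integral_add Bochner_Integration.integrable_add
          integrable_mult_right integral_mult_right_zero eq)
  qed simp_all
  \<comment> \<open>With \<open>f = 0\<close> the weight is \<open>V\<close> alone; subtracting this
    case isolates the contribution of \<open>f\<close>.\<close>
  have 0: "(LINT w|M. V w * indicator A (X w)) = (LINT w|M. V' w * indicator A (Y w))"
    using key[of "\<lambda>_. 0" 0 0] by simp
  have f: "(LINT w|M. V w * f (\<theta> w) * indicator A (X w)) = (LINT w|M. V' w * f (\<theta>' w) * indicator A (Y w))"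
    if [measurable]: "f \<in> borel_measurable borel" and f: "\<And>x. \<bar>f x\<bar> \<le> 1" 
     and ab: "\<And>x. complex_of_real (f x) = a * cis x + b * cis (- x)" for f :: "real \<Rightarrow> real" and a b :: complex
    using key[OF that] 0 int2[OF that(1,2)] int2[of "\<lambda>_. 1"]
    by (simp add: distrib_left distrib_right)
  have c: "(LINT w|M. V w * cos (\<theta> w) * indicator A (X w)) = (LINT w|M. V' w * cos (\<theta>' w) * indicator A (Y w))"
    by (rule f[of cos "1/2" "1/2"]) (auto simp: complex_eq_iff)
  have s: "(LINT w|M. V w * sin (\<theta> w) * indicator A (X w)) = (LINT w|M. V' w * sin (\<theta>' w) * indicator A (Y w))"
    by (rule f[of sin "-\<i>/2" "\<i>/2"]) (auto simp: complex_eq_iff)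
  have *: "complex_of_real (v * indicator A x) * cis y = complex_of_real (v * cos y * indicator A x) + \<i> * complex_of_real (v * sin y * indicator A x)" for v x y
    by (auto simp: complex_eq_iff indicator_def)
  show ?thesis unfolding * 
    using int2[OF borel_measurable_continuous_onI[OF continuous_on_cos[OF continuous_on_id]] abs_cos_le_one]
      int2[OF borel_measurable_continuous_onI[OF continuous_on_sin[OF continuous_on_id]] abs_sin_le_one] c s
    by (simp only: Bochner_Integration.integral_add integrable_of_real integral_mult_right_zero integrable_mult_right integral_complex_of_real)
qed

text \<open>In \<open>main\<close> the first \<open>m\<close> coordinates carry indicators and the
  others still carry a character; each induction step converts one more coordinate. At
  \<open>m = k\<close> the identity compares the masses of boxes, which determine a law on a finite
  product.\<close>

lemma joint_char_unique:
  fixes X Y :: "nat \<Rightarrow> 'w \<Rightarrow> real"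
  assumes "prob_space M" and XY: "\<And>j. j < k \<Longrightarrow> X j \<in> borel_measurable M" "\<And>j. j < k \<Longrightarrow> Y j \<in> borel_measurable M"
    and eq: "\<And>c. (LINT w|M. cis (\<Sum>j<k. c j * X j w)) = (LINT w|M. cis (\<Sum>j<k. c j * Y j w))"
  shows "distr M (Pi\<^sub>M {..<k} (\<lambda>_. borel)) (\<lambda>w. \<lambda>j\<in>{..<k}. X j w)
       = distr M (Pi\<^sub>M {..<k} (\<lambda>_. borel)) (\<lambda>w. \<lambda>j\<in>{..<k}. Y j w)"
proof -
  interpret prob_space M by fact
  note [measurable] = XY
  have main: "(LINT w|M. (\<Prod>j<m. indicator (A j) (X j w) :: real) * cis (\<Sum>j\<in>{m..<k}. c j * X j w))
    = (LINT w|M. (\<Prod>j<m. indicator (A j) (Y j w) :: real) * cis (\<Sum>j\<in>{m..<k}. c j * Y j w))"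
    if "m \<le> k" and "\<And>j. j < k \<Longrightarrow> A j \<in> sets borel" for m A c
    using that(1)
  proof (induction m arbitrary: c)
    case 0
    then show ?case using eq[of c] by (simp add: atLeast0LessThan)
  next
    case (Suc m)
    note [measurable] = that(2)
    have m: "m < k" using Suc.prems by simp
    have pr: "0 \<le> (\<Prod>j<m. indicator (A j) (Z j w) :: real)" "(\<Prod>j<m. indicator (A j) (Z j w) :: real) \<le> 1" for Z :: "nat \<Rightarrow> 'w \<Rightarrow> real" and w
      by (auto intro!: prod_nonneg prod_le_1)
    have "(LINT w|M. (\<Prod>j<m. indicator (A j) (X j w) :: real) * indicator (A m) (X m w) * cis (\<Sum>j\<in>{Suc m..<k}. c j * X j w))
      = (LINT w|M. (\<Prod>j<m. indicator (A j) (Y j w) :: real) * indicator (A m) (Y m w) * cis (\<Sum>j\<in>{Suc m..<k}. c j * Y j w))"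
    proof (rule joint_char_unique_step[OF \<open>prob_space M\<close>])
      show "A m \<in> sets borel" using m that by auto
      fix r t
      \<comment> \<open>The phase of the remaining coordinates and the new frequency
        \<open>t\<close> of coordinate \<open>m\<close> form one linear combination, so the
        induction hypothesis covers both.\<close>
      have split: "r * (\<Sum>j\<in>{Suc m..<k}. c j * Z j w) + t * Z m w = (\<Sum>j\<in>{m..<k}. (if j = m then t else r * c j) * Z j w)" for Z :: "nat \<Rightarrow> 'w \<Rightarrow> real" and w
        using m by (subst (2) sum.atLeast_Suc_lessThan) (auto simp: sum_distrib_left mult.assoc intro!: sum.cong)
      show "(LINT w|M. complex_of_real (\<Prod>j<m. indicator (A j) (X j w)) * cis (r * (\<Sum>j\<in>{Suc m..<k}. c j * X j w) + t * X m w)) =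
        (LINT w|M. complex_of_real (\<Prod>j<m. indicator (A j) (Y j w)) * cis (r * (\<Sum>j\<in>{Suc m..<k}. c j * Y j w) + t * Y m w))"
        unfolding split using Suc.IH[of "\<lambda>j. if j = m then t else r * c j"] m by simp
    qed (use pr m in \<open>auto intro!: borel_measurable_sum borel_measurable_prod XY measurable_compose[OF XY(1)] measurable_compose[OF XY(2)] borel_measurable_times borel_measurable_indicator that\<close>)
    then show ?case by (simp add: mult.assoc)
  qed
  have ms: "(\<lambda>w. \<lambda>j\<in>{..<k}. Z j w) \<in> measurable M (Pi\<^sub>M {..<k} (\<lambda>_. borel))" if "\<And>j. j < k \<Longrightarrow> Z j \<in> borel_measurable M" for Z :: "nat \<Rightarrow> 'w \<Rightarrow> real"
    by (rule measurable_restrict) (use that in auto)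
  have em: "emeasure (distr M (Pi\<^sub>M {..<k} (\<lambda>_. borel)) (\<lambda>w. \<lambda>j\<in>{..<k}. Z j w)) (Pi\<^sub>E {..<k} A)
     = ennreal (LINT w|M. (\<Prod>j<k. indicator (A j) (Z j w) :: real))"
    if Z[measurable]: "\<And>j. j < k \<Longrightarrow> Z j \<in> borel_measurable M" and A: "\<And>j. j < k \<Longrightarrow> A j \<in> sets borel" for Z :: "nat \<Rightarrow> 'w \<Rightarrow> real" and A
  proof -
    have AA: "Pi\<^sub>E {..<k} A \<in> sets (Pi\<^sub>M {..<k} (\<lambda>_. borel))"
      by (rule sets_PiM_I_finite) (use A in auto)
    have "emeasure (distr M (Pi\<^sub>M {..<k} (\<lambda>_. borel)) (\<lambda>w. \<lambda>j\<in>{..<k}. Z j w)) (Pi\<^sub>E {..<k} A)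
      = emeasure M ((\<lambda>w. \<lambda>j\<in>{..<k}. Z j w) -` Pi\<^sub>E {..<k} A \<inter> space M)"
      by (rule emeasure_distr[OF ms[OF Z] AA])
    also have "\<dots> = ennreal (measure M ((\<lambda>w. \<lambda>j\<in>{..<k}. Z j w) -` Pi\<^sub>E {..<k} A \<inter> space M))"
      by (rule emeasure_eq_measure)
    also have "measure M ((\<lambda>w. \<lambda>j\<in>{..<k}. Z j w) -` Pi\<^sub>E {..<k} A \<inter> space M) = 
      (LINT w|M. indicator ((\<lambda>w. \<lambda>j\<in>{..<k}. Z j w) -` Pi\<^sub>E {..<k} A \<inter> space M) w)"
      by simp
    also have "\<dots> = (LINT w|M. (\<Prod>j<k. indicator (A j) (Z j w) :: real))"
      by (rule Bochner_Integration.integral_cong) (auto simp: indicator_def PiE_def Pi_def)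
    finally show ?thesis .
  qed
  show ?thesis
  proof (rule measure_eqI_PiM_finite[where I="{..<k}" and M="\<lambda>_. borel" and A="\<lambda>_::nat. Pi\<^sub>E {..<k} (\<lambda>_. UNIV)"])
    fix A assume "\<And>i. i \<in> {..<k} \<Longrightarrow> A i \<in> sets (borel :: real measure)"
    then have A: "\<And>i. i < k \<Longrightarrow> A i \<in> sets borel" by auto
    have "(LINT w|M. complex_of_real (\<Prod>j<k. indicator (A j) (X j w))) = (LINT w|M. complex_of_real (\<Prod>j<k. indicator (A j) (Y j w)))"
      using main[of k A "\<lambda>_. 0"] A by simp
    then have "(LINT w|M. (\<Prod>j<k. indicator (A j) (X j w) :: real)) = (LINT w|M. (\<Prod>j<k. indicator (A j) (Y j w)))"
      by (simp only: integral_complex_of_real of_real_eq_iff)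
    then show "emeasure (distr M (Pi\<^sub>M {..<k} (\<lambda>_. borel)) (\<lambda>w. \<lambda>j\<in>{..<k}. X j w)) (Pi\<^sub>E {..<k} A) = 
       emeasure (distr M (Pi\<^sub>M {..<k} (\<lambda>_. borel)) (\<lambda>w. \<lambda>j\<in>{..<k}. Y j w)) (Pi\<^sub>E {..<k} A)"
      using em[of X A] em[of Y A] XY A by simp
  qed (use em[of X "\<lambda>_. UNIV"] XY(1) in \<open>auto simp: space_PiM intro!: prod_algebraI_finite\<close>)
qed

section \<open>Convergence in probability\<close>

lemma tendsto_zero_upper:
  fixes f g :: "nat \<Rightarrow> real"
  assumes "g \<longlonglongrightarrow> c" "\<And>n. f n \<le> g n" "c = 0" "\<And>n. 0 \<le> f n"
  shows "f \<longlonglongrightarrow> 0"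
  by (rule tendsto_sandwich[OF _ _ tendsto_const[of 0] assms(1)[unfolded assms(3)]]) (use assms in auto)

text \<open>A nonintegrable \<open>f\<close> has integral 0 by convention, and then the claim is the
  nonnegativity of the integral of \<open>g\<close>.\<close>

lemma norm_integral_le:
  fixes f :: "'a \<Rightarrow> 'b::{banach,second_countable_topology}"
  assumes "integrable M g" "\<And>x. x \<in> space M \<Longrightarrow> norm (f x) \<le> g x"
  shows "norm (integral\<^sup>L M f) \<le> integral\<^sup>L M g"
proof (cases "integrable M f")
  case True
  have "norm (integral\<^sup>L M f) \<le> (LINT x|M. norm (f x))" by (rule integral_norm_bound)
  also have "\<dots> \<le> integral\<^sup>L M g" by (rule integral_mono) (use assms True in auto)
  finally show ?thesis .
next
  case False
  have "0 \<le> integral\<^sup>L M g"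
    using assms(2) order_trans[OF norm_ge_zero] by (intro Bochner_Integration.integral_nonneg) blast
  then show ?thesis using False by (simp add: not_integrable_integral_eq)
qed

text \<open>A bounded pseudometric for convergence in probability. Its triangle inequality replaces
  computations with exceptional events.\<close>

definition prob_dist :: "'w measure \<Rightarrow> ('w \<Rightarrow> real) \<Rightarrow> ('w \<Rightarrow> real) \<Rightarrow> real" where
  "prob_dist M X Y = (LINT w|M. min 1 \<bar>X w - Y w\<bar>)"

context prob_space begin

lemma integrable_min_one:
  assumes [measurable]: "X \<in> borel_measurable M" "Y \<in> borel_measurable M"
  shows "integrable M (\<lambda>w. min 1 \<bar>X w - Y w :: real\<bar>)"
  by (rule integrable_const_bound[where B=1]) auto

lemma prob_dist_nonneg: "prob_dist M X Y \<ge> 0"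
  unfolding prob_dist_def by (intro Bochner_Integration.integral_nonneg) auto

lemma prob_dist_commute: "prob_dist M X Y = prob_dist M Y X"
  unfolding prob_dist_def by (simp add: abs_minus_commute)

lemma prob_dist_triangle:
  assumes [measurable]: "X \<in> borel_measurable M" "Y \<in> borel_measurable M" "Z \<in> borel_measurable M"
  shows "prob_dist M X Z \<le> prob_dist M X Y + prob_dist M Y Z"
  unfolding prob_dist_def
  by (subst Bochner_Integration.integral_add[symmetric])
    (auto intro!: integral_mono integrable_min_one Bochner_Integration.integrable_add)

text \<open>One direction splits the expectation at the level \<open>e/2\<close>. The other is
  Markov's inequality at the level \<open>min 1 e\<close>, since the integrand is capped at
  1.\<close>

lemma conv_in_prob_iff:
  assumes [measurable]: "\<And>n. X n \<in> borel_measurable M" "Y \<in> borel_measurable M"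
  shows "conv_in_prob M X Y \<longleftrightarrow> (\<lambda>n. prob_dist M (X n) Y) \<longlonglongrightarrow> 0"
proof
  assume *: "conv_in_prob M X Y"
  show "(\<lambda>n. prob_dist M (X n) Y) \<longlonglongrightarrow> 0"
  proof (rule LIMSEQ_I)
    fix e :: real assume e: "e > 0"
    have "(\<lambda>n. measure M {w\<in>space M. e/2 < \<bar>X n w - Y w\<bar>}) \<longlonglongrightarrow> 0"
      using *[unfolded conv_in_prob_def, rule_format, of "e/2"] e by simp
    then have "\<forall>\<^sub>F n in sequentially. measure M {w\<in>space M. \<bar>X n w - Y w\<bar> > e/2} < e/2"
      using e by (auto dest!: order_tendstoD(2)[where a="e/2"])
    then obtain N where N: "\<And>n. n \<ge> N \<Longrightarrow> measure M {w\<in>space M. \<bar>X n w - Y w\<bar> > e/2} < e/2"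
      unfolding eventually_sequentially by auto
    have "prob_dist M (X n) Y < e" if "n \<ge> N" for n
    proof -
      have m: "{w\<in>space M. \<bar>X n w - Y w\<bar> > e/2} \<in> sets M" by measurable
      then have ii: "integrable M (indicator {w\<in>space M. \<bar>X n w - Y w\<bar> > e/2} :: _ \<Rightarrow> real)"
        by (intro integrable_real_indicator) (auto simp: less_top[symmetric])
      have "prob_dist M (X n) Y \<le> (LINT w|M. e/2 + indicator {w\<in>space M. \<bar>X n w - Y w\<bar> > e/2} w)"
        unfolding prob_dist_def
        by (intro integral_mono integrable_min_one Bochner_Integration.integrable_add integrable_const ii)
          (use e in \<open>auto simp: indicator_def min_def less_top[symmetric] emeasure_eq_measure split: if_splits simp del: less_divide_eq_numeral1 divide_less_eq_numeral1\<close>)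
      also have "\<dots> = e/2 + measure M {w\<in>space M. \<bar>X n w - Y w\<bar> > e/2}"
        using ii m by (subst Bochner_Integration.integral_add) (auto simp: prob_space)
      finally show ?thesis using N[OF that] by simp
    qed
    then show "\<exists>no. \<forall>n\<ge>no. norm (prob_dist M (X n) Y - 0) < e"
      using prob_dist_nonneg by (auto intro!: exI[of _ N])
  qed
next
  assume *: "(\<lambda>n. prob_dist M (X n) Y) \<longlonglongrightarrow> 0"
  show "conv_in_prob M X Y"
    unfolding conv_in_prob_def
  proof safe
    fix e :: real assume e: "e > 0"
    have b: "measure M {w\<in>space M. \<bar>X n w - Y w\<bar> > e} \<le> prob_dist M (X n) Y / min 1 e" for n
    proof -
      have m: "{w\<in>space M. \<bar>X n w - Y w\<bar> > e} \<in> sets M" by measurable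
      then have ii: "integrable M (indicator {w\<in>space M. \<bar>X n w - Y w\<bar> > e} :: _ \<Rightarrow> real)"
        by (intro integrable_real_indicator) (auto simp: less_top[symmetric])
      have "min 1 e * measure M {w\<in>space M. \<bar>X n w - Y w\<bar> > e} = (LINT w|M. min 1 e * indicator {w\<in>space M. \<bar>X n w - Y w\<bar> > e} w)"
        by simp
      also have "\<dots> \<le> prob_dist M (X n) Y"
        unfolding prob_dist_def
        by (intro integral_mono integrable_min_one integrable_mult_right ii) (use e in \<open>auto simp: indicator_def\<close>)
      finally show ?thesis using e by (simp add: pos_le_divide_eq mult.commute)
    qed
    have "min 1 e \<noteq> 0" using e by auto
    then have "(\<lambda>n. prob_dist M (X n) Y / min 1 e) \<longlonglongrightarrow> 0 / min 1 e"
      by (rule tendsto_divide[OF * tendsto_const])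
    then show "(\<lambda>n. measure M {w\<in>space M. \<bar>X n w - Y w\<bar> > e}) \<longlonglongrightarrow> 0"
      by (rule tendsto_zero_upper) (use b in auto)
  qed
qed

lemma prob_dist_AE_cong:
  assumes [measurable]: "X \<in> borel_measurable M" "X' \<in> borel_measurable M" "Y \<in> borel_measurable M" "Y' \<in> borel_measurable M"
   and "AE w in M. \<bar>X w - Y w\<bar> = \<bar>X' w - Y' w\<bar>"
  shows "prob_dist M X Y = prob_dist M X' Y'"
  unfolding prob_dist_def by (rule integral_cong_AE) (use assms(5) in auto)

lemma conv_in_prob_AE_cong:
  assumes [measurable]: "\<And>n. X n \<in> borel_measurable M" "\<And>n. X' n \<in> borel_measurable M" "Y \<in> borel_measurable M"
    and eq: "\<And>n. AE w in M. X n w = X' n w" and c: "conv_in_prob M X Y"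
  shows "conv_in_prob M X' Y"
proof -
  have "prob_dist M (X n) Y = prob_dist M (X' n) Y" for n
    by (rule prob_dist_AE_cong) (use eq[of n] in auto)
  then show ?thesis using c by (simp add: conv_in_prob_iff)
qed

lemma prob_dist_zero_AE:
  assumes [measurable]: "X \<in> borel_measurable M" "Y \<in> borel_measurable M" and "prob_dist M X Y = 0"
  shows "AE w in M. X w = Y w"
proof -
  have "AE w in M. min 1 \<bar>X w - Y w\<bar> = 0"
    using assms(3) integral_nonneg_eq_0_iff_AE[OF integrable_min_one[OF assms(1,2)]]
    unfolding prob_dist_def by auto
  then show ?thesis by eventually_elim (auto simp: min_def split: if_splits)
qed

lemma conv_in_prob_unique:
  assumes X[measurable]: "\<And>n. X n \<in> borel_measurable M" and Y[measurable]: "Y \<in> borel_measurable M" and Z[measurable]: "Z \<in> borel_measurable M"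
    and "conv_in_prob M X Y" "conv_in_prob M X Z"
  shows "AE w in M. Y w = Z w"
proof (rule prob_dist_zero_AE)
  have "(\<lambda>n. prob_dist M (X n) Y + prob_dist M (X n) Z) \<longlonglongrightarrow> 0 + 0"
    by (intro tendsto_add) (use assms conv_in_prob_iff in auto)
  moreover have "prob_dist M Y Z \<le> prob_dist M (X n) Y + prob_dist M (X n) Z" for n
    using prob_dist_triangle[OF Y X Z, of n] prob_dist_commute[of Y "X n"] by simp
  ultimately have "prob_dist M Y Z \<le> 0" by (intro LIMSEQ_le_const) auto
  then show "prob_dist M Y Z = 0" using prob_dist_nonneg[of Y Z] by simp
qed auto

lemma conv_in_prob_lincomb:
  assumes [measurable]: "\<And>n. X n \<in> borel_measurable M" "Y \<in> borel_measurable M" "\<And>n. X' n \<in> borel_measurable M" "Y' \<in> borel_measurable M"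
    and c: "conv_in_prob M X Y" "conv_in_prob M X' Y'"
  shows "conv_in_prob M (\<lambda>n w. a * X n w + b * X' n w) (\<lambda>w. a * Y w + b * Y' w)"
proof (subst conv_in_prob_iff)
  have "(\<lambda>n. (1 + \<bar>a\<bar>) * prob_dist M (X n) Y + (1 + \<bar>b\<bar>) * prob_dist M (X' n) Y') \<longlonglongrightarrow> (1 + \<bar>a\<bar>) * 0 + (1 + \<bar>b\<bar>) * 0"
    by (intro tendsto_intros) (use c conv_in_prob_iff in auto)
  moreover have "prob_dist M (\<lambda>w. a * X n w + b * X' n w) (\<lambda>w. a * Y w + b * Y' w) \<le> (1 + \<bar>a\<bar>) * prob_dist M (X n) Y + (1 + \<bar>b\<bar>) * prob_dist M (X' n) Y'" for n
  proof -
    \<comment> \<open>The cap breaks homogeneity. The factor \<open>1 + \<bar>c\<bar>\<close> is at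
      least \<open>\<bar>c\<bar>\<close> where the cap is inactive and at least 1 where it is
      active.\<close>
    have pt: "min 1 \<bar>c * u\<bar> \<le> (1 + \<bar>c\<bar>) * min 1 \<bar>u\<bar>" for c u :: real
    proof (cases "\<bar>u\<bar> \<le> 1")
      case True
      then have "(1 + \<bar>c\<bar>) * min 1 \<bar>u\<bar> = \<bar>u\<bar> + \<bar>c * u\<bar>" by (simp add: abs_mult algebra_simps)
      then show ?thesis by simp
    next
      case False
      then have "min 1 \<bar>u\<bar> = 1" by simp
      then show ?thesis by simp
    qed
    have mt: "min 1 \<bar>u + v\<bar> \<le> min 1 \<bar>u\<bar> + min 1 \<bar>v\<bar>" for u v :: real by linarith
    have "min 1 \<bar>(a * x + b * x') - (a * y + b * y')\<bar> \<le> min 1 \<bar>a * (x - y)\<bar> + min 1 \<bar>b * (x' - y')\<bar>" for x x' y y' :: real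
      using mt[of "a * (x - y)" "b * (x' - y')"] by (simp add: algebra_simps)
    then have "min 1 \<bar>(a * x + b * x') - (a * y + b * y')\<bar> \<le> (1 + \<bar>a\<bar>) * min 1 \<bar>x - y\<bar> + (1 + \<bar>b\<bar>) * min 1 \<bar>x' - y'\<bar>" for x x' y y' :: real
      using pt[of a "x - y"] pt[of b "x' - y'"] by (meson add_mono order_trans)
    then have "prob_dist M (\<lambda>w. a * X n w + b * X' n w) (\<lambda>w. a * Y w + b * Y' w) \<le> 
       (LINT w|M. (1 + \<bar>a\<bar>) * min 1 \<bar>X n w - Y w\<bar> + (1 + \<bar>b\<bar>) * min 1 \<bar>X' n w - Y' w\<bar>)"
      unfolding prob_dist_def
      by (intro integral_mono integrable_min_one Bochner_Integration.integrable_add integrable_mult_right) auto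
    then show ?thesis unfolding prob_dist_def 
      by (subst (asm) Bochner_Integration.integral_add) (auto intro!: integrable_min_one)
  qed
  ultimately show "(\<lambda>n. prob_dist M (\<lambda>w. a * X n w + b * X' n w) (\<lambda>w. a * Y w + b * Y' w)) \<longlonglongrightarrow> 0"
    by (rule tendsto_zero_upper) (auto simp: prob_dist_nonneg)
qed auto

text \<open>\<open>cis\<close> is 1-Lipschitz and its values differ by at most 2, so the difference
  of the expectations is at most twice \<open>prob_dist\<close>.\<close>

lemma conv_in_prob_char:
  assumes [measurable]: "\<And>n. X n \<in> borel_measurable M" "Y \<in> borel_measurable M" and c: "conv_in_prob M X Y"
  shows "(\<lambda>n. LINT w|M. cis (X n w)) \<longlonglongrightarrow> (LINT w|M. cis (Y w))"
proof (rule LIM_zero_cancel, rule tendsto_norm_zero_cancel)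
  have ic: "integrable M (\<lambda>w. cis (Z w))" if [measurable]: "Z \<in> borel_measurable M" for Z
    by (rule integrable_const_bound[where B=1]) (auto simp: cis_conv_exp)
  have cis: "norm (cis u - cis v) \<le> 2 * min 1 \<bar>u - v\<bar>" for u v :: real
  proof -
    have "cis u - cis v = cis v * (cis (u - v) - 1)" by (simp add: algebra_simps cis_mult)
    then have "norm (cis u - cis v) = norm (cis (u - v) - 1)" by (simp add: norm_mult)
    also have "\<dots> \<le> \<bar>u - v\<bar>" using iexp_approx1[of "u - v" 0] by (simp add: cis_conv_exp)
    finally have 1: "norm (cis u - cis v) \<le> \<bar>u - v\<bar>" .
    have "norm (cis u - cis v) \<le> norm (cis u) + norm (cis v)" by (rule norm_triangle_ineq4)
    with 1 norm_ge_zero[of "cis u - cis v"] show ?thesis unfolding min_def by (auto simp del: norm_ge_zero)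
  qed
  have bnd: "norm ((LINT w|M. cis (X n w)) - (LINT w|M. cis (Y w))) \<le> 2 * prob_dist M (X n) Y" for n
  proof -
    have "norm ((LINT w|M. cis (X n w)) - (LINT w|M. cis (Y w))) = norm (LINT w|M. cis (X n w) - cis (Y w))"
      by (subst Bochner_Integration.integral_diff) (auto intro!: ic)
    also have "\<dots> \<le> (LINT w|M. 2 * min 1 \<bar>X n w - Y w\<bar>)"
      by (rule norm_integral_le) (auto intro!: ic integrable_min_one cis)
    finally show ?thesis unfolding prob_dist_def by simp
  qed
  have "(\<lambda>n. 2 * prob_dist M (X n) Y) \<longlonglongrightarrow> 2 * 0"
    by (intro tendsto_intros) (use c conv_in_prob_iff in auto)
  then show "(\<lambda>n. norm ((LINT w|M. cis (X n w)) - (LINT w|M. cis (Y w)))) \<longlonglongrightarrow> 0"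
    by (rule tendsto_zero_upper) (use bnd in auto)
qed

text \<open>Integrating the characteristic functions against a standard normal law turns them into
  the expectations of \<open>exp (- X\<^sup>2 / 2)\<close>.\<close>
lemma conv_in_prob_zero_of_char:
  assumes [measurable]: "\<And>n. X n \<in> borel_measurable M" 
    and c: "\<And>z. (\<lambda>n. LINT w|M. cis (z * X n w)) \<longlonglongrightarrow> 1"
  shows "conv_in_prob M X (\<lambda>_. 0)"
proof (subst conv_in_prob_iff)
  let ?N = "std_normal_distribution"
  interpret N: real_distribution ?N by (rule real_dist_normal_dist)
  interpret P: pair_prob_space M ?N ..
  have char: "(LINT z|?N. cis (z * x)) = exp (- (x^2) / 2)" for x
    using fun_cong[OF char_std_normal_distribution, of x] by (simp add: char_def cis_conv_exp mult.commute)
  define cf where "cf n z = (LINT w|M. cis (z * X n w))" for n z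
  have swap: "integral\<^sup>L ?N (cf n) = complex_of_real (LINT w|M. exp (- (X n w)\<^sup>2 / 2))" for n
  proof -
    have "integral\<^sup>L ?N (cf n) = integral\<^sup>L M (\<lambda>w. LINT z|?N. cis (z * X n w))"
      unfolding cf_def
      by (rule P.Fubini_integral[where f="\<lambda>w z. cis (z * X n w)"], rule P.integrable_const_bound[where B=1])
        (auto simp: cis_conv_exp split_beta')
    then show ?thesis unfolding char by simp
  qed
  have "(\<lambda>n. integral\<^sup>L ?N (cf n)) \<longlonglongrightarrow> (LINT z|?N. 1)"
    unfolding cf_def
  proof (rule integral_dominated_convergence[where w="\<lambda>_. 1"])
    show "AE z in ?N. norm (LINT w|M. cis (z * X n w)) \<le> 1" for n
    proof (intro AE_I2)
      fix z
      have "norm (LINT w|M. cis (z * X n w)) \<le> (LINT w|M. 1)"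
        by (rule norm_integral_le) (auto intro!: integrable_const_bound[where B=1] simp: cis_conv_exp)
      then show "norm (LINT w|M. cis (z * X n w)) \<le> 1" by (simp add: prob_space)
    qed
    show "(\<lambda>z. LINT w|M. cis (z * X n w)) \<in> borel_measurable ?N" for n
      by (rule borel_measurable_lebesgue_integral) (auto simp: cis_conv_exp)
  qed (use c in auto)
  moreover have "(LINT z|?N. 1 :: complex) = 1" using N.prob_space by simp
  ultimately have "(\<lambda>n. complex_of_real (LINT w|M. exp (- (X n w)\<^sup>2 / 2))) \<longlonglongrightarrow> complex_of_real 1"
    unfolding swap by simp
  then have l: "(\<lambda>n. LINT w|M. exp (- (X n w)\<^sup>2 / 2)) \<longlonglongrightarrow> 1" 
    by (simp only: tendsto_of_real_iff)
  have ie: "integrable M (\<lambda>w. exp (- (X n w)\<^sup>2 / 2))" for n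
    by (rule integrable_const_bound[where B=1]) auto
  \<comment> \<open>A lower bound for \<open>1 - exp (- x\<^sup>2 / 2)\<close> by the squared capped
    distance. The constant 4 comes from \<open>1 / (1 + y/2) \<le> 1 - y/4\<close> on the unit
    interval.\<close>
  have le: "(min 1 \<bar>x\<bar>)^2 \<le> 4 * (1 - exp (- x\<^sup>2 / 2))" for x :: real
  proof -
    define y where "y = min 1 (x\<^sup>2)"
    have y: "0 \<le> y" "y \<le> 1" "y \<le> x\<^sup>2" by (auto simp: y_def)
    have "(1 + y/2) * exp (- y/2) \<le> 1"
      using exp_ge_add_one_self[of "y/2"] by (simp add: exp_minus field_simps)
    then have "exp (- y/2) \<le> 1 / (1 + y/2)" using y by (simp add: field_simps)
    also have "\<dots> \<le> 1 - y/4"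
    proof -
      have "y * y \<le> 1 * y" using y by (intro mult_right_mono) auto
      then show ?thesis using y by (simp add: field_simps)
    qed
    finally have "y \<le> 4 * (1 - exp (- y / 2))" by simp
    also have "\<dots> \<le> 4 * (1 - exp (- x\<^sup>2 / 2))" using y by simp
    finally have "y \<le> 4 * (1 - exp (- x\<^sup>2 / 2))" .
    moreover have "(min 1 \<bar>x\<bar>)\<^sup>2 = y"
    proof (cases "\<bar>x\<bar> \<le> 1")
      case True
      then have "x\<^sup>2 \<le> 1" by (simp add: abs_square_le_1)
      with True show ?thesis by (simp add: y_def min_def)
    next
      case False
      then have "\<not> x\<^sup>2 \<le> 1" by (simp add: abs_square_le_1)
      with False show ?thesis by (simp add: y_def min_def)
    qed
    ultimately show ?thesis by simp
  qed
  have bnd: "(prob_dist M (X n) (\<lambda>_. 0))\<^sup>2 \<le> 4 * (1 - (LINT w|M. exp (- (X n w)\<^sup>2 / 2)))" for n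
  proof -
    have sq: "integrable M (\<lambda>w. (min 1 \<bar>X n w\<bar>)\<^sup>2)"
      by (rule integrable_const_bound[where B=1]) (auto simp: abs_square_le_1)
    \<comment> \<open>Jensen's inequality for the square, in the form that a variance is
      nonnegative.\<close>
    have "(prob_dist M (X n) (\<lambda>_. 0))\<^sup>2 \<le> (LINT w|M. (min 1 \<bar>X n w\<bar>)\<^sup>2)"
      using Bochner_Integration.integral_nonneg[of M "\<lambda>w. (min 1 \<bar>X n w\<bar> - (LINT w|M. min 1 \<bar>X n w\<bar>))\<^sup>2"] integrable_min_one[of "X n" "\<lambda>_. 0"] sq
        variance_eq[of "\<lambda>w. min 1 \<bar>X n w\<bar>"]
      unfolding prob_dist_def by (simp del: Bochner_Integration.integral_nonneg)
    also have "\<dots> \<le> (LINT w|M. 4 * (1 - exp (- (X n w)\<^sup>2 / 2)))"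
      by (rule integral_mono) (use sq ie le in auto)
    also have "\<dots> = 4 * (1 - (LINT w|M. exp (- (X n w)\<^sup>2 / 2)))"
      using ie by (simp add: prob_space)
    finally show ?thesis .
  qed
  have "(\<lambda>n. 4 * (1 - (LINT w|M. exp (- (X n w)\<^sup>2 / 2)))) \<longlonglongrightarrow> 4 * (1 - 1)"
    by (intro tendsto_intros l)
  then have "(\<lambda>n. (prob_dist M (X n) (\<lambda>_. 0))\<^sup>2) \<longlonglongrightarrow> 0"
    by (rule tendsto_zero_upper) (use bnd in auto)
  then show "(\<lambda>n. prob_dist M (X n) (\<lambda>_. 0)) \<longlonglongrightarrow> 0" by (subst (asm) power_tendsto_0_iff) auto
qed auto

text \<open>A subsequence whose successive distances are at most \<open>(1/2)^k\<close> has almost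
  surely summable increments and so converges almost surely. Dominated convergence turns this into
  convergence of \<open>prob_dist\<close>, and the Cauchy condition carries it to the whole
  sequence.\<close>

lemma prob_Cauchy_convergent:
  assumes X[measurable]: "\<And>n. X n \<in> borel_measurable M" 
    and C: "\<And>e. e > 0 \<Longrightarrow> \<exists>N. \<forall>m\<ge>N. \<forall>n\<ge>N. prob_dist M (X m) (X n) < e"
  shows "\<exists>Y\<in>borel_measurable M. conv_in_prob M X Y"
proof -
  have "\<exists>N. \<forall>m\<ge>N. \<forall>n\<ge>N. prob_dist M (X m) (X n) < (1/2)^k" for k by (rule C) simp
  then obtain N where N: "\<And>k m n. m \<ge> N k \<Longrightarrow> n \<ge> N k \<Longrightarrow> prob_dist M (X m) (X n) < (1/2)^k" by metis
  \<comment> \<open>Partial sums make the indices nondecreasing while keeping \<open>r k\<close>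
    above the threshold \<open>N k\<close>.\<close>
  define r where "r k = (\<Sum>i\<le>k. N i)" for k
  have r: "N k \<le> r k" "r k \<le> r (Suc k)" for k unfolding r_def by (auto intro: member_le_sum)
  define D where "D k w = min 1 \<bar>X (r (Suc k)) w - X (r k) w\<bar>" for k w
  have [measurable]: "D k \<in> borel_measurable M" for k unfolding D_def by measurable
  have D: "(\<integral>\<^sup>+w. ennreal (D k w) \<partial>M) \<le> ennreal ((1/2)^k)" for k
  proof -
    have "(\<integral>\<^sup>+w. ennreal (D k w) \<partial>M) = ennreal (prob_dist M (X (r (Suc k))) (X (r k)))"
      unfolding D_def prob_dist_def by (rule nn_integral_eq_integral) (auto intro: integrable_min_one)
    also have "\<dots> \<le> ennreal ((1/2)^k)"
      using N[of k "r (Suc k)" "r k"] r[of k] by (intro ennreal_leI) simp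
    finally show ?thesis .
  qed
  have "(\<integral>\<^sup>+w. (\<Sum>k. ennreal (D k w)) \<partial>M) = (\<Sum>k. \<integral>\<^sup>+w. ennreal (D k w) \<partial>M)"
    by (rule nn_integral_suminf) measurable
  also have "\<dots> \<le> (\<Sum>k. ennreal ((1/2)^k))" by (rule suminf_le) (use D in auto)
  also have "\<dots> = ennreal (\<Sum>k. (1/2)^k)" by (rule suminf_ennreal2) auto
  also have "\<dots> < \<infinity>" by simp
  finally have "AE w in M. (\<Sum>k. ennreal (D k w)) \<noteq> \<infinity>"
    by (intro nn_integral_PInf_AE) auto
  then have conv: "AE w in M. convergent (\<lambda>k. X (r k) w)"
  proof eventually_elim
    case (elim w)
    have s: "summable (\<lambda>k. D k w)"
      by (rule summable_suminf_not_top) (use elim in \<open>auto simp: D_def\<close>)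
    then have "(\<lambda>k. D k w) \<longlonglongrightarrow> 0" by (rule summable_LIMSEQ_zero)
    \<comment> \<open>Below 1 the cap is inactive, so \<open>D k w\<close> is the true size of the
      increment.\<close>
    then have "\<forall>\<^sub>F k in sequentially. D k w < 1" by (rule order_tendstoD) simp
    then have "\<forall>\<^sub>F k in sequentially. norm (X (r (Suc k)) w - X (r k) w) \<le> D k w"
      by eventually_elim (auto simp: D_def min_def split: if_splits)
    then have "summable (\<lambda>k. X (r (Suc k)) w - X (r k) w)"
      using s by (rule summable_comparison_test_ev)
    then have "convergent (\<lambda>n. X (r n) w - X (r 0) w)"
      unfolding summable_iff_convergent using sum_lessThan_telescope[of "\<lambda>k. X (r k) w"] by simp
    then show ?case using convergent_add_const_right_iff[of "\<lambda>k. X (r k) w" "- X (r 0) w"] by simp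
  qed
  \<comment> \<open>\<open>lim\<close> is total, so \<open>Y\<close> is measurable as it stands; its
    values on the null set of divergence do not affect the law.\<close>
  define Y where "Y w = lim (\<lambda>k. X (r k) w)" for w
  have Y[measurable]: "Y \<in> borel_measurable M" unfolding Y_def by measurable
  have "(\<lambda>k. LINT w|M. min 1 \<bar>X (r k) w - Y w\<bar>) \<longlonglongrightarrow> (LINT w|M. 0)"
  proof (rule integral_dominated_convergence[where w="\<lambda>_. 1"])
    show "AE w in M. (\<lambda>k. min 1 \<bar>X (r k) w - Y w\<bar>) \<longlonglongrightarrow> 0"
      using conv
    proof eventually_elim
      case (elim w)
      then have "(\<lambda>k. X (r k) w) \<longlonglongrightarrow> Y w" unfolding Y_def by (simp add: convergent_LIMSEQ_iff)
      then have "(\<lambda>k. min 1 \<bar>X (r k) w - Y w\<bar>) \<longlonglongrightarrow> min 1 \<bar>Y w - Y w\<bar>" by (intro tendsto_intros)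
      then show ?case by simp
    qed
  qed auto
  then have l: "(\<lambda>k. prob_dist M (X (r k)) Y) \<longlonglongrightarrow> 0" by (simp add: prob_dist_def)
  have "conv_in_prob M X Y"
  proof (subst conv_in_prob_iff)
    show "(\<lambda>n. prob_dist M (X n) Y) \<longlonglongrightarrow> 0"
    proof (rule LIMSEQ_I)
      fix e :: real assume e: "e > 0"
      have "\<forall>\<^sub>F k in sequentially. prob_dist M (X (r k)) Y < e/2" using l e by (auto dest!: order_tendstoD(2)[where a="e/2"])
      moreover have "\<forall>\<^sub>F k in sequentially. (1/2::real)^k < e/2"
        by (rule order_tendstoD(2)[OF LIMSEQ_power_zero]) (use e in auto)
      ultimately have "\<forall>\<^sub>F k in sequentially. prob_dist M (X (r k)) Y < e/2 \<and> (1/2)^k < e/2" by eventually_elim auto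
      then obtain k where k: "prob_dist M (X (r k)) Y < e/2" "(1/2)^k < e/2" by (auto simp: eventually_sequentially)
      have "prob_dist M (X n) Y < e" if "n \<ge> N k" for n
        using prob_dist_triangle[OF X X Y, of n "r k"] N[OF that r(1)] k by simp
      then show "\<exists>no. \<forall>n\<ge>no. norm (prob_dist M (X n) Y - 0) < e" using prob_dist_nonneg by (auto intro!: exI[of _ "N k"])
    qed
  qed auto
  then show ?thesis using Y by blast
qed

end

section \<open>The Levy exponent of exponentially decaying functions\<close>

text \<open>With this norm the exponential weight is a product over the coordinates, and the norm is
  the pairing of a vector with its own signs, which is what a shift of each frequency coordinate
  produces.\<close>

definition l1norm :: "real^'d::finite \<Rightarrow> real" where "l1norm x = (\<Sum>i\<in>UNIV. \<bar>x$i\<bar>)"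

lemma l1norm_triangle: "l1norm (x + y) \<le> l1norm x + l1norm y"
  unfolding l1norm_def sum.distrib[symmetric] by (intro sum_mono) simp

lemma component_le_l1norm: "\<bar>x$i\<bar> \<le> l1norm x"
  unfolding l1norm_def by (rule member_le_sum) auto

lemma continuous_on_l1norm[continuous_intros]: "continuous_on S f \<Longrightarrow> continuous_on S (\<lambda>x. l1norm (f x))"
  unfolding l1norm_def by (intro continuous_intros)

lemma borel_measurable_l1norm[measurable]: "l1norm \<in> borel_measurable borel"
  by (intro borel_measurable_continuous_onI continuous_intros)

lemma borel_measurable_vec_nth[measurable]: "(\<lambda>x::real^'d::finite. x $ i) \<in> borel_measurable borel"
  by (intro borel_measurable_continuous_onI continuous_intros)

lemma integral_lborel_prod_Basis:
  fixes f :: "'a::euclidean_space \<Rightarrow> real \<Rightarrow> 'b::{real_normed_field,banach,second_countable_topology}"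
  assumes f: "\<And>b. b \<in> Basis \<Longrightarrow> integrable lborel (f b)"
  shows "integrable lborel (\<lambda>x. \<Prod>b\<in>Basis. f b (x \<bullet> b))"
    and "(LINT x|lborel. (\<Prod>b\<in>Basis. f b (x \<bullet> b))) = (\<Prod>b\<in>Basis. LINT t|lborel. f b t)"
proof -
  interpret product_sigma_finite "\<lambda>_::'a. lborel :: real measure" ..
  have [measurable]: "b \<in> Basis \<Longrightarrow> f b \<in> borel_measurable borel" for b using f[of b] by auto
  have inner: "(\<Sum>b\<in>Basis. y b *\<^sub>R b) \<bullet> b' = y b'" if "b' \<in> Basis" for y and b' :: 'a
    using that by simp
  have int: "integrable (Pi\<^sub>M Basis (\<lambda>_. lborel)) (\<lambda>y. \<Prod>b\<in>Basis. f b (y b))"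
    by (rule product_integrable_prod[OF finite_Basis f])
  show "integrable lborel (\<lambda>x. \<Prod>b\<in>Basis. f b (x \<bullet> b))"
    by (subst lborel_eq, subst integrable_distr_eq) (auto simp: inner int cong: prod.cong)
  show "(LINT x|lborel. (\<Prod>b\<in>Basis. f b (x \<bullet> b))) = (\<Prod>b\<in>Basis. LINT t|lborel. f b t)"
    by (subst lborel_eq, subst integral_distr)
      (use product_integral_prod[OF finite_Basis f] in \<open>auto simp: inner cong: prod.cong\<close>)
qed

lemma prod_Basis_vec:
  "(\<Prod>b\<in>(Basis::(real^'d::finite) set). f b (x \<bullet> b)) = (\<Prod>i\<in>UNIV. f (axis i 1) (x $ i))"
proof -
  have "(\<Prod>b\<in>(Basis::(real^'d) set). f b (x \<bullet> b)) = (\<Prod>i\<in>UNIV. f (axis i 1) (x \<bullet> axis i 1))"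
    by (rule prod.reindex_cong[where l="\<lambda>i. axis i 1"])
      (auto simp: inj_on_def axis_eq_axis Basis_vec_def)
  then show ?thesis by (simp add: inner_axis)
qed

lemma integral_lborel_prod:
  fixes f :: "'d::finite \<Rightarrow> real \<Rightarrow> 'b::{real_normed_field,banach,second_countable_topology}"
  assumes f: "\<And>i. integrable lborel (f i)"
  shows "integrable lborel (\<lambda>x::real^'d. \<Prod>i\<in>UNIV. f i (x $ i))"
    and "(LINT x|lborel. (\<Prod>i\<in>UNIV. f i ((x::real^'d) $ i))) = (\<Prod>i\<in>UNIV. LINT t|lborel. f i t)"
proof -
  define g where "g b = f (axis_index b)" for b :: "real^'d"
  have g: "g (axis i 1) = f i" for i unfolding g_def by simp
  have p: "(\<Prod>b\<in>Basis. g b (x \<bullet> b)) = (\<Prod>i\<in>UNIV. f i (x $ i))" for x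
    by (subst prod_Basis_vec) (simp add: g)
  have q: "(\<Prod>b\<in>Basis. LINT t|lborel. g b t) = (\<Prod>i\<in>UNIV. LINT t|lborel. f i t)"
    using prod_Basis_vec[of "\<lambda>b _. LINT t|lborel. g b t"] by (simp add: g)
  have "b \<in> Basis \<Longrightarrow> integrable lborel (g b)" for b unfolding g_def by (rule f)
  from integral_lborel_prod_Basis[of g, OF this]
  show "integrable lborel (\<lambda>x::real^'d. \<Prod>i\<in>UNIV. f i (x $ i))"
    "(LINT x|lborel. (\<Prod>i\<in>UNIV. f i ((x::real^'d) $ i))) = (\<Prod>i\<in>UNIV. LINT t|lborel. f i t)"
    unfolding p q by auto
qed

lemma integrable_inverse_1_plus_square_lborel: "integrable lborel (\<lambda>t::real. 1 / (1 + t\<^sup>2))"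
  using integrable_inverse_1_plus_square by (simp add: set_integrable_def einterval_def inverse_eq_divide)

text \<open>The weight factorizes over the coordinates. The constant \<open>c\<close> is chosen so
  that \<open>c * (1 + t\<^sup>2)\<close> stays below the second-order Taylor bound of
  \<open>exp (\<delta> * \<bar>t\<bar>)\<close>, which leaves an integrable rational
  majorant.\<close>

lemma integrable_exp_l1norm:
  assumes "\<delta> > 0"
  shows "integrable lborel (\<lambda>x::real^'d::finite. exp (- \<delta> * l1norm x))"
proof -
  have 1: "integrable lborel (\<lambda>t::real. exp (- \<delta> * \<bar>t\<bar>))"
  proof (rule Bochner_Integration.integrable_bound)
    define c where "c = min 1 (\<delta>\<^sup>2 / 2)"
    have c: "0 < c" "c \<le> 1" "c \<le> \<delta>\<^sup>2 / 2" using assms by (auto simp: c_def)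
    show "integrable lborel (\<lambda>t::real. (1/c) * (1 / (1 + t\<^sup>2)))"
      by (intro integrable_mult_right integrable_inverse_1_plus_square_lborel)
    have "norm (exp (- \<delta> * \<bar>t\<bar>)) \<le> norm ((1/c) * (1 / (1 + t\<^sup>2)))" for t
    proof -
      have "c * (1 + t\<^sup>2) = c + c * t\<^sup>2" by (simp add: algebra_simps)
      also have "\<dots> \<le> 1 + (\<delta>\<^sup>2 / 2) * t\<^sup>2" using c by (intro add_mono mult_right_mono) auto
      also have "\<dots> \<le> 1 + \<delta> * \<bar>t\<bar> + (\<delta> * \<bar>t\<bar>)\<^sup>2 / 2" using assms by (simp add: power_mult_distrib)
      also have "\<dots> \<le> exp (\<delta> * \<bar>t\<bar>)" using assms by (intro exp_lower_Taylor_quadratic) auto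
      finally have *: "c * (1 + t\<^sup>2) \<le> exp (\<delta> * \<bar>t\<bar>)" .
      have p: "0 < c * (1 + t\<^sup>2)" using c by (intro mult_pos_pos) (auto simp: add_pos_nonneg)
      have "exp (- \<delta> * \<bar>t\<bar>) = 1 / exp (\<delta> * \<bar>t\<bar>)" by (simp add: exp_minus inverse_eq_divide)
      also have "\<dots> \<le> 1 / (c * (1 + t\<^sup>2))" by (rule divide_left_mono) (use * p in auto)
      finally show ?thesis using c by simp
    qed
    then show "AE t in lborel. norm (exp (- \<delta> * \<bar>t\<bar>)) \<le> norm ((1/c) * (1 / (1 + t\<^sup>2)))" by simp
  qed auto
  have "exp (- \<delta> * l1norm x) = (\<Prod>i\<in>UNIV. exp (- \<delta> * \<bar>x $ i\<bar>))" for x :: "real^'d"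
    unfolding l1norm_def by (simp add: sum_distrib_left exp_sum[symmetric] sum_negf)
  then show ?thesis using integral_lborel_prod(1)[of "\<lambda>_ t. exp (- \<delta> * \<bar>t\<bar>)", OF 1] by simp
qed

text \<open>The cap 2 matters only on a cube whose side is proportional to \<open>ln K\<close>; its
  volume is the source of the exponent of the logarithm.\<close>

lemma nn_integral_min_exp_l1norm:
  assumes "\<delta> > 0"
  shows "\<exists>A B. A \<ge> 0 \<and> B \<ge> 0 \<and> (\<forall>K\<ge>1. (\<integral>\<^sup>+x. ennreal (min 2 (K * exp (- \<delta> * l1norm (x::real^'d::finite)))) \<partial>lborel)
     \<le> ennreal (A + B * (ln K) ^ CARD('d)))"
proof (intro exI conjI allI impI)
  let ?A = "LINT x|lborel. exp (- (\<delta>/2) * l1norm (x::real^'d))"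
  let ?B = "2 * (4 / \<delta>) ^ CARD('d)"
  show A: "0 \<le> ?A" by (rule Bochner_Integration.integral_nonneg) simp
  show "0 \<le> ?B" using assms by simp
  fix K :: real assume K: "1 \<le> K"
  \<comment> \<open>Twice the radius at which \<open>K * exp (- \<delta> * l1norm x)\<close> falls
    to 1: beyond it, half of the decay rate pays for \<open>K\<close> and leaves an integrand free
    of \<open>K\<close>.\<close>
  define \<rho> where "\<rho> = 2 * ln K / \<delta>"
  have \<rho>: "\<rho> \<ge> 0" unfolding \<rho>_def using K assms by simp
  let ?box = "cbox (\<chi> i. - \<rho>) (\<chi> i. \<rho>) :: (real^'d) set"
  have le: "min 2 (K * exp (- \<delta> * l1norm x)) \<le> 2 * indicator ?box x + exp (- (\<delta>/2) * l1norm x)" for x :: "real^'d"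
  proof (cases "l1norm x \<le> \<rho>")
    case True
    have "x \<in> ?box"
      unfolding mem_box_cart using component_le_l1norm[of x] True by (auto simp: abs_le_iff) (smt (verit))+
    then show ?thesis by (simp add: min.coboundedI1)
  next
    case False
    have "K = exp (\<delta>/2 * \<rho>)" using K assms by (simp add: \<rho>_def)
    also have "\<dots> \<le> exp (\<delta>/2 * l1norm x)" using False assms by simp
    finally have "K * exp (- \<delta> * l1norm x) \<le> exp (\<delta>/2 * l1norm x) * exp (- \<delta> * l1norm x)"
      by (intro mult_right_mono) auto
    also have "\<dots> = exp (- (\<delta>/2) * l1norm x)" by (simp add: exp_add[symmetric] field_simps)
    finally show ?thesis by (intro min.coboundedI2) (auto simp: indicator_def)
  qed
  have "(\<integral>\<^sup>+x. ennreal (min 2 (K * exp (- \<delta> * l1norm (x::real^'d)))) \<partial>lborel)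
    \<le> (\<integral>\<^sup>+x. 2 * indicator ?box x + ennreal (exp (- (\<delta>/2) * l1norm x)) \<partial>lborel)"
  proof (rule nn_integral_mono)
    fix x :: "real^'d"
    show "ennreal (min 2 (K * exp (- \<delta> * l1norm x))) \<le> 2 * indicator ?box x + ennreal (exp (- (\<delta>/2) * l1norm x))"
      using ennreal_leI[OF le[of x]] by (cases "x \<in> ?box") (simp_all add: ennreal_plus[symmetric] ennreal_numeral[symmetric] del: ennreal_plus ennreal_numeral)
  qed
  also have "\<dots> = 2 * emeasure lborel ?box + ennreal ?A"
    using assms nn_integral_eq_integral[OF integrable_exp_l1norm[of "\<delta>/2", where 'd='d]]
    by (subst nn_integral_add) (simp_all add: nn_integral_cmult)
  also have "emeasure lborel ?box = ennreal ((2 * \<rho>) ^ CARD('d))"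
  proof -
    have "emeasure lborel ?box = ennreal (measure lborel ?box)"
      by (rule emeasure_eq_ennreal_measure) (simp only: less_top emeasure_lborel_cbox_finite[unfolded infinity_ennreal_def])
    also have "measure lborel ?box = (2 * \<rho>) ^ CARD('d)"
      using \<rho> by (subst content_cbox_cart) (auto simp: interval_ne_empty_cart)
    finally show ?thesis .
  qed
  also have "2 * ennreal ((2 * \<rho>) ^ CARD('d)) + ennreal ?A = ennreal (2 * (2 * \<rho>) ^ CARD('d) + ?A)"
    using \<rho> A by (simp add: ennreal_mult)
  also have "2 * (2 * \<rho>) ^ CARD('d) + ?A = ?A + ?B * (ln K) ^ CARD('d)"
    by (simp add: \<rho>_def power_mult_distrib[symmetric] power_divide[symmetric])
  finally show "(\<integral>\<^sup>+x. ennreal (min 2 (K * exp (- \<delta> * l1norm (x::real^'d)))) \<partial>lborel)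
    \<le> ennreal (?A + ?B * (ln K) ^ CARD('d))" .
qed

text \<open>For small jumps the compensator removes the linear term and a second-order estimate
  remains. For large jumps there is no compensator: the bound 2 controls the dependence on
  \<open>r\<close>, while \<open>\<bar>r\<bar> * U\<close> keeps the decay in
  \<open>U\<close>.\<close>

lemma levy_kernel_bound:
  fixes r u U :: real
  assumes "\<bar>u\<bar> \<le> U"
  shows "norm (cis (r * u) - 1 - \<i> * complex_of_real (r * u * indicator {-1..1} r))
    \<le> (if \<bar>r\<bar> \<le> 1 then U\<^sup>2 * r\<^sup>2 else min 2 (\<bar>r\<bar> * U))"
proof (cases "\<bar>r\<bar> \<le> 1")
  case True
  have "norm (cis (r * u) - 1 - \<i> * complex_of_real (r * u * indicator {-1..1} r)) \<le> (r * u)\<^sup>2 / 2"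
    using iexp_approx1[of "r * u" 1] True by (simp add: cis_conv_exp indicator_def abs_le_iff diff_diff_eq power2_eq_square)
  also have "\<dots> \<le> (r * u)\<^sup>2" by simp
  also have "\<dots> = u\<^sup>2 * r\<^sup>2" by (simp add: power_mult_distrib)
  also have "\<dots> \<le> U\<^sup>2 * r\<^sup>2" using assms by (intro mult_right_mono) (auto simp: abs_le_square_iff[symmetric])
  finally show ?thesis using True by simp
next
  case False
  have "norm (cis (r * u) - 1) \<le> \<bar>r * u\<bar>" using iexp_approx1[of "r * u" 0] by (simp add: cis_conv_exp)
  also have "\<dots> \<le> \<bar>r\<bar> * U" using assms by (simp add: abs_mult mult_left_mono)
  finally have 1: "norm (cis (r * u) - 1) \<le> \<bar>r\<bar> * U" .
  have 2: "norm (cis (r * u) - 1) \<le> 2" using norm_triangle_ineq4[of "cis (r * u)" 1] by simp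
  show ?thesis using False 1 2 by (auto simp: indicator_def)
qed

section \<open>Integrable majorants for the Levy exponent\<close>

context
  fixes \<nu> :: "real measure" and a \<gamma> :: real
  assumes levy: "levy_measure \<nu>" and a: "a \<ge> 0"
begin

lemma levy_measure_sets[measurable_cong]: "sets \<nu> = sets borel"
  using levy by (simp add: levy_measure_def)

lemma levy_measure_integrable_min: "integrable \<nu> (\<lambda>r. min 1 (r\<^sup>2))"
  using levy by (intro integrableI_nonneg) (auto simp: levy_measure_def)

text \<open>Prepares the exchange of the integrals over jumps and over space. The sets where
  \<open>min 1 (r\<^sup>2)\<close> is at least \<open>1 / (n + 1)\<close> have finite mass by
  Markov's inequality, and they miss only the null point 0.\<close>

lemma levy_measure_sigma_finite: "sigma_finite_measure \<nu>"
proof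
  define A where "A n = {r::real. 1 \<le> ennreal (Suc n) * ennreal (min 1 (r\<^sup>2))}" for n :: nat
  have A[measurable]: "A n \<in> sets borel" for n unfolding A_def by measurable
  have fin: "emeasure \<nu> (A n) \<noteq> \<infinity>" for n
  proof -
    have "emeasure \<nu> ({r\<in>space \<nu>. 1 \<le> ennreal (Suc n) * ennreal (min 1 (r\<^sup>2))}) \<le> ennreal (Suc n) * (\<integral>\<^sup>+ r. ennreal (min 1 (r\<^sup>2)) * indicator (space \<nu>) r \<partial>\<nu>)"
      by (rule nn_integral_Markov_inequality) (use sets.top[of \<nu>] in \<open>auto simp: levy_measure_sets\<close>)
    also have "\<dots> = ennreal (Suc n) * (\<integral>\<^sup>+ r. ennreal (min 1 (r\<^sup>2)) \<partial>\<nu>)"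
      by (intro arg_cong2[where f="(*)"] nn_integral_cong) auto
    also have "\<dots> < \<infinity>" using levy by (auto simp: levy_measure_def ennreal_mult_less_top)
    finally show ?thesis using sets_eq_imp_space_eq[OF levy_measure_sets] by (simp add: A_def)
  qed
  have cov: "r \<in> insert 0 (\<Union>n. A n)" for r
  proof (cases "r = 0")
    case False
    then have "min 1 (r\<^sup>2) > 0" by simp
    then obtain n :: nat where n: "1 / min 1 (r\<^sup>2) < n" using reals_Archimedean2 by blast
    then have "1 \<le> real (Suc n) * min 1 (r\<^sup>2)" using \<open>min 1 (r\<^sup>2) > 0\<close>
      by (simp add: pos_divide_less_eq algebra_simps) (smt (verit) \<open>0 < min 1 (r\<^sup>2)\<close>)
    then have "ennreal 1 \<le> ennreal (real (Suc n) * min 1 (r\<^sup>2))" by (rule ennreal_leI)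
    then have "r \<in> A n" unfolding A_def by (simp add: ennreal_mult)
    then show ?thesis by auto
  qed simp
  show "\<exists>A. countable A \<and> A \<subseteq> sets \<nu> \<and> \<Union> A = space \<nu> \<and> (\<forall>a\<in>A. emeasure \<nu> a \<noteq> \<infinity>)"
  proof (intro exI conjI)
    show "countable (insert {0} (range A))" by simp
    show "insert {0} (range A) \<subseteq> sets \<nu>" using A by (auto simp: levy_measure_sets)
    show "\<Union> (insert {0} (range A)) = space \<nu>"
      using cov sets_eq_imp_space_eq[OF levy_measure_sets] by auto
    show "\<forall>a\<in>insert {0} (range A). emeasure \<nu> a \<noteq> \<infinity>"
      using fin levy by (auto simp: levy_measure_def)
  qed
qed

text \<open>The right-hand side of \<open>levy_kernel_bound\<close>. It sees the argument of the
  exponent only through an upper bound \<open>U\<close>, for which an exponential envelope can be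
  substituted.\<close>

definition levy_maj :: "real \<Rightarrow> real \<Rightarrow> real" where
  "levy_maj U r = (if \<bar>r\<bar> \<le> 1 then U\<^sup>2 * r\<^sup>2 else min 2 (\<bar>r\<bar> * U))"

lemma levy_maj_measurable[measurable]: "(\<lambda>x. levy_maj (f x) (g x)) \<in> borel_measurable M"
  if [measurable]: "f \<in> borel_measurable M" "g \<in> borel_measurable M"
  unfolding levy_maj_def by measurable

lemma levy_maj_integrable: "U \<ge> 0 \<Longrightarrow> integrable \<nu> (levy_maj U)"
proof (rule Bochner_Integration.integrable_bound)
  show "integrable \<nu> (\<lambda>r. (U\<^sup>2 + 2) * min 1 (r\<^sup>2))"
    by (intro integrable_mult_right levy_measure_integrable_min)
  assume U: "U \<ge> 0"
  have "norm (levy_maj U r) \<le> norm ((U\<^sup>2 + 2) * min 1 (r\<^sup>2))" for r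
  proof (cases "\<bar>r\<bar> \<le> 1")
    case True
    then have "r\<^sup>2 \<le> 1" by (simp add: abs_square_le_1)
    with True show ?thesis unfolding levy_maj_def by (simp add: mult_right_mono)
  next
    case False
    then have "\<not> r\<^sup>2 \<le> 1" by (simp add: abs_square_le_1)
    then have "min 1 (r\<^sup>2) = 1" by simp
    moreover have "0 \<le> U\<^sup>2" by simp
    ultimately show ?thesis using False U unfolding levy_maj_def by (simp add: min_def; linarith)
  qed
  then show "AE r in \<nu>. norm (levy_maj U r) \<le> norm ((U\<^sup>2 + 2) * min 1 (r\<^sup>2))" by simp
qed measurable

lemma levy_exponent_bound:
  assumes "\<bar>u\<bar> \<le> U"
  shows "norm (levy_exponent a \<gamma> \<nu> u) \<le> \<bar>\<gamma>\<bar> * U + a * U\<^sup>2 / 2 + (LINT r|\<nu>. levy_maj U r)"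
proof -
  have U: "U \<ge> 0" using assms by simp
  have "norm (levy_exponent a \<gamma> \<nu> u) \<le> norm (\<i> * complex_of_real (\<gamma> * u)) + norm (complex_of_real (a * u\<^sup>2 / 2)) +
     norm (LINT r|\<nu>. cis (r * u) - 1 - \<i> * complex_of_real (r * u * indicator {-1..1} r))"
    unfolding levy_exponent_def
    by (rule order_trans[OF norm_triangle_ineq]) (intro add_right_mono norm_triangle_ineq4)
  also have "norm (LINT r|\<nu>. cis (r * u) - 1 - \<i> * complex_of_real (r * u * indicator {-1..1} r)) \<le> (LINT r|\<nu>. levy_maj U r)"
    by (rule norm_integral_le[OF levy_maj_integrable[OF U]]) (unfold levy_maj_def, rule levy_kernel_bound[OF assms])
  also have "norm (\<i> * complex_of_real (\<gamma> * u)) \<le> \<bar>\<gamma>\<bar> * U"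
    using assms by (simp add: norm_mult abs_mult mult_left_mono)
  also have "norm (complex_of_real (a * u\<^sup>2 / 2)) \<le> a * U\<^sup>2 / 2"
  proof -
    have "u\<^sup>2 \<le> U\<^sup>2" using assms U by (simp add: abs_le_square_iff[symmetric])
    then have "a * u\<^sup>2 \<le> a * U\<^sup>2" using a by (rule mult_left_mono)
    then show ?thesis using a unfolding norm_of_real by simp
  qed
  finally show ?thesis by simp
qed

text \<open>A convergent sequence is bounded, so one majorant \<open>levy_maj U\<close> dominates
  all the integrands. The resulting continuity is also the source of measurability of the
  exponent.\<close>

lemma levy_exponent_LIMSEQ:
  assumes "u \<longlonglongrightarrow> v"
  shows "(\<lambda>n. levy_exponent a \<gamma> \<nu> (u n)) \<longlonglongrightarrow> levy_exponent a \<gamma> \<nu> v"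
proof -
  obtain U where U: "\<And>n. \<bar>u n\<bar> \<le> U" using convergent_imp_Bseq[OF convergentI[OF assms]] by (auto simp: Bseq_def)
  have U0: "U \<ge> 0" using U[of 0] by simp
  have "(\<lambda>n. LINT r|\<nu>. cis (r * u n) - 1 - \<i> * complex_of_real (r * u n * indicator {-1..1} r))
    \<longlonglongrightarrow> (LINT r|\<nu>. cis (r * v) - 1 - \<i> * complex_of_real (r * v * indicator {-1..1} r))"
  proof (rule integral_dominated_convergence[where w="levy_maj U"])
    show "AE r in \<nu>. (\<lambda>n. cis (r * u n) - 1 - \<i> * complex_of_real (r * u n * indicator {-1..1} r))
       \<longlonglongrightarrow> cis (r * v) - 1 - \<i> * complex_of_real (r * v * indicator {-1..1} r)"
      unfolding cis_conv_exp by (intro AE_I2 tendsto_intros assms)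
    show "AE r in \<nu>. norm (cis (r * u n) - 1 - \<i> * complex_of_real (r * u n * indicator {-1..1} r)) \<le> levy_maj U r" for n
      unfolding levy_maj_def by (intro AE_I2 levy_kernel_bound U)
  qed (auto simp: cis_conv_exp levy_maj_integrable U0)
  then show ?thesis unfolding levy_exponent_def by (intro tendsto_intros assms) simp
qed

lemma levy_exponent_measurable[measurable]: "levy_exponent a \<gamma> \<nu> \<in> borel_measurable borel"
  by (intro borel_measurable_continuous_onI) (auto simp: continuous_on_sequentially o_def intro!: levy_exponent_LIMSEQ)

text \<open>By Tonelli the integral over \<open>x\<close> is taken first. A small jump contributes a
  multiple of \<open>r\<^sup>2\<close>, a large jump a power of its logarithm; the Levy condition
  and the logarithmic moment make both integrable in \<open>r\<close>.\<close>

lemma levy_maj_exp_integrable: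
  assumes lm: "(\<integral>\<^sup>+ r. ennreal (indicator {r. \<bar>r\<bar> > 1} r * (ln \<bar>r\<bar>) ^ CARD('d::finite)) \<partial>\<nu>) < \<infinity>"
    and \<delta>: "\<delta> > 0" and C: "C \<ge> 0"
  shows "integrable lborel (\<lambda>x::real^'d. LINT r|\<nu>. levy_maj (C * exp (- \<delta> * l1norm x)) r)"
proof -
  interpret S: sigma_finite_measure \<nu> by (rule levy_measure_sigma_finite)
  interpret P: pair_sigma_finite \<nu> "lborel :: (real^'d) measure" ..
  let ?U = "\<lambda>x::real^'d. C * exp (- \<delta> * l1norm x)"
  have U: "?U x \<ge> 0" for x using C by simp
  have nn: "levy_maj V r \<ge> 0" if "V \<ge> 0" for V r using that unfolding levy_maj_def by simp
  obtain A B where AB: "A \<ge> 0" "B \<ge> 0" and 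
    K: "\<And>K. K \<ge> 1 \<Longrightarrow> (\<integral>\<^sup>+x. ennreal (min 2 (K * exp (- \<delta> * l1norm (x::real^'d)))) \<partial>lborel) \<le> ennreal (A + B * (ln K) ^ CARD('d))"
    using nn_integral_min_exp_l1norm[OF \<delta>, where 'd='d] by metis
  \<comment> \<open>Enlarging \<open>C\<close> to at least 1 makes
    \<open>\<bar>r\<bar> * c \<ge> 1\<close> for every large jump, the range in which the bound by
    logarithms holds.\<close>
  define c where "c = max 1 C"
  have c: "c \<ge> 1" "C \<le> c" "ln c \<ge> 0" by (auto simp: c_def)
  define E where "E = (LINT x|lborel. C\<^sup>2 * exp (- (2 * \<delta>) * l1norm (x::real^'d)))"
  have E: "E \<ge> 0" unfolding E_def by (intro Bochner_Integration.integral_nonneg) simp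
  define D where "D = B * 2 ^ CARD('d)"
  have D: "D \<ge> 0" using AB by (simp add: D_def)
  \<comment> \<open>For \<open>\<bar>r\<bar> > 1\<close> the factor \<open>min 1 (r\<^sup>2)\<close>
    equals 1, so the first summand also collects the constants from the large jumps.\<close>
  define G where "G r = (E + A + D * ln c ^ CARD('d)) * min 1 (r\<^sup>2) + D * (indicator {r. \<bar>r\<bar> > 1} r * (ln \<bar>r\<bar>) ^ CARD('d))" for r
  have bnd: "(\<integral>\<^sup>+x. ennreal (levy_maj (?U x) r) \<partial>lborel) \<le> ennreal (G r)" for r
  proof (cases "\<bar>r\<bar> \<le> 1")
    case True
    then have r2: "r\<^sup>2 \<le> 1" by (simp add: abs_square_le_1)
    have "levy_maj (?U x) r = r\<^sup>2 * (C\<^sup>2 * exp (- (2 * \<delta>) * l1norm x))" for x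
      using True by (simp add: levy_maj_def power_mult_distrib exp_double[symmetric] mult_ac)
    then have "(\<integral>\<^sup>+x. ennreal (levy_maj (?U x) r) \<partial>lborel) = (\<integral>\<^sup>+x. ennreal (r\<^sup>2 * (C\<^sup>2 * exp (- (2 * \<delta>) * l1norm (x::real^'d)))) \<partial>lborel)" by simp
    also have "\<dots> = ennreal (r\<^sup>2 * E)"
      unfolding E_def by (subst nn_integral_eq_integral) (use \<delta> integrable_exp_l1norm[of "2 * \<delta>", where 'd='d] in auto)
    also have "\<dots> \<le> ennreal (G r)"
    proof (rule ennreal_leI)
      have "E * r\<^sup>2 \<le> (E + A + D * ln c ^ CARD('d)) * r\<^sup>2"
        using E AB D c by (intro mult_right_mono) auto
      then show "r\<^sup>2 * E \<le> G r" using True r2 by (simp add: G_def indicator_def mult.commute)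
    qed
    finally show ?thesis .
  next
    case False
    then have "\<not> r\<^sup>2 \<le> 1" by (simp add: abs_square_le_1)
    then have r2: "min 1 (r\<^sup>2) = 1" by simp
    have rc: "1 \<le> \<bar>r\<bar> * c" using False c mult_mono[of 1 "\<bar>r\<bar>" 1 c] by simp
    have lr: "ln \<bar>r\<bar> \<ge> 0" using False by simp
    have "(\<integral>\<^sup>+x. ennreal (levy_maj (?U x) r) \<partial>lborel) \<le> (\<integral>\<^sup>+x. ennreal (min 2 ((\<bar>r\<bar> * c) * exp (- \<delta> * l1norm (x::real^'d)))) \<partial>lborel)"
    proof (rule nn_integral_mono, rule ennreal_leI)
      fix x :: "real^'d"
      have "\<bar>r\<bar> * (C * exp (- \<delta> * l1norm x)) \<le> \<bar>r\<bar> * (c * exp (- \<delta> * l1norm x))"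
        using c by (intro mult_left_mono mult_right_mono) auto
      then show "levy_maj (?U x) r \<le> min 2 ((\<bar>r\<bar> * c) * exp (- \<delta> * l1norm x))"
        using False by (simp add: levy_maj_def mult.assoc)
    qed
    also have "\<dots> \<le> ennreal (A + B * (ln (\<bar>r\<bar> * c)) ^ CARD('d))" by (rule K[OF rc])
    also have "\<dots> \<le> ennreal (G r)"
    proof (rule ennreal_leI)
      have ln: "ln (\<bar>r\<bar> * c) = ln \<bar>r\<bar> + ln c" using False c by (subst ln_mult) auto
      \<comment> \<open>Passing through twice the maximum separates the logarithm of the jump from
        that of the constant.\<close>
      have "(ln \<bar>r\<bar> + ln c) ^ CARD('d) \<le> (2 * max (ln \<bar>r\<bar>) (ln c)) ^ CARD('d)"
        using lr c by (intro power_mono) auto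
      also have "\<dots> = 2 ^ CARD('d) * (max (ln \<bar>r\<bar>) (ln c)) ^ CARD('d)" by (simp add: power_mult_distrib)
      also have "\<dots> \<le> 2 ^ CARD('d) * (ln \<bar>r\<bar> ^ CARD('d) + ln c ^ CARD('d))"
        using lr c by (intro mult_left_mono) (auto simp: max_def)
      finally have "B * (ln \<bar>r\<bar> + ln c) ^ CARD('d) \<le> B * (2 ^ CARD('d) * (ln \<bar>r\<bar> ^ CARD('d) + ln c ^ CARD('d)))"
        using AB by (intro mult_left_mono)
      also have "\<dots> = D * ln \<bar>r\<bar> ^ CARD('d) + D * ln c ^ CARD('d)" by (simp add: D_def algebra_simps)
      finally show "A + B * (ln (\<bar>r\<bar> * c)) ^ CARD('d) \<le> G r"
        unfolding ln G_def r2 using False E by (simp add: indicator_def)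
    qed
    finally show ?thesis .
  qed
  have ms: "(\<lambda>(r, x). ennreal (levy_maj (?U x) r)) \<in> borel_measurable (\<nu> \<Otimes>\<^sub>M lborel)"
    by measurable
  have "(\<integral>\<^sup>+x. \<integral>\<^sup>+r. ennreal (levy_maj (?U x) r) \<partial>\<nu> \<partial>lborel) = (\<integral>\<^sup>+r. \<integral>\<^sup>+x. ennreal (levy_maj (?U x) r) \<partial>lborel \<partial>\<nu>)"
    using P.Fubini'[OF ms] by simp
  also have "\<dots> \<le> (\<integral>\<^sup>+r. ennreal (G r) \<partial>\<nu>)" by (rule nn_integral_mono) (rule bnd)
  also have "\<dots> < \<infinity>"
  proof -
    have "integrable \<nu> (\<lambda>r. indicator {r. \<bar>r\<bar> > 1} r * (ln \<bar>r\<bar>) ^ CARD('d))"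
      using lm by (intro integrableI_nonneg) (auto simp: indicator_def)
    then have "integrable \<nu> G" unfolding G_def
      by (intro Bochner_Integration.integrable_add integrable_mult_right levy_measure_integrable_min)
    moreover have "G r \<ge> 0" for r unfolding G_def using E AB D c by (auto simp: indicator_def)
    ultimately show ?thesis by (subst nn_integral_eq_integral) auto
  qed
  finally have fin: "(\<integral>\<^sup>+x. \<integral>\<^sup>+r. ennreal (levy_maj (?U x) r) \<partial>\<nu> \<partial>lborel) < \<infinity>" .
  have eq: "(\<integral>\<^sup>+r. ennreal (levy_maj (?U x) r) \<partial>\<nu>) = ennreal (LINT r|\<nu>. levy_maj (?U x) r)" for x
    by (rule nn_integral_eq_integral) (use levy_maj_integrable U nn in auto)
  show ?thesis
  proof (rule integrableI_nonneg)
    show "(\<lambda>x. LINT r|\<nu>. levy_maj (?U x) r) \<in> borel_measurable lborel"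
      by (rule S.borel_measurable_lebesgue_integral) measurable
    show "AE x in lborel. 0 \<le> (LINT r|\<nu>. levy_maj (?U x) r)"
      by (intro AE_I2 Bochner_Integration.integral_nonneg nn U)
    show "(\<integral>\<^sup>+x. ennreal (LINT r|\<nu>. levy_maj (?U x) r) \<partial>lborel) < \<infinity>" using fin unfolding eq .
  qed
qed

text \<open>One envelope dominates for all \<open>n\<close>: the drift and Gaussian parts are
  integrable exponentials and the jump part is \<open>levy_maj_exp_integrable\<close>. The limit is
  0 because the exponent vanishes at 0.\<close>

lemma levy_exponent_integral_tendsto:
  fixes h :: "nat \<Rightarrow> real^'d::finite \<Rightarrow> real"
  assumes lm: "(\<integral>\<^sup>+ r. ennreal (indicator {r. \<bar>r\<bar> > 1} r * (ln \<bar>r\<bar>) ^ CARD('d)) \<partial>\<nu>) < \<infinity>"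
    and \<delta>: "\<delta> > 0" and [measurable]: "\<And>n. h n \<in> borel_measurable borel"
    and bnd: "\<And>n x. \<bar>h n x\<bar> \<le> C * exp (- \<delta> * l1norm x)" and lim: "\<And>x. (\<lambda>n. h n x) \<longlonglongrightarrow> 0"
  shows "(\<lambda>n. LINT x|lborel. levy_exponent a \<gamma> \<nu> (h n x)) \<longlonglongrightarrow> 0"
proof -
  have "0 \<le> C * exp (- \<delta> * l1norm (0::real^'d))" using bnd[of 0 0] by linarith
  then have C: "C \<ge> 0" by (simp add: l1norm_def)
  have z: "levy_exponent a \<gamma> \<nu> 0 = 0" unfolding levy_exponent_def by simp
  let ?U = "\<lambda>x::real^'d. C * exp (- \<delta> * l1norm x)"
  have "(\<lambda>n. LINT x|lborel. levy_exponent a \<gamma> \<nu> (h n x)) \<longlonglongrightarrow> (LINT x|(lborel::(real^'d) measure). 0)"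
  proof (rule integral_dominated_convergence[where w="\<lambda>x. \<bar>\<gamma>\<bar> * ?U x + a * (?U x)\<^sup>2 / 2 + (LINT r|\<nu>. levy_maj (?U x) r)"])
    have sq: "(?U x)\<^sup>2 = C\<^sup>2 * exp (- (2 * \<delta>) * l1norm x)" for x by (simp add: power_mult_distrib exp_double[symmetric] mult_ac)
    have "integrable lborel (\<lambda>x. \<bar>\<gamma>\<bar> * ?U x)" using \<delta> by (intro integrable_mult_right integrable_exp_l1norm)
    moreover have "integrable lborel (\<lambda>x. a * (?U x)\<^sup>2 / 2)" unfolding sq using \<delta>
      by (intro integrable_mult_right integrable_divide integrable_exp_l1norm) auto
    ultimately show "integrable lborel (\<lambda>x. \<bar>\<gamma>\<bar> * ?U x + a * (?U x)\<^sup>2 / 2 + (LINT r|\<nu>. levy_maj (?U x) r))"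
      by (intro Bochner_Integration.integrable_add levy_maj_exp_integrable lm \<delta> C)
    show "AE x in lborel. (\<lambda>n. levy_exponent a \<gamma> \<nu> (h n x)) \<longlonglongrightarrow> 0"
      using levy_exponent_LIMSEQ[OF lim] z by simp
    show "AE x in lborel. norm (levy_exponent a \<gamma> \<nu> (h n x)) \<le> \<bar>\<gamma>\<bar> * ?U x + a * (?U x)\<^sup>2 / 2 + (LINT r|\<nu>. levy_maj (?U x) r)" for n
      by (intro AE_I2 levy_exponent_bound bnd)
  qed auto
  then show ?thesis by simp
qed

end

section \<open>Test functions and truncated convolutions\<close>

lemma iter_partial_append: "iter_partial (is @ js) f = iter_partial is (iter_partial js f)"
  by (induction "is") auto

lemma smooth_fun_iter_partial: "smooth_fun f \<Longrightarrow> smooth_fun (iter_partial js f)"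
  unfolding smooth_fun_def iter_partial_append[symmetric] by blast

lemma smooth_fun_differentiable: "smooth_fun f \<Longrightarrow> f differentiable (at x)"
  unfolding smooth_fun_def by (metis iter_partial.simps(1))

lemma smooth_fun_continuous: "smooth_fun f \<Longrightarrow> continuous_on S f"
  using smooth_fun_differentiable differentiable_imp_continuous_within
  by (metis continuous_at_imp_continuous_on)

lemma smooth_fun_partial: "smooth_fun f \<Longrightarrow> smooth_fun (partial i f)"
  using smooth_fun_iter_partial[of f "[i]"] by simp

lemma partial_eqI:
  assumes "\<And>x. (f has_derivative f' x) (at x)"
  shows "partial i f = (\<lambda>x. f' x (axis i 1))"
  unfolding partial_def using frechet_derivative_at[OF assms] by metis

lemma smooth_fun_has_derivative:
  fixes f :: "real^'d::finite \<Rightarrow> real"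
  assumes "smooth_fun f"
  shows "(f has_derivative (\<lambda>v. (\<chi> i. partial i f x) \<bullet> v)) (at x)"
proof -
  let ?D = "frechet_derivative f (at x)"
  have D: "(f has_derivative ?D) (at x)"
    using smooth_fun_differentiable[OF assms] frechet_derivative_works by blast
  then interpret bounded_linear ?D by (rule has_derivative_bounded_linear)
  have "?D v = (\<chi> i. partial i f x) \<bullet> v" for v
  proof -
    have "?D v = ?D (\<Sum>i\<in>UNIV. v $ i *\<^sub>R axis i 1)"
      using basis_expansion[of v] by (simp add: scalar_mult_eq_scaleR)
    also have "\<dots> = (\<Sum>i\<in>UNIV. v $ i * ?D (axis i 1))" by (simp add: sum scaleR)
    also have "\<dots> = (\<chi> i. partial i f x) \<bullet> v"
      by (simp add: inner_vec_def partial_def mult.commute)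
    finally show ?thesis .
  qed
  then show ?thesis using D by (metis (no_types, lifting) ext)
qed

lemma smooth_fun_has_derivative_shift:
  fixes f :: "real^'d::finite \<Rightarrow> real"
  assumes "smooth_fun f"
  shows "((\<lambda>x. f (x - t)) has_derivative (\<lambda>v. (\<chi> i. partial i f (x - t)) \<bullet> v)) (at x)"
  by (rule has_derivative_compose[where f="\<lambda>x. x - t" and f'="\<lambda>v. v" and g=f])
    (auto intro!: derivative_eq_intros smooth_fun_has_derivative[OF assms])

lemma partial_lincomb:
  assumes "smooth_fun f" "smooth_fun g"
  shows "partial i (\<lambda>x. a * f x + b * g x) = (\<lambda>x. a * partial i f x + b * partial i g x)"
  by (subst partial_eqI[where f'="\<lambda>x v. a * ((\<chi> i. partial i f x) \<bullet> v) + b * ((\<chi> i. partial i g x) \<bullet> v)"])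
    (auto intro!: derivative_eq_intros smooth_fun_has_derivative assms simp: inner_axis)

lemma iter_partial_lincomb:
  assumes "smooth_fun f" "smooth_fun g"
  shows "iter_partial is (\<lambda>x. a * f x + b * g x) = (\<lambda>x. a * iter_partial is f x + b * iter_partial is g x)"
  by (induction "is") (simp_all add: partial_lincomb smooth_fun_iter_partial assms)

lemma smooth_fun_lincomb:
  assumes "smooth_fun f" "smooth_fun g"
  shows "smooth_fun (\<lambda>x. a * f x + b * g x)"
  unfolding smooth_fun_def iter_partial_lincomb[OF assms]
  using assms unfolding smooth_fun_def
  by (intro allI differentiable_add differentiable_mult differentiable_const) auto

lemma iter_partial_translate:
  assumes "smooth_fun f"
  shows "iter_partial is (\<lambda>x. f (x - t)) = (\<lambda>x. iter_partial is f (x - t))"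
proof (induction "is")
  case (Cons i "is")
  note this = smooth_fun_has_derivative_shift[OF smooth_fun_iter_partial[OF assms, of "is"], of t]
  from partial_eqI[OF this, of i] Cons show ?case by (simp add: inner_axis)
qed simp

lemma smooth_fun_translate:
  assumes "smooth_fun f"
  shows "smooth_fun (\<lambda>x. f (x - t))"
  unfolding smooth_fun_def iter_partial_translate[OF assms]
  using smooth_fun_has_derivative_shift[OF smooth_fun_iter_partial[OF assms], of _ t] by (auto simp: differentiable_def)

lemma test_function_iff: "test_function f \<longleftrightarrow> smooth_fun f \<and> bounded {x. f x \<noteq> 0}"
  unfolding test_function_def by simp

lemma test_function_smooth: "test_function f \<Longrightarrow> smooth_fun f"
  by (simp add: test_function_def)

text \<open>Off the closure the function vanishes on a neighbourhood, so its derivative there is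
  that of the zero function.\<close>

lemma partial_support: "{x. partial i f x \<noteq> 0} \<subseteq> closure {x. f x \<noteq> 0}"
proof safe
  fix x assume x: "partial i f x \<noteq> 0"
  show "x \<in> closure {x. f x \<noteq> 0}"
  proof (rule ccontr)
    assume "x \<notin> closure {x. f x \<noteq> 0}"
    then have "x \<in> - closure {x. f x \<noteq> 0}" by blast
    have "(f has_derivative (\<lambda>v. 0)) (at x within UNIV)"
    proof (rule has_derivative_transform_within_open)
      show "((\<lambda>x. 0) has_derivative (\<lambda>v. 0)) (at x within UNIV)" by simp
      show "open (- closure {x. f x \<noteq> 0})" by (simp add: open_Compl)
      show "x \<in> - closure {x. f x \<noteq> 0}" by fact
      show "0 = f y" if "y \<in> - closure {x. f x \<noteq> 0}" for y
      proof (rule ccontr)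
        assume "0 \<noteq> f y"
        then have "y \<in> {x. f x \<noteq> 0}" by simp
        then have "y \<in> closure {x. f x \<noteq> 0}" by (rule subsetD[OF closure_subset])
        with that show False by simp
      qed
    qed
    then have "partial i f x = 0" unfolding partial_def by (simp add: frechet_derivative_at[symmetric])
    with x show False by simp
  qed
qed

lemma test_function_partial: "test_function f \<Longrightarrow> test_function (partial i f)"
  unfolding test_function_iff
  using bounded_subset[OF bounded_closure partial_support] smooth_fun_partial by blast

lemma test_function_iter_partial: "test_function f \<Longrightarrow> test_function (iter_partial is f)"
  by (induction "is") (simp_all add: test_function_partial)

lemma test_function_lincomb:
  assumes "test_function f" "test_function g"
  shows "test_function (\<lambda>x. a * f x + b * g x)"
  unfolding test_function_iff
proof
  have "{x. a * f x + b * g x \<noteq> 0} \<subseteq> {x. f x \<noteq> 0} \<union> {x. g x \<noteq> 0}" by auto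
  then show "bounded {x. a * f x + b * g x \<noteq> 0}"
    by (rule bounded_subset[rotated]) (use assms in \<open>auto simp: test_function_iff\<close>)
qed (use assms smooth_fun_lincomb in \<open>auto simp: test_function_iff\<close>)

lemma test_function_zero: "test_function (\<lambda>x::real^'d::finite. 0)"
proof -
  have "iter_partial is (\<lambda>x::real^'d. 0) = (\<lambda>x. 0)" for "is"
    by (induction "is") (auto simp: partial_def)
  then show ?thesis by (simp add: test_function_iff smooth_fun_def)
qed

lemma test_function_cmult: "test_function f \<Longrightarrow> test_function (\<lambda>x. a * f x)"
  using test_function_lincomb[of f f a 0] by simp

lemma test_function_sum:
  "finite A \<Longrightarrow> (\<And>i. i \<in> A \<Longrightarrow> test_function (f i)) \<Longrightarrow> test_function (\<lambda>x. \<Sum>i\<in>A. f i x)"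
proof (induction A rule: finite_induct)
  case (insert i A)
  then show ?case using test_function_lincomb[of "f i" "\<lambda>x. \<Sum>i\<in>A. f i x" 1 1] by simp
qed (simp add: test_function_zero)

lemma test_function_translate: "test_function f \<Longrightarrow> test_function (\<lambda>x. f (x - t))"
  unfolding test_function_iff
proof safe
  assume "bounded {x. f x \<noteq> 0}"
  then have "bounded ((+) t ` {x. f x \<noteq> 0})" by (rule bounded_translation)
  then show "bounded {x. f (x - t) \<noteq> 0}"
    by (rule bounded_subset) (auto intro!: image_eqI[of _ _ "x - t" for x])
qed (rule smooth_fun_translate)

lemma test_function_measurable[measurable_dest]: "test_function f \<Longrightarrow> f \<in> borel_measurable borel"
  using smooth_fun_continuous[OF test_function_smooth] by (intro borel_measurable_continuous_onI)

lemma test_function_bounded: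
  fixes f :: "real^'d::finite \<Rightarrow> real"
  assumes "test_function f"
  shows "\<exists>B. \<forall>x. \<bar>f x\<bar> \<le> B"
proof -
  let ?K = "closure {x. f x \<noteq> 0}"
  have "compact (f ` ?K)" using assms
    by (intro compact_continuous_image smooth_fun_continuous) (auto simp: test_function_def)
  then have "bounded (f ` ?K)" by (rule compact_imp_bounded)
  then obtain B where B: "\<And>x. x \<in> ?K \<Longrightarrow> \<bar>f x\<bar> \<le> B" by (auto simp: bounded_iff)
  have "\<bar>f x\<bar> \<le> max B 0" for x
    using B[of x] closure_subset[of "{x. f x \<noteq> 0}"] by (cases "f x = 0") auto
  then show ?thesis by blast
qed

lemma compact_support_integrable:
  fixes f :: "real^'d::finite \<Rightarrow> real"
  assumes "continuous_on UNIV f" and "{x. f x \<noteq> 0} \<subseteq> cbox a b"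
  shows "integrable lborel f"
proof -
  have "integrable lborel (\<lambda>x. indicator (cbox a b) x *\<^sub>R f x)"
    by (rule borel_integrable_compact) (auto intro: continuous_on_subset[OF assms(1)])
  moreover have "(\<lambda>x. indicator (cbox a b) x *\<^sub>R f x) = f" using assms(2) by (intro ext) (auto simp: indicator_def)
  ultimately show ?thesis by simp
qed

lemma test_function_cbox:
  fixes f :: "real^'d::finite \<Rightarrow> real"
  assumes "test_function f"
  obtains a b where "{x. f x \<noteq> 0} \<subseteq> cbox a b"
  using assms bounded_subset_cbox_symmetric unfolding test_function_iff by metis

lemma test_function_weight_integrable:
  fixes f :: "real^'d::finite \<Rightarrow> real"
  assumes "test_function f"
  shows "integrable lborel (\<lambda>x. exp (\<delta> * l1norm x) * \<bar>f x\<bar>)"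
proof -
  obtain a b where ab: "{x. f x \<noteq> 0} \<subseteq> cbox a b" using test_function_cbox[OF assms] .
  show ?thesis
    by (rule compact_support_integrable[of _ a b])
      (use ab smooth_fun_continuous[OF test_function_smooth[OF assms]] in \<open>auto intro!: continuous_intros\<close>)
qed

lemma test_function_integrable: "test_function f \<Longrightarrow> integrable lborel f"
  by (metis compact_support_integrable smooth_fun_continuous test_function_cbox test_function_smooth)

text \<open>The gauge integral over a compact box gives direct access to the Leibniz rule. The sharp
  cutoff sits on the kernel and all derivatives fall on \<open>f\<close>, so it costs no
  smoothness.\<close>

definition box_conv :: "real \<Rightarrow> (real^'d::finite \<Rightarrow> real) \<Rightarrow> (real^'d \<Rightarrow> real) \<Rightarrow> real^'d \<Rightarrow> real" where
  "box_conv c g f x = integral (cbox (\<chi> i. - c) (\<chi> i. c)) (\<lambda>y. g y * f (x - y))"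

lemma box_conv_has_derivative:
  fixes f g :: "real^'d::finite \<Rightarrow> real"
  assumes f: "smooth_fun f" and g: "continuous_on UNIV g"
  shows "(box_conv c g f has_derivative (\<lambda>v. (\<chi> i. box_conv c g (partial i f) x) \<bullet> v)) (at x)"
proof -
  define a b :: "real^'d" where "a = (\<chi> i. - c)" and "b = (\<chi> i. c)"
  define grad where "grad x = (\<chi> i. partial i f x)" for x
  \<comment> \<open>The derivative of the integrand as a bounded linear functional, continuous in
    both variables; in this form it can be integrated over the box and then evaluated at a
    vector.\<close>
  define fx where "fx x y = g y *\<^sub>R blinfun_inner_right (grad (x - y))" for x y
  note [continuous_intros] = continuous_on_compose2[OF g] continuous_on_compose2[OF smooth_fun_continuous[OF f, of UNIV]]
     continuous_on_compose2[OF smooth_fun_continuous[OF smooth_fun_partial[OF f], of UNIV]]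
  have int: "(\<lambda>y. g y * h (x - y)) integrable_on cbox a b" if "smooth_fun h" for h x
    by (intro integrable_continuous continuous_intros continuous_on_compose2[OF smooth_fun_continuous[OF that, of UNIV]]) auto
  have grad_cont: "continuous_on UNIV grad" unfolding grad_def
    by (intro continuous_on_vec_lambda smooth_fun_continuous smooth_fun_partial f)
  have d: "((\<lambda>x. integral (cbox a b) (\<lambda>y. g y * f (x - y))) has_derivative blinfun_apply (integral (cbox a b) (fx x))) (at x within UNIV)"
  proof (rule leibniz_rule[where U=UNIV])
    fix x t
    have "((\<lambda>x. f (x - t)) has_derivative (\<lambda>v. grad (x - t) \<bullet> v)) (at x)"
      unfolding grad_def by (rule smooth_fun_has_derivative_shift[OF f])
    then show "((\<lambda>x. g t * f (x - t)) has_derivative blinfun_apply (fx x t)) (at x within UNIV)"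
      unfolding fx_def by (auto intro!: derivative_eq_intros simp: blinfun.scaleR_left)
    show "(\<lambda>y. g y * f (x - y)) integrable_on cbox a b" by (rule int[OF f])
    show "continuous_on (UNIV \<times> cbox a b) (\<lambda>(x, t). fx x t)"
      unfolding fx_def split_beta'
      by (intro continuous_intros bounded_linear.continuous_on[OF bounded_linear_blinfun_inner_right] continuous_on_compose2[OF grad_cont]) auto
  qed auto
  have fxi: "(fx x) integrable_on cbox a b" unfolding fx_def
    by (intro integrable_continuous continuous_intros bounded_linear.continuous_on[OF bounded_linear_blinfun_inner_right] continuous_on_compose2[OF grad_cont]) auto
  have "blinfun_apply (integral (cbox a b) (fx x)) v = (\<chi> i. box_conv c g (partial i f) x) \<bullet> v" for v
  proof -
    have "blinfun_apply (integral (cbox a b) (fx x)) v = integral (cbox a b) (\<lambda>y. blinfun_apply (fx x y) v)"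
      by (rule blinfun_apply_integral[OF fxi])
    also have "\<dots> = integral (cbox a b) (\<lambda>y. \<Sum>i\<in>UNIV. (g y * partial i f (x - y)) * v $ i)"
      by (simp add: fx_def blinfun.scaleR_left grad_def inner_vec_def sum_distrib_left mult.assoc)
    also have "\<dots> = (\<Sum>i\<in>UNIV. integral (cbox a b) (\<lambda>y. (g y * partial i f (x - y)) * v $ i))"
      by (intro integral_sum integrable_on_mult_left int smooth_fun_partial f) auto
    also have "\<dots> = (\<chi> i. box_conv c g (partial i f) x) \<bullet> v"
      by (simp add: inner_vec_def box_conv_def a_def b_def)
    finally show ?thesis .
  qed
  then have "blinfun_apply (integral (cbox a b) (fx x)) = (\<lambda>v. (\<chi> i. box_conv c g (partial i f) x) \<bullet> v)"
    by (rule ext)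
  with d show ?thesis unfolding box_conv_def[of c g f, abs_def] a_def b_def by simp
qed

lemma iter_partial_box_conv:
  fixes f g :: "real^'d::finite \<Rightarrow> real"
  assumes f: "smooth_fun f" and g: "continuous_on UNIV g"
  shows "iter_partial is (box_conv c g f) = box_conv c g (iter_partial is f)"
proof (induction "is")
  case (Cons i "is")
  show ?case
    using partial_eqI[OF box_conv_has_derivative[OF smooth_fun_iter_partial[OF f, of "is"] g, of c], of i]
    by (simp add: Cons inner_axis)
qed simp

text \<open>Derivatives pass to \<open>f\<close>, and the support lies in the Minkowski sum of the
  support of \<open>f\<close> and the box. This is what makes the noise applicable to truncated
  convolutions.\<close>

lemma test_function_box_conv:
  fixes f g :: "real^'d::finite \<Rightarrow> real"
  assumes f: "test_function f" and g: "continuous_on UNIV g"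
  shows "test_function (box_conv c g f)"
  unfolding test_function_iff
proof
  show "smooth_fun (box_conv c g f)" unfolding smooth_fun_def iter_partial_box_conv[OF test_function_smooth[OF f] g]
    using box_conv_has_derivative[OF smooth_fun_iter_partial[OF test_function_smooth[OF f]] g] 
    by (auto simp: differentiable_def)
  let ?K = "cbox (\<chi> i. - c) (\<chi> i. c) :: (real^'d) set"
  have "{x. box_conv c g f x \<noteq> 0} \<subseteq> {x + y |x y. x \<in> {x. f x \<noteq> 0} \<and> y \<in> ?K}"
  proof
    fix x assume x: "x \<in> {x. box_conv c g f x \<noteq> 0}"
    have "\<exists>y\<in>?K. g y * f (x - y) \<noteq> 0"
    proof (rule ccontr)
      assume "\<not> (\<exists>y\<in>?K. g y * f (x - y) \<noteq> 0)"
      then have "box_conv c g f x = integral ?K (\<lambda>y. 0)" unfolding box_conv_def by (intro integral_cong) auto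
      with x show False by simp
    qed
    then obtain y where "y \<in> ?K" "f (x - y) \<noteq> 0" by auto
    then show "x \<in> {x + y |x y. x \<in> {x. f x \<noteq> 0} \<and> y \<in> ?K}" by (intro CollectI exI[of _ "x - y"] exI[of _ y]) auto
  qed
  moreover have "bounded {x + y |x y. x \<in> {x. f x \<noteq> 0} \<and> y \<in> ?K}"
  proof -
    have "{x + y |x y. x \<in> {x. f x \<noteq> 0} \<and> y \<in> ?K} = (\<lambda>(x, y). x + y) ` ({x. f x \<noteq> 0} \<times> ?K)" by auto
    moreover have "bounded ((\<lambda>(x, y). x + y) ` ({x. f x \<noteq> 0} \<times> ?K))"
      by (rule bounded_plus) (use f in \<open>auto simp: test_function_iff\<close>)
    ultimately show ?thesis by simp
  qed
  ultimately show "bounded {x. box_conv c g f x \<noteq> 0}" by (rule bounded_subset[rotated])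
qed

lemma box_conv_lincomb:
  assumes "smooth_fun f" "smooth_fun h" and g: "continuous_on UNIV g"
  shows "box_conv c g (\<lambda>x. a * f x + b * h x) = (\<lambda>x. a * box_conv c g f x + b * box_conv c g h x)"
proof
  fix x
  have int: "(\<lambda>y. g y * k (x - y)) integrable_on cbox (\<chi> i. - c) (\<chi> i. c)" if "smooth_fun k" for k
    by (intro integrable_continuous continuous_intros continuous_on_subset[OF g] continuous_on_compose2[OF smooth_fun_continuous[OF that, of UNIV]]) auto
  have "integral (cbox (\<chi> i. - c) (\<chi> i. c)) (\<lambda>y. a * (g y * f (x - y)) + b * (g y * h (x - y))) = a * box_conv c g f x + b * box_conv c g h x"
    unfolding box_conv_def
    by (subst integral_add) (auto intro!: integrable_on_mult_right int assms)
  then show "box_conv c g (\<lambda>x. a * f x + b * h x) x = a * box_conv c g f x + b * box_conv c g h x"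
    unfolding box_conv_def by (simp add: algebra_simps)
qed

lemma box_conv_translate: "box_conv c g (\<lambda>x. f (x - t)) x = box_conv c g f (x - t)"
  unfolding box_conv_def by (simp add: algebra_simps)

section \<open>Fourier transforms of test functions\<close>

lemma lborel_integral_shift:
  fixes g :: "'a::euclidean_space \<Rightarrow> 'b::{banach,second_countable_topology}"
  assumes [measurable]: "g \<in> borel_measurable borel"
  shows "(LINT x|lborel. g (c + x)) = (LINT x|lborel. g x)"
  by (subst (2) lborel_distr_plus[of c, symmetric], subst integral_distr) auto

lemma lborel_integral_scale:
  fixes g :: "'a::euclidean_space \<Rightarrow> complex"
  assumes [measurable]: "g \<in> borel_measurable borel" and c: "c > 0"
  shows "(LINT x|lborel. g x) = c ^ DIM('a) * (LINT x|lborel. g (t + c *\<^sub>R x))"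
proof -
  have "(LINT x|lborel. g x) = (LINT x|density (distr lborel borel (\<lambda>x. t + c *\<^sub>R x)) (\<lambda>_. ennreal (\<bar>c\<bar> ^ DIM('a))). g x)"
    using lborel_affine[of c t] c by simp
  also have "\<dots> = c ^ DIM('a) * (LINT x|lborel. g (t + c *\<^sub>R x))"
    using c by (subst integral_density, simp, simp, simp, simp, subst integral_distr) (auto simp: scaleR_conv_of_real)
  finally show ?thesis by simp
qed

text \<open>The positive sign in the phase makes the formal adjoint of \<open>p(D)\<close> act as
  multiplication by \<open>p(i\<xi>)\<close>, the symbol for which the holomorphic extension is
  assumed.\<close>

definition fourier :: "(real^'d::finite \<Rightarrow> real) \<Rightarrow> real^'d \<Rightarrow> complex" where
  "fourier f \<xi> = (LINT x|lborel. cis (\<xi> \<bullet> x) * complex_of_real (f x))"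

lemma cis_measurable[measurable]: "f \<in> borel_measurable M \<Longrightarrow> (\<lambda>x. cis (f x)) \<in> borel_measurable M"
  unfolding cis_conv_exp by measurable

lemma integrable_cis_mult:
  assumes "integrable M f" and [measurable]: "h \<in> borel_measurable M"
  shows "integrable M (\<lambda>x. cis (h x) * complex_of_real (f x))"
  by (rule Bochner_Integration.integrable_bound[OF assms(1)]) (use assms(1) in \<open>auto simp: norm_mult\<close>)

lemma fourier_norm_le: "integrable lborel f \<Longrightarrow> norm (fourier f \<xi>) \<le> (LINT x|lborel. \<bar>f x\<bar>)"
  unfolding fourier_def by (rule norm_integral_le) (auto simp: norm_mult)

lemma fourier_lincomb:
  assumes "integrable lborel f" "integrable lborel g"
  shows "fourier (\<lambda>x. a * f x + b * g x) \<xi> = a * fourier f \<xi> + b * fourier g \<xi>"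
proof -
  have "fourier (\<lambda>x. a * f x + b * g x) \<xi> = (LINT x|lborel. a * (cis (\<xi> \<bullet> x) * f x) + b * (cis (\<xi> \<bullet> x) * g x))"
    unfolding fourier_def by (simp add: algebra_simps)
  also have "\<dots> = a * fourier f \<xi> + b * fourier g \<xi>"
    unfolding fourier_def
    by (subst Bochner_Integration.integral_add)
      (auto intro!: integrable_mult_right integrable_cis_mult assms)
  finally show ?thesis .
qed

lemma fourier_sum:
  assumes "finite A" "\<And>i. i \<in> A \<Longrightarrow> integrable lborel (f i)"
  shows "fourier (\<lambda>x. \<Sum>i\<in>A. f i x) \<xi> = (\<Sum>i\<in>A. fourier (f i) \<xi>)"
  using assms
proof (induction A rule: finite_induct)
  case (insert i A)
  then show ?case using fourier_lincomb[of "f i" "\<lambda>x. \<Sum>i\<in>A. f i x" 1 1 \<xi>] by auto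
qed (simp add: fourier_def)

lemma fourier_cmult: "integrable lborel f \<Longrightarrow> fourier (\<lambda>x. a * f x) \<xi> = a * fourier f \<xi>"
  using fourier_lincomb[of f f a 0] by simp

lemma fourier_shift:
  assumes "test_function f"
  shows "fourier (\<lambda>x. f (c + x)) \<xi> = cis (- (\<xi> \<bullet> c)) * fourier f \<xi>"
proof -
  have [measurable]: "f \<in> borel_measurable borel" by (rule test_function_measurable[OF assms])
  have "fourier (\<lambda>x. f (c + x)) \<xi> = (LINT x|lborel. cis (- (\<xi> \<bullet> c)) * (cis (\<xi> \<bullet> (c + x)) * f (c + x)))"
    unfolding fourier_def by (simp add: inner_add_right mult.assoc[symmetric] cis_mult)
  also have "\<dots> = (LINT x|lborel. cis (- (\<xi> \<bullet> c)) * (cis (\<xi> \<bullet> x) * f x))"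
    by (rule lborel_integral_shift[where g="\<lambda>x. cis (- (\<xi> \<bullet> c)) * (cis (\<xi> \<bullet> x) * f x)"]) measurable
  finally show ?thesis unfolding fourier_def by simp
qed

text \<open>The transform of the difference quotients is explicit, so no integration by parts is needed.\<close>
lemma fourier_partial:
  fixes f :: "real^'d::finite \<Rightarrow> real"
  assumes f: "test_function f"
  shows "fourier (partial i f) \<xi> = - \<i> * (\<xi> $ i) * fourier f \<xi>"
proof -
  define e :: "real^'d" where "e = axis i 1"
  define h where "h n = inverse (real (Suc n))" for n
  have h: "0 < h n" "h n \<le> 1" for n by (auto simp: h_def inverse_eq_divide)
  have h0: "h \<longlonglongrightarrow> 0" unfolding h_def by (rule LIMSEQ_inverse_real_of_nat)
  define D where "D n x = inverse (h n) * f (h n *\<^sub>R e + x) + (- inverse (h n)) * f x" for n x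
  have [measurable]: "f \<in> borel_measurable borel" "partial i f \<in> borel_measurable borel"
    using f test_function_partial test_function_measurable by auto
  have der: "((\<lambda>t. f (t *\<^sub>R e + x)) has_real_derivative partial i f (t *\<^sub>R e + x)) (at t)" for x t
  proof -
    have "((\<lambda>t. f (t *\<^sub>R e + x)) has_derivative (\<lambda>s. (\<chi> i. partial i f (t *\<^sub>R e + x)) \<bullet> (s *\<^sub>R e))) (at t)"
    proof (rule has_derivative_compose[where g=f])
      show "((\<lambda>t. t *\<^sub>R e + x) has_derivative (\<lambda>s. s *\<^sub>R e)) (at t)"
        by (auto intro!: derivative_eq_intros)
      show "(f has_derivative (\<bullet>) (\<chi> i. partial i f (t *\<^sub>R e + x))) (at (t *\<^sub>R e + x))"
        by (rule smooth_fun_has_derivative[OF test_function_smooth[OF f]])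
    qed
    moreover have "(\<lambda>s. (\<chi> i. partial i f (t *\<^sub>R e + x)) \<bullet> (s *\<^sub>R e)) = (*) (partial i f (t *\<^sub>R e + x))"
      by (intro ext) (simp add: e_def inner_axis)
    ultimately show ?thesis unfolding has_field_derivative_def by (simp only:)
  qed
  obtain B where B: "\<And>x. \<bar>partial i f x\<bar> \<le> B" using test_function_bounded[OF test_function_partial[OF f]] by blast
  have B0: "B \<ge> 0" using B[of 0] by linarith
  obtain R where R: "\<And>x. f x \<noteq> 0 \<Longrightarrow> norm x \<le> R" using f unfolding test_function_iff bounded_iff by auto
  have Dlim: "(\<lambda>n. D n x) \<longlonglongrightarrow> partial i f x" for x
  proof -
    have "((\<lambda>s. (f ((0 + s) *\<^sub>R e + x) - f (0 *\<^sub>R e + x)) / s) \<longlongrightarrow> partial i f x) (at 0)"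
      using der[of x 0] unfolding DERIV_def by simp
    then have "(\<lambda>n. (f ((0 + h n) *\<^sub>R e + x) - f (0 *\<^sub>R e + x)) / h n) \<longlonglongrightarrow> partial i f x"
      by (rule filterlim_compose) (use h0 h in \<open>auto simp: filterlim_at less_imp_neq[symmetric] intro!: always_eventually\<close>)
    then show ?thesis unfolding D_def by (simp add: field_simps diff_divide_distrib)
  qed
  \<comment> \<open>By the mean value theorem a difference quotient is a value of the derivative.
    Step sizes at most 1 keep all the quotients supported in the ball of radius
    \<open>R + 1\<close>.\<close>
  have Dbnd: "\<bar>D n x\<bar> \<le> B * indicator (cball 0 (R + 1)) x" for n x
  proof (cases "x \<in> cball 0 (R + 1)")
    case True
    obtain z where "f (h n *\<^sub>R e + x) - f (0 *\<^sub>R e + x) = (h n - 0) * partial i f (z *\<^sub>R e + x)"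
      using MVT2[OF h(1)[of n], of "\<lambda>t. f (t *\<^sub>R e + x)" "\<lambda>t. partial i f (t *\<^sub>R e + x)"] der by blast
    then have "D n x = partial i f (z *\<^sub>R e + x)" unfolding D_def using h(1)[of n] by (simp add: field_simps)
    then show ?thesis using B True by simp
  next
    case False
    have "norm (h n *\<^sub>R e + x) \<ge> norm x - norm (h n *\<^sub>R e)" by (metis add.commute norm_diff_ineq)
    moreover have "norm (h n *\<^sub>R e) \<le> 1" using h[of n] by (simp add: e_def)
    ultimately have "f (h n *\<^sub>R e + x) = 0" "f x = 0" using R[of x] R[of "h n *\<^sub>R e + x"] False by auto
    then show ?thesis by (simp add: D_def B0)
  qed
  have "(\<lambda>n. fourier (D n) \<xi>) \<longlonglongrightarrow> fourier (partial i f) \<xi>"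
    unfolding fourier_def
  proof (rule integral_dominated_convergence[where w="\<lambda>x. B * indicator (cball 0 (R + 1)) x"])
    show "integrable lborel (\<lambda>x::real^'d. B * indicator (cball 0 (R + 1)) x)"
      by (intro integrable_mult_right integrable_real_indicator) (auto simp: emeasure_lborel_cball_finite[unfolded infinity_ennreal_def])
    show "AE x in lborel. (\<lambda>n. cis (\<xi> \<bullet> x) * complex_of_real (D n x)) \<longlonglongrightarrow> cis (\<xi> \<bullet> x) * complex_of_real (partial i f x)"
      by (intro AE_I2 tendsto_intros Dlim)
    show "AE x in lborel. norm (cis (\<xi> \<bullet> x) * complex_of_real (D n x)) \<le> B * indicator (cball 0 (R + 1)) x" for n
      using Dbnd by (simp add: norm_mult)
  qed (auto simp: D_def)
  moreover have "fourier (D n) \<xi> = (exp (- \<i> * (\<xi> $ i) * complex_of_real (h n)) - 1) / complex_of_real (h n) * fourier f \<xi>" for n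
  proof -
    have "test_function (\<lambda>x. f (x - (- (h n *\<^sub>R e))))" by (rule test_function_translate[OF f])
    then have t: "integrable lborel (\<lambda>x. f (h n *\<^sub>R e + x))" by (auto dest: test_function_integrable simp: add.commute)
    have "fourier (D n) \<xi> = inverse (h n) * fourier (\<lambda>x. f (h n *\<^sub>R e + x)) \<xi> + (- inverse (h n)) * fourier f \<xi>"
      unfolding D_def by (subst fourier_lincomb[OF t test_function_integrable[OF f]]) simp
    then show ?thesis unfolding fourier_shift[OF f]
      using h(1)[of n] by (simp add: e_def inner_axis cis_conv_exp field_simps)
  qed
  moreover have "(\<lambda>n. (exp (- \<i> * (\<xi> $ i) * complex_of_real (h n)) - 1) / complex_of_real (h n) * fourier f \<xi>) \<longlonglongrightarrow> - \<i> * (\<xi> $ i) * fourier f \<xi>"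
  proof (rule tendsto_mult_right)
    have "((\<lambda>z. exp (- \<i> * (\<xi> $ i) * z)) has_field_derivative - \<i> * (\<xi> $ i)) (at 0)"
      by (auto intro!: derivative_eq_intros)
    then have "((\<lambda>s. (exp (- \<i> * (\<xi> $ i) * (0 + s)) - exp (- \<i> * (\<xi> $ i) * 0)) / s) \<longlongrightarrow> - \<i> * (\<xi> $ i)) (at 0)"
      unfolding DERIV_def .
    then have "((\<lambda>n. (exp (- \<i> * (\<xi> $ i) * (0 + complex_of_real (h n))) - exp (- \<i> * (\<xi> $ i) * 0)) / complex_of_real (h n)) \<longlonglongrightarrow> - \<i> * (\<xi> $ i))"
      by (rule filterlim_compose)
        (use h0 h in \<open>auto simp: filterlim_at less_imp_neq[symmetric] tendsto_of_real_iff[where c=0, simplified] intro!: always_eventually\<close>)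
    then show "(\<lambda>n. (exp (- \<i> * (\<xi> $ i) * complex_of_real (h n)) - 1) / complex_of_real (h n)) \<longlonglongrightarrow> - \<i> * (\<xi> $ i)" by simp
  qed
  ultimately show ?thesis using LIMSEQ_unique by auto
qed

section \<open>Differential operators as Fourier multipliers\<close>

lemma fourier_iter_partial:
  assumes "test_function f"
  shows "fourier (iter_partial js f) \<xi> = (\<Prod>j\<leftarrow>js. - \<i> * (\<xi> $ j)) * fourier f \<xi>"
  by (induction js) (simp_all add: fourier_partial test_function_iter_partial assms)

text \<open>A name for the order of coordinates chosen inside \<open>Dmulti\<close>; only its being
  a duplicate-free enumeration is used.\<close>

definition coord_list :: "'d::finite list" where
  "coord_list = (SOME xs. distinct xs \<and> set xs = UNIV)"

lemma coord_list: "distinct coord_list" "set coord_list = UNIV"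
  using someI_ex[OF finite_distinct_list[OF finite[of UNIV], unfolded conj_commute[of "set _ = _"]]]
  unfolding coord_list_def by auto

lemma Dmulti_eq: "Dmulti \<alpha> f = iter_partial (concat (map (\<lambda>i. replicate (\<alpha> i) i) coord_list)) f"
  unfolding Dmulti_def coord_list_def ..

text \<open>The multipliers commute, so the arbitrary order of the coordinates disappears on the
  transform side.\<close>

lemma fourier_Dmulti:
  assumes "test_function f"
  shows "fourier (Dmulti \<alpha> f) \<xi> = (\<Prod>i\<in>UNIV. (- \<i> * (\<xi> $ i)) ^ \<alpha> i) * fourier f \<xi>"
proof -
  have "(\<Prod>j\<leftarrow>concat (map (\<lambda>i. replicate (\<alpha> i) i) xs). g j) = (\<Prod>i\<leftarrow>xs. g i ^ \<alpha> i)" for g :: "'a \<Rightarrow> complex" and xs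
    by (induction xs) (auto simp: prod_list_replicate)
  then show ?thesis unfolding Dmulti_eq fourier_iter_partial[OF assms]
    using prod.distinct_set_conv_list[OF coord_list(1), of "\<lambda>i. (- \<i> * (\<xi> $ i)) ^ \<alpha> i"]
    by (simp add: coord_list(2))
qed

text \<open>Connects the pure derivatives in \<open>pure_op\<close> with \<open>Dmulti\<close>, the
  form in which convergence of test functions is given.\<close>

lemma Dmulti_single: "Dmulti (\<lambda>k. if k = i then m else 0) f = iter_partial (replicate m i) f"
proof -
  have "concat (map (\<lambda>k. replicate (if k = i then m else 0) k) xs) = (if i \<in> set xs then replicate m i else [])"
    if "distinct xs" for xs
    using that by (induction xs) (auto cong: map_cong)
  from this[OF coord_list(1)] show ?thesis unfolding Dmulti_eq coord_list(2) by simp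
qed

lemma test_function_Dmulti: "test_function f \<Longrightarrow> test_function (Dmulti \<alpha> f)"
  unfolding Dmulti_eq by (rule test_function_iter_partial)

lemma test_function_diff_op_neg: "is_mpoly P \<Longrightarrow> test_function f \<Longrightarrow> test_function (diff_op_neg P f)"
  unfolding diff_op_neg_def is_mpoly_def
  by (intro test_function_sum test_function_cmult test_function_Dmulti) auto

definition imag_vec :: "real^'d::finite \<Rightarrow> complex^'d" where "imag_vec \<xi> = (\<chi> i. \<i> * (\<xi> $ i))"

lemma fourier_diff_op_neg:
  assumes P: "is_mpoly P" and f: "test_function f"
  shows "fourier (diff_op_neg P f) \<xi> = mpoly_eval_c P (imag_vec \<xi>) * fourier f \<xi>"
proof -
  \<comment> \<open>The sign of the adjoint cancels the sign from the transform of each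
    derivative.\<close>
  have "(-1) ^ mindex_abs \<alpha> * (\<Prod>i\<in>UNIV. (- \<i> * (\<xi> $ i)) ^ \<alpha> i) = (\<Prod>i\<in>UNIV. (\<i> * (\<xi> $ i)) ^ \<alpha> i)" for \<alpha>
    unfolding mindex_abs_def power_sum prod.distrib[symmetric] power_mult_distrib[symmetric] by simp
  note * = this[symmetric]
  have "fourier (diff_op_neg P f) \<xi> = (\<Sum>\<alpha>\<in>{\<alpha>. P \<alpha> \<noteq> 0}. (P \<alpha> * (-1) ^ mindex_abs \<alpha>) * fourier (Dmulti \<alpha> f) \<xi>)"
    unfolding diff_op_neg_def using P f
    by (subst fourier_sum) (auto simp: is_mpoly_def fourier_cmult test_function_integrable test_function_Dmulti test_function_cmult)
  also have "\<dots> = mpoly_eval_c P (imag_vec \<xi>) * fourier f \<xi>"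
    unfolding mpoly_eval_c_def imag_vec_def fourier_Dmulti[OF f] sum_distrib_right
    by (intro sum.cong refl) (simp add: *)
  finally show ?thesis .
qed

text \<open>Only pure derivatives occur, so that \<open>Dmulti\<close> convergence controls this operator without any
  symmetry of mixed derivatives.\<close>
definition pure_op :: "nat \<Rightarrow> (real^'d::finite \<Rightarrow> real) \<Rightarrow> real^'d \<Rightarrow> real" where
  "pure_op m f = (\<lambda>x. f x + (\<Sum>i\<in>UNIV. iter_partial (replicate m i) f x))"

lemma test_function_pure_op: 
  assumes "test_function f" shows "test_function (pure_op m f)"
  using test_function_lincomb[OF assms test_function_sum[where A=UNIV and f="\<lambda>i. iter_partial (replicate m i) f"], of 1 1]
  by (simp add: pure_op_def test_function_iter_partial assms)

text \<open>Since 4 divides \<open>m\<close>, the factors \<open>(-\<i>) ^ m\<close> equal 1; the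
  multiplier is real and, being 1 plus a sum of even powers, at least 1.\<close>

lemma fourier_pure_op:
  assumes f: "test_function f" and m: "4 dvd m"
  shows "fourier (pure_op m f) \<xi> = complex_of_real (1 + (\<Sum>i\<in>UNIV. (\<xi> $ i) ^ m)) * fourier f \<xi>"
proof -
  have im: "(- (\<i> * x)) ^ m = x ^ m" for x :: complex
  proof -
    from m obtain k where k: "m = 4 * k" by (elim dvdE)
    have "\<i> ^ 4 = 1" by (simp add: eval_nat_numeral)
    then have "(- (\<i> * x)) ^ 4 = x ^ 4" by (simp add: power_mult_distrib)
    then show ?thesis unfolding k power_mult by simp
  qed
  have "fourier (pure_op m f) \<xi> = fourier f \<xi> + (\<Sum>i\<in>UNIV. fourier (iter_partial (replicate m i) f) \<xi>)"
    using fourier_lincomb[of f "\<lambda>x. \<Sum>i\<in>UNIV. iter_partial (replicate m i) f x" 1 1 \<xi>]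
    by (simp add: pure_op_def fourier_sum test_function_integrable f test_function_iter_partial)
  also have "\<dots> = complex_of_real (1 + (\<Sum>i\<in>UNIV. (\<xi> $ i) ^ m)) * fourier f \<xi>"
    by (simp add: fourier_iter_partial f prod_list_replicate im algebra_simps sum_distrib_left)
  finally show ?thesis .
qed

lemma pure_op_lincomb:
  assumes "smooth_fun f" "smooth_fun g"
  shows "pure_op m (\<lambda>x. a * f x + b * g x) = (\<lambda>x. a * pure_op m f x + b * pure_op m g x)"
  unfolding pure_op_def iter_partial_lincomb[OF assms]
  by (simp add: sum.distrib sum_distrib_left algebra_simps)

lemma pure_op_translate: "smooth_fun f \<Longrightarrow> pure_op m (\<lambda>x. f (x - t)) = (\<lambda>x. pure_op m f (x - t))"
  unfolding pure_op_def by (simp add: iter_partial_translate)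

section \<open>Polynomial weights and integrability of Fourier transforms\<close>

definition japanese_prod :: "real^'d::finite \<Rightarrow> real" where "japanese_prod x = (\<Prod>i\<in>UNIV. 1 + \<bar>x $ i\<bar>)"

lemma japanese_prod_ge: "japanese_prod x \<ge> 1" "1 + \<bar>x $ i\<bar> \<le> japanese_prod x"
proof -
  show 1: "japanese_prod x \<ge> 1" unfolding japanese_prod_def by (rule prod_ge_1) simp
  have "japanese_prod x = (1 + \<bar>x $ i\<bar>) * (\<Prod>i\<in>UNIV - {i}. 1 + \<bar>x $ i\<bar>)"
    unfolding japanese_prod_def by (subst prod.remove[of _ i]) auto
  moreover have "(\<Prod>i\<in>UNIV - {i}. 1 + \<bar>x $ i\<bar>) \<ge> 1" by (rule prod_ge_1) simp
  ultimately show "1 + \<bar>x $ i\<bar> \<le> japanese_prod x" using mult_left_mono[of 1 _ "1 + \<bar>x $ i\<bar>"] by simp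
qed

text \<open>The product is at most a power of its largest factor, and that power is one term of the
  sum.\<close>

lemma prod_le_sum_power:
  fixes b :: "'d::finite \<Rightarrow> real"
  assumes "\<And>i. b i \<ge> 0"
  shows "(\<Prod>i\<in>UNIV. b i) \<le> (\<Sum>i\<in>UNIV. b i ^ CARD('d))"
proof -
  obtain j where j: "b j = Max (range b)" using Max_in[of "range b"] by (metis UNIV_not_empty empty_is_image finite finite_imageI imageE)
  then have le: "b i \<le> b j" for i by simp
  have "(\<Prod>i\<in>UNIV. b i) \<le> (\<Prod>i\<in>(UNIV::'d set). b j)" by (intro prod_mono) (use assms le in auto)
  also have "\<dots> = b j ^ CARD('d)" by simp
  also have "\<dots> \<le> (\<Sum>i\<in>UNIV. b i ^ CARD('d))" by (rule member_le_sum) (use assms in auto)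
  finally show ?thesis .
qed

text \<open>The product weight contains mixed monomials, while the symbol of \<open>pure_op\<close>
  has only pure powers. Raising the exponent by the factor \<open>CARD('d)\<close> bridges the two,
  and evenness keeps all the powers nonnegative.\<close>

lemma japanese_prod_power_le:
  fixes x :: "real^'d::finite"
  assumes "even (CARD('d) * s)"
  shows "japanese_prod x ^ s \<le> 2 ^ (CARD('d) * s) * CARD('d) * (1 + (\<Sum>i\<in>UNIV. (x $ i) ^ (CARD('d) * s)))"
proof -
  let ?m = "CARD('d) * s"
  have p: "(1 + \<bar>t\<bar>) ^ ?m \<le> 2 ^ ?m * (1 + t ^ ?m)" for t :: real
  proof -
    have "(1 + \<bar>t\<bar>) ^ ?m \<le> (2 * max 1 \<bar>t\<bar>) ^ ?m" by (intro power_mono) auto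
    also have "\<dots> = 2 ^ ?m * (max 1 \<bar>t\<bar>) ^ ?m" by (simp add: power_mult_distrib)
    also have "\<dots> \<le> 2 ^ ?m * (1 + \<bar>t\<bar> ^ ?m)" by (intro mult_left_mono) (auto simp: max_def)
    finally show ?thesis using assms by (simp add: power_even_abs)
  qed
  have nn: "(x $ i) ^ ?m \<ge> 0" for i using assms by (simp add: zero_le_even_power)
  have "japanese_prod x ^ s = (\<Prod>i\<in>UNIV. (1 + \<bar>x $ i\<bar>) ^ s)" by (simp add: japanese_prod_def prod_power_distrib)
  also have "\<dots> \<le> (\<Sum>i\<in>UNIV. ((1 + \<bar>x $ i\<bar>) ^ s) ^ CARD('d))" by (rule prod_le_sum_power) simp
  also have "\<dots> = (\<Sum>i\<in>UNIV. (1 + \<bar>x $ i\<bar>) ^ ?m)" by (simp add: power_mult[symmetric] mult.commute)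
  also have "\<dots> \<le> (\<Sum>i\<in>UNIV. 2 ^ ?m * (1 + (x $ i) ^ ?m))" by (intro sum_mono p)
  also have "\<dots> = 2 ^ ?m * (CARD('d) + (\<Sum>i\<in>UNIV. (x $ i) ^ ?m))" by (simp add: sum_distrib_left[symmetric] sum.distrib)
  also have "\<dots> \<le> 2 ^ ?m * (CARD('d) * (1 + (\<Sum>i\<in>UNIV. (x $ i) ^ ?m)))"
  proof (intro mult_left_mono)
    have "1 * (\<Sum>i\<in>UNIV. (x $ i) ^ ?m) \<le> CARD('d) * (\<Sum>i\<in>UNIV. (x $ i) ^ ?m)"
      by (intro mult_right_mono sum_nonneg nn) (simp add: Suc_le_eq)
    then show "CARD('d) + (\<Sum>i\<in>UNIV. (x $ i) ^ ?m) \<le> CARD('d) * (1 + (\<Sum>i\<in>UNIV. (x $ i) ^ ?m))" by (simp add: algebra_simps)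
  qed simp
  finally show ?thesis by (simp add: mult.assoc)
qed

text \<open>The weight is a product so that its inverse square splits into integrable functions of
  one variable.\<close>

lemma japanese_prod_integrable: "integrable lborel (\<lambda>x::real^'d::finite. 1 / japanese_prod x ^ 2)"
proof -
  have "integrable lborel (\<lambda>t::real. 1 / (1 + \<bar>t\<bar>)\<^sup>2)"
    by (rule Bochner_Integration.integrable_bound[OF integrable_inverse_1_plus_square_lborel])
      (auto intro!: AE_I2 divide_left_mono mult_pos_pos simp: power2_sum add_pos_nonneg)
  from integral_lborel_prod(1)[of "\<lambda>_ t. 1 / (1 + \<bar>t\<bar>)\<^sup>2", OF this]
  show ?thesis by (simp add: japanese_prod_def prod_power_distrib prod_dividef)
qed

lemma borel_measurable_japanese_prod[measurable]: "japanese_prod \<in> borel_measurable borel"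
  unfolding japanese_prod_def by measurable

lemma fourier_measurable[measurable]: 
  assumes [measurable]: "f \<in> borel_measurable borel"
  shows "fourier f \<in> borel_measurable borel"
  unfolding fourier_def by measurable

text \<open>The transform of \<open>pure_op m f\<close> is bounded and equals the symbol times
  \<open>fourier f\<close>, so \<open>fourier f\<close> decays like the inverse symbol.\<close>

lemma fourier_integrable:
  fixes f :: "real^'d::finite \<Rightarrow> real"
  assumes f: "test_function f"
  shows "integrable lborel (fourier f)"
proof -
  \<comment> \<open>The factor 4 gives the divisibility that \<open>fourier_pure_op\<close> asks
    for; the symbol then dominates \<open>japanese_prod x ^ 4\<close>, hence also the square, whose
    inverse is integrable.\<close>
  let ?m = "CARD('d) * 4"
  have m: "4 dvd ?m" "even ?m" by auto
  define C where "C = (LINT x|lborel. \<bar>pure_op ?m f x\<bar>)"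
  have C: "C \<ge> 0" unfolding C_def by (intro Bochner_Integration.integral_nonneg) simp
  let ?K = "2 ^ ?m * real CARD('d)"
  have bnd: "norm (fourier f x) \<le> (C * ?K) * (1 / japanese_prod x ^ 2)" for x
  proof -
    let ?R = "1 + (\<Sum>i\<in>UNIV. (x $ i) ^ ?m)"
    have R: "?R \<ge> 1" by (simp add: sum_nonneg zero_le_even_power)
    have "?R * norm (fourier f x) = norm (fourier (pure_op ?m f) x)"
      unfolding fourier_pure_op[OF f m(1)] norm_mult norm_of_real using R by simp
    also have "\<dots> \<le> C" unfolding C_def by (rule fourier_norm_le[OF test_function_integrable[OF test_function_pure_op[OF f]]])
    finally have 1: "?R * norm (fourier f x) \<le> C" .
    have "japanese_prod x ^ 2 \<le> japanese_prod x ^ 4" by (rule power_increasing) (auto simp: japanese_prod_ge)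
    also have "\<dots> \<le> ?K * ?R" using japanese_prod_power_le[of 4 x] m by simp
    finally have "japanese_prod x ^ 2 * norm (fourier f x) \<le> ?K * ?R * norm (fourier f x)" by (rule mult_right_mono) simp
    also have "\<dots> = ?K * (?R * norm (fourier f x))" by (rule mult.assoc)
    also have "\<dots> \<le> ?K * C" by (rule mult_left_mono[OF 1]) simp
    finally have "norm (fourier f x) * japanese_prod x ^ 2 \<le> C * ?K" by (simp only: mult.commute)
    moreover have "japanese_prod x ^ 2 > 0" using japanese_prod_ge(1)[of x] by simp
    ultimately show ?thesis by (simp add: pos_le_divide_eq)
  qed
  have [measurable]: "f \<in> borel_measurable borel" by (rule test_function_measurable[OF f])
  show ?thesis
    by (rule Bochner_Integration.integrable_bound[OF integrable_mult_right[OF japanese_prod_integrable]])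
      (auto intro!: AE_I2 order_trans[OF bnd] abs_ge_self simp del: times_divide_eq_right)
qed

section \<open>Gaussian regularization and Fourier inversion\<close>

definition gauss :: "real^'d::finite \<Rightarrow> real" where
  "gauss \<eta> = (\<Prod>i\<in>UNIV. std_normal_density (\<eta> $ i))"

lemma gauss_measurable[measurable]: "gauss \<in> borel_measurable borel"
  unfolding gauss_def by measurable

lemma gauss_eq: "gauss (\<eta> :: real^'d::finite) = (1 / sqrt (2 * pi)) ^ CARD('d) * exp (- (\<eta> \<bullet> \<eta>) / 2)"
  unfolding gauss_def std_normal_density_def
  by (simp add: prod.distrib exp_sum[symmetric] sum_negf sum_divide_distrib[symmetric] inner_vec_def power2_eq_square prod_dividef power_divide)

lemma gauss_nonneg: "gauss (\<eta> :: real^'d::finite) \<ge> 0" unfolding gauss_def by (intro prod_nonneg) simp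

lemma gauss_integral: "integrable lborel (gauss :: real^'d::finite \<Rightarrow> real)" "(LINT \<eta>|lborel. gauss (\<eta>::real^'d)) = 1"
proof -
  have *: "integrable lborel std_normal_density" by (rule integrable_normal_density) simp
  show "integrable lborel (gauss :: real^'d \<Rightarrow> real)" "(LINT \<eta>|lborel. gauss (\<eta>::real^'d)) = 1"
    using integral_lborel_prod[of "\<lambda>_::'d. std_normal_density", OF *]
      integral_normal_density[of 1 0] unfolding gauss_def by simp_all
qed

text \<open>A product of characteristic functions of standard normal laws on the line.\<close>

lemma gauss_fourier: "(LINT \<eta>|lborel. cis (\<eta> \<bullet> w) * complex_of_real (gauss \<eta>)) = exp (- (w \<bullet> w) / 2)" for w :: "real^'d::finite"
proof -
  have 1: "integrable lborel (\<lambda>t. cis (t * u) * complex_of_real (std_normal_density t))" for u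
    by (rule integrable_cis_mult) (auto intro: integrable_normal_density)
  have 2: "(LINT t|lborel. cis (t * u) * complex_of_real (std_normal_density t)) = complex_of_real (exp (- u\<^sup>2 / 2))" for u
  proof -
    have "complex_of_real (exp (- u\<^sup>2 / 2)) = (LINT t|std_normal_distribution. cis (t * u))"
      using fun_cong[OF char_std_normal_distribution, of u] by (simp add: char_def cis_conv_exp mult.commute)
    also have "\<dots> = (LINT t|lborel. std_normal_density t *\<^sub>R cis (t * u))"
      by (rule integral_density) auto
    finally show ?thesis by (simp add: scaleR_conv_of_real mult.commute)
  qed
  have cis_sum: "(\<Prod>i\<in>UNIV. cis (f i)) = cis (\<Sum>i\<in>UNIV. f i)" for f :: "'d \<Rightarrow> real"
    unfolding cis_conv_exp by (simp add: exp_sum[symmetric] sum_distrib_left)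
  have "cis (\<eta> \<bullet> w) * complex_of_real (gauss \<eta>) = (\<Prod>i\<in>UNIV. cis ((\<eta> $ i) * (w $ i)) * complex_of_real (std_normal_density (\<eta> $ i)))" for \<eta> :: "real^'d"
    unfolding gauss_def of_real_prod prod.distrib cis_sum by (simp add: inner_vec_def)
  then have "(LINT \<eta>|lborel. cis (\<eta> \<bullet> w) * complex_of_real (gauss \<eta>)) = (\<Prod>i\<in>UNIV. complex_of_real (exp (- (w $ i)\<^sup>2 / 2)))"
    using integral_lborel_prod(2)[of "\<lambda>i t. cis (t * (w $ i)) * complex_of_real (std_normal_density t)", OF 1] unfolding 2 by simp
  also have "\<dots> = complex_of_real (exp (\<Sum>i\<in>UNIV. - (w $ i)\<^sup>2 / 2))"
    by (simp only: of_real_prod[symmetric] exp_sum[OF finite])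
  also have "(\<Sum>i\<in>UNIV. - (w $ i)\<^sup>2 / 2) = - (w \<bullet> w) / 2"
    by (simp add: inner_vec_def power2_eq_square sum_negf sum_divide_distrib[symmetric])
  finally show ?thesis .
qed

text \<open>Damping the frequency integral by a Gaussian and interchanging the integrals produces a
  Gaussian approximate identity.\<close>
lemma fourier_gauss_damped:
  fixes f :: "real^'d::finite \<Rightarrow> real"
  assumes f: "integrable lborel f" and c: "c > 0"
  shows "(LINT \<xi>|lborel. fourier f \<xi> * cis (- (\<xi> \<bullet> x)) * complex_of_real (gauss (c *\<^sub>R \<xi>)))
    = (LINT w|lborel. complex_of_real (f (x + c *\<^sub>R w) * exp (- (w \<bullet> w) / 2)))"
proof -
  have [measurable]: "f \<in> borel_measurable borel" using f by auto
  have g: "integrable lborel (\<lambda>\<xi>::real^'d. gauss (c *\<^sub>R \<xi>))"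
  proof -
    have "gauss (c *\<^sub>R \<xi>) = (\<Prod>i\<in>UNIV. std_normal_density (c * (\<xi> $ i)))" for \<xi> :: "real^'d" by (simp add: gauss_def)
    moreover have "integrable lborel (\<lambda>t. std_normal_density (c * t))"
      using lborel_integrable_real_affine[OF integrable_normal_density[of 1 0], of c 0] c by simp
    ultimately show ?thesis using integral_lborel_prod(1)[of "\<lambda>_::'d. \<lambda>t. std_normal_density (c * t)"] by simp
  qed
  let ?k = "\<lambda>\<xi> u. cis (\<xi> \<bullet> (u - x)) * complex_of_real (f u * gauss (c *\<^sub>R \<xi>))"
  have int: "integrable (lborel \<Otimes>\<^sub>M lborel) (\<lambda>(\<xi>, u). ?k \<xi> u)"
  proof (rule lborel_pair.Fubini_integrable)
    show "(\<lambda>(\<xi>, u). ?k \<xi> u) \<in> borel_measurable (lborel \<Otimes>\<^sub>M lborel)" by measurable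
    have n: "norm (?k \<xi> u) = \<bar>f u\<bar> * gauss (c *\<^sub>R \<xi>)" for \<xi> u by (simp add: norm_mult abs_mult gauss_nonneg)
    show "integrable lborel (\<lambda>\<xi>. LINT u|lborel. norm (case (\<xi>, u) of (\<xi>, u) \<Rightarrow> ?k \<xi> u))"
      unfolding split n using g by simp
    show "AE \<xi> in lborel. integrable lborel (\<lambda>u. case (\<xi>, u) of (\<xi>, u) \<Rightarrow> ?k \<xi> u)"
      unfolding split by (intro AE_I2 integrable_cis_mult integrable_mult_left f) measurable
  qed
  have "(LINT \<xi>|lborel. fourier f \<xi> * cis (- (\<xi> \<bullet> x)) * complex_of_real (gauss (c *\<^sub>R \<xi>))) = (LINT \<xi>|lborel. LINT u|lborel. ?k \<xi> u)"
  proof (rule Bochner_Integration.integral_cong[OF refl])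
    fix \<xi> :: "real^'d"
    have "?k \<xi> u = (cis (\<xi> \<bullet> u) * complex_of_real (f u)) * (cis (- (\<xi> \<bullet> x)) * complex_of_real (gauss (c *\<^sub>R \<xi>)))" for u
      by (simp add: inner_diff_right cis_mult mult_ac)
    then have "(LINT u|lborel. ?k \<xi> u) = fourier f \<xi> * (cis (- (\<xi> \<bullet> x)) * complex_of_real (gauss (c *\<^sub>R \<xi>)))"
      unfolding fourier_def by (simp only: integral_mult_left_zero)
    then show "fourier f \<xi> * cis (- (\<xi> \<bullet> x)) * complex_of_real (gauss (c *\<^sub>R \<xi>)) = (LINT u|lborel. ?k \<xi> u)"
      by (simp only: mult.assoc)
  qed
  also have "\<dots> = (LINT u|lborel. LINT \<xi>|lborel. ?k \<xi> u)"
    by (rule lborel_pair.Fubini_integral[OF int, symmetric])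
  \<comment> \<open>The Jacobian of \<open>u = x + c *\<^sub>R w\<close> is absorbed below by the
    rescaling \<open>\<eta> = c *\<^sub>R \<xi>\<close>, which turns the inner integral into the
    transform of the standard Gaussian.\<close>
  also have "\<dots> = complex_of_real c ^ CARD('d) * (LINT w|lborel. LINT \<xi>|lborel. ?k \<xi> (x + c *\<^sub>R w))"
    using lborel_integral_scale[of "\<lambda>u. LINT \<xi>|lborel. ?k \<xi> u" c x] c by simp
  also have "\<dots> = (LINT w|lborel. complex_of_real c ^ CARD('d) * (LINT \<xi>|lborel. ?k \<xi> (x + c *\<^sub>R w)))"
    by (rule integral_mult_right_zero[symmetric])
  also have "\<dots> = (LINT w|lborel. complex_of_real (f (x + c *\<^sub>R w) * exp (- (w \<bullet> w) / 2)))"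
  proof (rule Bochner_Integration.integral_cong[OF refl])
    fix w :: "real^'d"
    have "complex_of_real (f (x + c *\<^sub>R w) * exp (- (w \<bullet> w) / 2)) = complex_of_real (f (x + c *\<^sub>R w)) * (LINT \<eta>|lborel. cis (\<eta> \<bullet> w) * complex_of_real (gauss \<eta>))"
      unfolding gauss_fourier by simp
    also have "(LINT \<eta>|lborel. cis (\<eta> \<bullet> w) * complex_of_real (gauss \<eta>)) = complex_of_real c ^ CARD('d) * (LINT \<xi>|lborel. cis (c * (\<xi> \<bullet> w)) * complex_of_real (gauss (c *\<^sub>R \<xi>)))"
      using lborel_integral_scale[of "\<lambda>\<eta>. cis (\<eta> \<bullet> w) * complex_of_real (gauss \<eta>)" c 0] c by simp
    finally have *: "complex_of_real (f (x + c *\<^sub>R w) * exp (- (w \<bullet> w) / 2)) = complex_of_real (f (x + c *\<^sub>R w)) * (complex_of_real c ^ CARD('d) * (LINT \<xi>|lborel. cis (c * (\<xi> \<bullet> w)) * complex_of_real (gauss (c *\<^sub>R \<xi>))))" .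
    have "?k \<xi> (x + c *\<^sub>R w) = complex_of_real (f (x + c *\<^sub>R w)) * (cis (c * (\<xi> \<bullet> w)) * complex_of_real (gauss (c *\<^sub>R \<xi>)))" for \<xi>
      by (simp add: mult_ac)
    then have "(LINT \<xi>|lborel. ?k \<xi> (x + c *\<^sub>R w)) = complex_of_real (f (x + c *\<^sub>R w)) * (LINT \<xi>|lborel. cis (c * (\<xi> \<bullet> w)) * complex_of_real (gauss (c *\<^sub>R \<xi>)))"
      by (simp only: integral_mult_right_zero)
    then show "complex_of_real c ^ CARD('d) * (LINT \<xi>|lborel. ?k \<xi> (x + c *\<^sub>R w)) = complex_of_real (f (x + c *\<^sub>R w) * exp (- (w \<bullet> w) / 2))"
      unfolding * by (simp only: mult_ac)
  qed
  finally show ?thesis .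
qed

text \<open>As the damping is removed, the frequency side tends to the undamped integral times
  \<open>N = gauss 0\<close>, and the space side tends to \<open>f x\<close> times the mass
  \<open>1 / N\<close> of the unnormalized Gaussian. The constant \<open>(2 * pi) ^ CARD('d)\<close>
  is \<open>1 / (N * N)\<close>.\<close>

lemma fourier_inversion:
  fixes f :: "real^'d::finite \<Rightarrow> real"
  assumes f: "integrable lborel f" and cont: "continuous_on UNIV f" and B: "\<And>x. \<bar>f x\<bar> \<le> B"
    and ff: "integrable lborel (fourier f)"
  shows "(LINT \<xi>|lborel. fourier f \<xi> * cis (- (\<xi> \<bullet> x))) = (2 * pi) ^ CARD('d) * f x"
proof -
  have [measurable]: "f \<in> borel_measurable borel" using f by auto
  define N where "N = (1 / sqrt (2 * pi)) ^ CARD('d)"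
  have N: "N > 0" by (simp add: N_def)
  define c where "c n = inverse (real (Suc n))" for n
  have c: "c n > 0" for n by (simp add: c_def)
  have c0: "c \<longlonglongrightarrow> 0" unfolding c_def by (rule LIMSEQ_inverse_real_of_nat)
  have gN: "gauss \<eta> \<le> N" "gauss (0::real^'d) = N" for \<eta> :: "real^'d"
    unfolding gauss_eq N_def by (auto intro!: mult_left_le)
  have gcont: "continuous_on UNIV (gauss :: real^'d \<Rightarrow> real)" unfolding gauss_eq[abs_def] by (intro continuous_intros)  auto
  have exp_gauss: "exp (- (w \<bullet> w) / 2) = gauss w / N" for w :: "real^'d" unfolding gauss_eq N_def by simp
  have cc: "(\<lambda>n. c n *\<^sub>R v) \<longlonglongrightarrow> 0" for v :: "real^'d" using tendsto_scaleR[OF c0 tendsto_const[of v]] by simp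
  have A: "(\<lambda>n. LINT \<xi>|lborel. fourier f \<xi> * cis (- (\<xi> \<bullet> x)) * complex_of_real (gauss (c n *\<^sub>R \<xi>)))
     \<longlonglongrightarrow> (LINT \<xi>|lborel. fourier f \<xi> * cis (- (\<xi> \<bullet> x)) * complex_of_real (gauss (0::real^'d)))"
  proof (rule integral_dominated_convergence[where w="\<lambda>\<xi>. norm (fourier f \<xi>) * N"])
    show "AE \<xi> in lborel. (\<lambda>n. fourier f \<xi> * cis (- (\<xi> \<bullet> x)) * complex_of_real (gauss (c n *\<^sub>R \<xi>))) \<longlonglongrightarrow> fourier f \<xi> * cis (- (\<xi> \<bullet> x)) * complex_of_real (gauss (0::real^'d))"
      by (intro AE_I2 tendsto_intros continuous_on_tendsto_compose[OF gcont] cc) auto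
    show "AE \<xi> in lborel. norm (fourier f \<xi> * cis (- (\<xi> \<bullet> x)) * complex_of_real (gauss (c n *\<^sub>R \<xi>))) \<le> norm (fourier f \<xi>) * N" for n
      using gN(1) by (intro AE_I2) (simp add: norm_mult mult_left_mono gauss_nonneg)
    show "integrable lborel (\<lambda>\<xi>. norm (fourier f \<xi>) * N)" by (intro integrable_mult_left integrable_norm ff)
  qed auto
  have "(\<lambda>n. LINT w|lborel. complex_of_real (f (x + c n *\<^sub>R w) * exp (- (w \<bullet> w) / 2)))
     \<longlonglongrightarrow> (LINT w|lborel. complex_of_real (f x * exp (- ((w::real^'d) \<bullet> w) / 2)))"
  proof (rule integral_dominated_convergence[where w="\<lambda>w::real^'d. B * (gauss w / N)"])
    show "integrable lborel (\<lambda>w::real^'d. B * (gauss w / N))" by (intro integrable_mult_right integrable_divide gauss_integral)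
    show "AE w in lborel. (\<lambda>n. complex_of_real (f (x + c n *\<^sub>R w) * exp (- (w \<bullet> w) / 2))) \<longlonglongrightarrow> complex_of_real (f x * exp (- (w \<bullet> w) / 2))"
    proof (intro AE_I2 tendsto_intros)
      fix w
      have "(\<lambda>n. x + c n *\<^sub>R w) \<longlonglongrightarrow> x + 0" by (intro tendsto_add tendsto_const cc)
      then show "(\<lambda>n. f (x + c n *\<^sub>R w)) \<longlonglongrightarrow> f x" using continuous_on_tendsto_compose[OF cont] by auto
    qed
    show "AE w in lborel. norm (complex_of_real (f (x + c n *\<^sub>R w) * exp (- (w \<bullet> w) / 2))) \<le> B * (gauss w / N)" for n
      unfolding norm_of_real abs_mult exp_gauss using B N gauss_nonneg[where 'd='d] by (intro AE_I2 mult_mono) (auto intro: order_trans[OF abs_ge_zero])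
  qed auto
  also have "(LINT w|lborel. complex_of_real (f x * exp (- ((w::real^'d) \<bullet> w) / 2))) = complex_of_real (LINT w|lborel. (f x / N) * gauss (w::real^'d))"
    unfolding exp_gauss by (subst integral_complex_of_real[symmetric]) simp
  also have "(LINT w|lborel. (f x / N) * gauss (w::real^'d)) = f x / N" by (subst integral_mult_right_zero) (simp add: gauss_integral)
  finally have "(LINT \<xi>|lborel. fourier f \<xi> * cis (- (\<xi> \<bullet> x)) * complex_of_real N) = complex_of_real (f x / N)"
    using A unfolding fourier_gauss_damped[OF f c] gN by (rule LIMSEQ_unique[rotated])
  then have "(LINT \<xi>|lborel. fourier f \<xi> * cis (- (\<xi> \<bullet> x))) * complex_of_real N = complex_of_real (f x / N)"
    by (simp only: integral_mult_left_zero)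
  then have "(LINT \<xi>|lborel. fourier f \<xi> * cis (- (\<xi> \<bullet> x))) = complex_of_real (f x / N / N)"
    using N by (simp add: nonzero_eq_divide_eq mult.assoc)
  also have "f x / N / N = (2 * pi) ^ CARD('d) * f x"
  proof -
    have "N * N = (1 / (2 * pi)) ^ CARD('d)"
      unfolding N_def power_mult_distrib[symmetric] by (simp add: real_sqrt_mult_self)
    then have "(2 * pi) ^ CARD('d) * (N * N) = 1" by (simp add: power_one_over)
    then have "(2 * pi) ^ CARD('d) * f x * N * N = f x" by (metis mult.assoc mult.commute mult_1)
    then show ?thesis using N by (metis less_numeral_extra(3) nonzero_mult_div_cancel_right)
  qed
  finally show ?thesis by simp
qed

section \<open>Polynomials along complex lines\<close>

text \<open>The reversed polynomial has the same modulus on the unit circle and takes the conjugate of the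
  leading coefficient at the origin, where the maximum modulus principle is applied.\<close>
lemma lead_coeff_mult_le_circle_bound:
  fixes p :: "complex poly"
  assumes f: "f holomorphic_on S" "open S" "cball 0 1 \<subseteq> S" and deg: "degree p \<le> n"
    and B: "\<And>u. norm u = 1 \<Longrightarrow> norm (poly p u * f u) \<le> B"
  shows "norm (coeff p n) * norm (f 0) \<le> B"
proof -
  define q where "q u = (\<Sum>k\<le>n. cnj (coeff p k) * u ^ (n - k))" for u
  have q: "norm (q u) = norm (poly p u)" if u: "norm u = 1" for u
  proof -
    have uu: "u * cnj u = 1" using u by (simp add: complex_norm_square[symmetric])
    have "poly p u = (\<Sum>k\<le>n. coeff p k * u ^ k)" 
      unfolding poly_altdef using deg by (intro sum.mono_neutral_left) (auto simp: coeff_eq_0)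
    then have "u ^ n * cnj (poly p u) = (\<Sum>k\<le>n. cnj (coeff p k) * (u ^ n * cnj u ^ k))"
      by (simp add: sum_distrib_left mult_ac)
    also have "\<dots> = q u" unfolding q_def
    proof (intro sum.cong refl)
      fix k assume "k \<in> {..n}"
      then have "u ^ n = u ^ (n - k) * u ^ k" by (simp add: power_add[symmetric])
      then have "u ^ n * cnj u ^ k = u ^ (n - k) * (u * cnj u) ^ k" by (simp add: power_mult_distrib mult_ac)
      then show "cnj (coeff p k) * (u ^ n * cnj u ^ k) = cnj (coeff p k) * u ^ (n - k)" using uu by simp
    qed
    finally have "norm (q u) = norm (u ^ n * cnj (poly p u))" by simp
    then show ?thesis using u by (simp add: norm_mult norm_power)
  qed
  have hol: "(\<lambda>u. q u * f u) holomorphic_on S" unfolding q_def by (intro holomorphic_intros f)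
  have "norm (q 0 * f 0) \<le> B"
  proof (rule maximum_modulus_frontier[where S="cball 0 1" and f="\<lambda>u. q u * f u"])
    show "(\<lambda>u. q u * f u) holomorphic_on interior (cball 0 1)"
      using hol by (rule holomorphic_on_subset) (use f(3) interior_subset in auto)
    show "continuous_on (closure (cball 0 1)) (\<lambda>u. q u * f u)"
      using holomorphic_on_imp_continuous_on[OF hol] by (rule continuous_on_subset) (use f(3) in auto)
    show "norm (q z * f z) \<le> B" if "z \<in> frontier (cball 0 1)" for z
      using that B[of z] q[of z] by (simp add: norm_mult)
  qed auto
  moreover have "q 0 = cnj (coeff p n)"
  proof -
    have "q 0 = (\<Sum>k\<le>n. if k = n then cnj (coeff p k) else 0)" unfolding q_def
      by (intro sum.cong) (auto simp: power_0_left)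
    then show ?thesis by simp
  qed
  ultimately show ?thesis by (simp add: norm_mult)
qed

text \<open>If a degree bound is not attained, both sides vanish. This admits directions with
  vanishing coordinates in the products below.\<close>

lemma coeff_mult_degree_le:
  fixes p q :: "'a::idom poly"
  assumes "degree p \<le> a" "degree q \<le> b"
  shows "coeff (p * q) (a + b) = coeff p a * coeff q b"
proof (cases "degree p = a \<and> degree q = b")
  case True then show ?thesis using coeff_mult_degree_sum[of p q] by simp
next
  case False
  then have "degree p < a \<or> degree q < b" using assms by auto
  then have "coeff p a * coeff q b = 0" by (auto simp: coeff_eq_0)
  moreover have "degree (p * q) < a + b" using degree_mult_le[of p q] assms False by linarith
  ultimately show ?thesis by (simp add: coeff_eq_0)
qed

lemma coeff_power_linear: "degree ([:a, b:] ^ n) \<le> n" "coeff ([:a, b:] ^ n) n = (b::complex) ^ n"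
proof -
  have d: "degree ([:a, b:] ^ n) \<le> n" for n
  proof -
    have "degree ([:a, b:] ^ n) \<le> degree [:a, b:] * n" by (rule degree_power_le)
    also have "\<dots> \<le> 1 * n" by (intro mult_right_mono) auto
    finally show ?thesis by simp
  qed
  then show "degree ([:a, b:] ^ n) \<le> n" .
  show "coeff ([:a, b:] ^ n) n = b ^ n"
  proof (induction n)
    case (Suc n)
    have "coeff ([:a, b:] * [:a, b:] ^ n) (1 + n) = coeff [:a, b:] 1 * coeff ([:a, b:] ^ n) n"
      by (rule coeff_mult_degree_le) (use d in auto)
    then show ?case using Suc by simp
  qed simp
qed

lemma coeff_prod_degree_le:
  fixes p :: "'i \<Rightarrow> complex poly"
  assumes "finite A" "\<And>i. i \<in> A \<Longrightarrow> degree (p i) \<le> k i"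
  shows "degree (\<Prod>i\<in>A. p i) \<le> (\<Sum>i\<in>A. k i) \<and> coeff (\<Prod>i\<in>A. p i) (\<Sum>i\<in>A. k i) = (\<Prod>i\<in>A. coeff (p i) (k i))"
  using assms
proof (induction A rule: finite_induct)
  case (insert i A)
  then have IH: "degree (\<Prod>i\<in>A. p i) \<le> (\<Sum>i\<in>A. k i)" "coeff (\<Prod>i\<in>A. p i) (\<Sum>i\<in>A. k i) = (\<Prod>i\<in>A. coeff (p i) (k i))"
    and pi: "degree (p i) \<le> k i" by auto
  have "degree (p i * (\<Prod>i\<in>A. p i)) \<le> k i + (\<Sum>i\<in>A. k i)"
    using degree_mult_le[of "p i" "\<Prod>i\<in>A. p i"] pi IH(1) by linarith
  then show ?case using insert(1,2) coeff_mult_degree_le[OF pi IH(1)] IH(2) by simp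
qed simp

text \<open>The function \<open>z \<mapsto> p(iz)\<close> restricted to a complex line, kept as a
  formal polynomial in the line parameter so that degree and top coefficient are available.\<close>

definition line_poly :: "(('d::finite \<Rightarrow> nat) \<Rightarrow> real) \<Rightarrow> complex^'d \<Rightarrow> complex^'d \<Rightarrow> complex poly" where
  "line_poly P z v = (\<Sum>\<alpha>\<in>{\<alpha>. P \<alpha> \<noteq> 0}. smult (complex_of_real (P \<alpha>)) (\<Prod>i\<in>UNIV. [:\<i> * z $ i, \<i> * v $ i:] ^ \<alpha> i))"

lemma poly_line_poly: "poly (line_poly P z v) u = mpoly_eval_c P (\<i> *s (z + u *s v))"
  unfolding line_poly_def mpoly_eval_c_def
  by (simp add: poly_sum poly_prod algebra_simps)

text \<open>Only monomials of total degree \<open>n\<close> reach the \<open>n\<close>-th power of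
  the parameter, and in their top coefficient the base point drops out: what remains is the
  principal part at the direction.\<close>

lemma line_poly_coeff:
  assumes P: "is_mpoly P" and n: "\<And>\<alpha>. P \<alpha> \<noteq> 0 \<Longrightarrow> mindex_abs \<alpha> \<le> n"
  shows "degree (line_poly P z v) \<le> n"
    and "coeff (line_poly P z v) n = (\<Sum>\<alpha>\<in>{\<alpha>. P \<alpha> \<noteq> 0 \<and> mindex_abs \<alpha> = n}. P \<alpha> * (\<Prod>i\<in>UNIV. (\<i> * v $ i) ^ \<alpha> i))"
proof -
  have mono: "degree (\<Prod>i\<in>UNIV. [:\<i> * z $ i, \<i> * v $ i:] ^ \<alpha> i) \<le> mindex_abs \<alpha>"
    "coeff (\<Prod>i\<in>UNIV. [:\<i> * z $ i, \<i> * v $ i:] ^ \<alpha> i) (mindex_abs \<alpha>) = (\<Prod>i\<in>UNIV. (\<i> * v $ i) ^ \<alpha> i)" for \<alpha>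
    using coeff_prod_degree_le[of UNIV "\<lambda>i. [:\<i> * z $ i, \<i> * v $ i:] ^ \<alpha> i" \<alpha>] coeff_power_linear
    unfolding mindex_abs_def by auto
  show "degree (line_poly P z v) \<le> n" unfolding line_poly_def
    using P by (intro degree_sum_le) (auto simp: is_mpoly_def intro: order_trans[OF degree_smult_le order_trans[OF mono(1) n]] simp del: degree_smult_eq)
  have "coeff (line_poly P z v) n = (\<Sum>\<alpha>\<in>{\<alpha>. P \<alpha> \<noteq> 0}. if mindex_abs \<alpha> = n then P \<alpha> * (\<Prod>i\<in>UNIV. (\<i> * v $ i) ^ \<alpha> i) else 0)"
    unfolding line_poly_def coeff_sum coeff_smult
  proof (intro sum.cong refl)
    fix \<alpha> assume "\<alpha> \<in> {\<alpha>. P \<alpha> \<noteq> 0}"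
    then have le: "mindex_abs \<alpha> \<le> n" using n by auto
    show "complex_of_real (P \<alpha>) * coeff (\<Prod>i\<in>UNIV. [:\<i> * z $ i, \<i> * v $ i:] ^ \<alpha> i) n = (if mindex_abs \<alpha> = n then P \<alpha> * (\<Prod>i\<in>UNIV. (\<i> * v $ i) ^ \<alpha> i) else 0)"
      using le mono[of \<alpha>] by (auto intro!: coeff_eq_0)
  qed
  also have "\<dots> = (\<Sum>\<alpha>\<in>{\<alpha>. P \<alpha> \<noteq> 0 \<and> mindex_abs \<alpha> = n}. P \<alpha> * (\<Prod>i\<in>UNIV. (\<i> * v $ i) ^ \<alpha> i))"
    using P by (simp add: sum.If_cases is_mpoly_def Int_def)
  finally show "coeff (line_poly P z v) n = (\<Sum>\<alpha>\<in>{\<alpha>. P \<alpha> \<noteq> 0 \<and> mindex_abs \<alpha> = n}. P \<alpha> * (\<Prod>i\<in>UNIV. (\<i> * v $ i) ^ \<alpha> i))" .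
qed

text \<open>Generic weights \<open>w\<close> separate the exponents, so along \<open>v\<^sub>i = exp (t * w\<^sub>i)\<close> one monomial dominates.\<close>
lemma nonzero_polynomial_point:
  fixes A :: "('d::finite \<Rightarrow> nat) set" and c :: "('d \<Rightarrow> nat) \<Rightarrow> real"
  assumes A: "finite A" "A \<noteq> {}" and c: "\<And>\<alpha>. \<alpha> \<in> A \<Longrightarrow> c \<alpha> \<noteq> 0"
  shows "\<exists>v::real^'d. (\<Sum>\<alpha>\<in>A. c \<alpha> * (\<Prod>i\<in>UNIV. (v $ i) ^ \<alpha> i)) \<noteq> 0"
proof -
  let ?e = "\<lambda>\<alpha>. (\<chi> i. real (\<alpha> i)) :: real^'d"
  let ?N = "\<Union>(\<alpha>, \<beta>)\<in>{(\<alpha>, \<beta>). \<alpha> \<in> A \<and> \<beta> \<in> A \<and> \<alpha> \<noteq> \<beta>}. {w. (?e \<alpha> - ?e \<beta>) \<bullet> w = 0}"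
  \<comment> \<open>Finitely many hyperplanes form a null set, so some \<open>w\<close> lies on none
    of them and pairs differently with any two exponents.\<close>
  have "negligible ?N"
  proof (rule negligible_Union)
    have "finite (A \<times> A)" using A by simp
    then show "finite ((\<lambda>(\<alpha>, \<beta>). {w. (?e \<alpha> - ?e \<beta>) \<bullet> w = 0}) ` {(\<alpha>, \<beta>). \<alpha> \<in> A \<and> \<beta> \<in> A \<and> \<alpha> \<noteq> \<beta>})"
      by (intro finite_imageI) (auto elim: rev_finite_subset)
    fix T assume "T \<in> (\<lambda>(\<alpha>, \<beta>). {w. (?e \<alpha> - ?e \<beta>) \<bullet> w = 0}) ` {(\<alpha>, \<beta>). \<alpha> \<in> A \<and> \<beta> \<in> A \<and> \<alpha> \<noteq> \<beta>}"
    then obtain \<alpha> \<beta> where T: "T = {w. (?e \<alpha> - ?e \<beta>) \<bullet> w = 0}" "\<alpha> \<noteq> \<beta>" by auto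
    have "?e \<alpha> - ?e \<beta> \<noteq> 0" using T(2) by (auto simp: vec_eq_iff fun_eq_iff)
    then show "negligible T" unfolding T by (intro negligible_hyperplane) auto
  qed
  then have "?N \<noteq> UNIV" by (rule contrapos_pn) (simp only: non_negligible_UNIV not_False_eq_True)
  then obtain w where w: "w \<notin> ?N" by blast
  have inj: "?e \<alpha> \<bullet> w \<noteq> ?e \<beta> \<bullet> w" if "\<alpha> \<in> A" "\<beta> \<in> A" "\<alpha> \<noteq> \<beta>" for \<alpha> \<beta>
    using w that by (auto simp: inner_diff_left)
  have "Max ((\<lambda>\<alpha>. ?e \<alpha> \<bullet> w) ` A) \<in> (\<lambda>\<alpha>. ?e \<alpha> \<bullet> w) ` A" using A by (intro Max_in) auto
  then obtain a where aM: "a \<in> A" "Max ((\<lambda>\<alpha>. ?e \<alpha> \<bullet> w) ` A) = ?e a \<bullet> w" by (rule imageE)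
  have a: "a \<in> A" "?e \<alpha> \<bullet> w \<le> ?e a \<bullet> w" if "\<alpha> \<in> A" for \<alpha>
    unfolding aM(2)[symmetric] using A aM(1) that by (auto intro: Max_ge)
  define d where "d \<alpha> = ?e \<alpha> \<bullet> w - ?e a \<bullet> w" for \<alpha>
  have d: "d \<alpha> < 0" if "\<alpha> \<in> A" "\<alpha> \<noteq> a" for \<alpha>
    using a(2)[OF that(1)] inj[OF that(1) aM(1) that(2)] unfolding d_def by linarith
  have "((\<lambda>t. \<Sum>\<alpha>\<in>A. c \<alpha> * exp (t * d \<alpha>)) \<longlongrightarrow> (\<Sum>\<alpha>\<in>A. if \<alpha> = a then c \<alpha> else 0)) at_top"
  proof (rule tendsto_sum)
    fix \<alpha> assume \<alpha>: "\<alpha> \<in> A"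
    show "((\<lambda>t. c \<alpha> * exp (t * d \<alpha>)) \<longlongrightarrow> (if \<alpha> = a then c \<alpha> else 0)) at_top"
    proof (cases "\<alpha> = a")
      case False
      have "filterlim (\<lambda>t. t * d \<alpha>) at_bot at_top"
        unfolding mult.commute[of _ "d \<alpha>"]
        by (rule filterlim_tendsto_neg_mult_at_bot[OF tendsto_const d[OF \<alpha> False] filterlim_ident])
      then have "((\<lambda>t. exp (t * d \<alpha>)) \<longlongrightarrow> 0) at_top" by (rule filterlim_compose[OF exp_at_bot])
      then show ?thesis using False by (auto intro: tendsto_mult_right_zero)
    qed (simp add: d_def)
  qed
  moreover have "(\<Sum>\<alpha>\<in>A. if \<alpha> = a then c \<alpha> else 0) = c a" using A aM(1) by simp
  ultimately have "\<forall>\<^sub>F t in at_top. (\<Sum>\<alpha>\<in>A. c \<alpha> * exp (t * d \<alpha>)) \<noteq> 0"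
    using c[OF aM(1)] by (intro tendsto_imp_eventually_ne) auto
  then obtain t where t: "(\<Sum>\<alpha>\<in>A. c \<alpha> * exp (t * d \<alpha>)) \<noteq> 0"
    using eventually_happens by fastforce
  define v :: "real^'d" where "v = (\<chi> i. exp (t * w $ i))"
  have "(\<Prod>i\<in>UNIV. (v $ i) ^ \<alpha> i) = exp (t * (?e a \<bullet> w)) * exp (t * d \<alpha>)" for \<alpha>
  proof -
    have "(\<Prod>i\<in>UNIV. (v $ i) ^ \<alpha> i) = exp (t * (?e \<alpha> \<bullet> w))"
      by (simp add: v_def exp_of_nat_mult[symmetric] exp_sum[symmetric] inner_vec_def sum_distrib_left mult_ac)
    then show ?thesis by (simp add: d_def exp_add[symmetric] algebra_simps)
  qed
  then have "(\<Sum>\<alpha>\<in>A. c \<alpha> * (\<Prod>i\<in>UNIV. (v $ i) ^ \<alpha> i)) = exp (t * (?e a \<bullet> w)) * (\<Sum>\<alpha>\<in>A. c \<alpha> * exp (t * d \<alpha>))"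
    by (simp add: sum_distrib_left mult_ac)
  then show ?thesis using t by (intro exI[of _ v]) simp
qed

definition complexify :: "real^'d::finite \<Rightarrow> complex^'d" where "complexify x = (\<chi> i. complex_of_real (x $ i))"

text \<open>A direction on which the principal part does not vanish. Homogeneity permits scaling it
  into a small ball, so that discs along it stay in a strip; the value \<open>A\<close> serves all
  base points at once.\<close>

lemma mpoly_noncharacteristic_direction:
  fixes P :: "('d::finite \<Rightarrow> nat) \<Rightarrow> real"
  assumes P: "is_mpoly P" "P \<noteq> (\<lambda>_. 0)" and r: "r > 0"
  shows "\<exists>(v::real^'d) n A. norm v \<le> r \<and> A \<noteq> 0 \<and>
    (\<forall>z. degree (line_poly P z (complexify v)) \<le> n \<and> coeff (line_poly P z (complexify v)) n = A)"
proof -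
  let ?S = "{\<alpha>. P \<alpha> \<noteq> 0}"
  have S: "finite ?S" "?S \<noteq> {}" using P by (auto simp: is_mpoly_def)
  define n where "n = Max (mindex_abs ` ?S)"
  have n: "\<And>\<alpha>. P \<alpha> \<noteq> 0 \<Longrightarrow> mindex_abs \<alpha> \<le> n" unfolding n_def using S by (intro Max_ge) auto
  let ?T = "{\<alpha>. P \<alpha> \<noteq> 0 \<and> mindex_abs \<alpha> = n}"
  have "n \<in> mindex_abs ` ?S" unfolding n_def using S by (intro Max_in) auto
  then have T: "finite ?T" "?T \<noteq> {}" using S by (auto intro: finite_subset[OF _ S(1)])
  obtain v0 :: "real^'d" where v0: "(\<Sum>\<alpha>\<in>?T. P \<alpha> * (\<Prod>i\<in>UNIV. (v0 $ i) ^ \<alpha> i)) \<noteq> 0"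
    using nonzero_polynomial_point[OF T, of P] by auto
  define s where "s = r / (1 + norm v0)"
  have s: "s > 0" unfolding s_def using r by (simp add: add_pos_nonneg)
  define v where "v = s *\<^sub>R v0"
  have nv: "norm v \<le> r"
  proof -
    have "norm v = r * (norm v0 / (1 + norm v0))" using r by (simp add: v_def s_def)
    also have "\<dots> \<le> r * 1" using r by (intro mult_left_mono) (auto simp: divide_le_eq_1 add_pos_nonneg)
    finally show ?thesis by simp
  qed
  define A where "A = \<i> ^ n * complex_of_real (s ^ n * (\<Sum>\<alpha>\<in>?T. P \<alpha> * (\<Prod>i\<in>UNIV. (v0 $ i) ^ \<alpha> i)))"
  have "coeff (line_poly P z (complexify v)) n = A" for z
  proof -
    have "(\<Prod>i\<in>UNIV. (\<i> * complexify v $ i) ^ \<alpha> i) = \<i> ^ n * complex_of_real (s ^ n * (\<Prod>i\<in>UNIV. (v0 $ i) ^ \<alpha> i))"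
      if "\<alpha> \<in> ?T" for \<alpha>
    proof -
      have "n = (\<Sum>i\<in>UNIV. \<alpha> i)" using that by (simp add: mindex_abs_def)
      then show ?thesis
        by (simp add: complexify_def v_def power_mult_distrib prod.distrib power_sum)
    qed
    then have "coeff (line_poly P z (complexify v)) n = (\<Sum>\<alpha>\<in>?T. P \<alpha> * (\<i> ^ n * complex_of_real (s ^ n * (\<Prod>i\<in>UNIV. (v0 $ i) ^ \<alpha> i))))"
      using line_poly_coeff(2)[OF P(1) n] by simp
    then show ?thesis by (simp add: A_def sum_distrib_left mult_ac)
  qed
  moreover have "A \<noteq> 0"
  proof -
    have "s ^ n * (\<Sum>\<alpha>\<in>?T. P \<alpha> * (\<Prod>i\<in>UNIV. (v0 $ i) ^ \<alpha> i)) \<noteq> 0" using v0 s by simp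
    then show ?thesis unfolding A_def by (simp only: mult_eq_0_iff of_real_eq_0_iff) simp
  qed
  ultimately show ?thesis using nv line_poly_coeff(1)[OF P(1) n] by blast
qed

section \<open>Growth of the symbol in a strip\<close>

abbreviation Re_vec :: "complex^'d::finite \<Rightarrow> real^'d" where "Re_vec z \<equiv> (\<chi> i. Re (z $ i))"
abbreviation Im_vec :: "complex^'d::finite \<Rightarrow> real^'d" where "Im_vec z \<equiv> (\<chi> i. Im (z $ i))"

lemma strip_iff: "z \<in> strip \<epsilon> \<longleftrightarrow> norm (Im_vec z) < \<epsilon>" unfolding strip_def by simp

lemma Im_vec_line: "Im_vec (z + u *s complexify v) = Im_vec z + Im u *\<^sub>R v"
  by (simp add: vec_eq_iff complexify_def)

lemma Re_vec_line: "Re_vec (z + u *s complexify v) = Re_vec z + Re u *\<^sub>R v"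
  by (simp add: vec_eq_iff complexify_def)

lemma Im_vec_complexify: "Im_vec (complexify x) = 0" by (simp add: complexify_def vec_eq_iff)

lemma Re_vec_complexify: "Re_vec (complexify x) = x" by (simp add: complexify_def vec_eq_iff)

lemma norm_Im_vec_line: "norm (Im_vec (z + u *s complexify v)) \<le> norm (Im_vec z) + \<bar>Im u\<bar> * norm v"
  unfolding Im_vec_line by (rule order_trans[OF norm_triangle_ineq]) simp

lemma bounded_linear_scale_vec: "bounded_linear (\<lambda>u::complex. u *s (v::complex^'d::finite))"
  by (subst linear_conv_bounded_linear[symmetric]) (auto intro!: linearI simp: vec_eq_iff algebra_simps)

lemma line_has_derivative: "((\<lambda>u. z + u *s v) has_derivative (\<lambda>h. h *s (v::complex^'d::finite))) (at u)"
  using has_derivative_add[OF has_derivative_const bounded_linear_imp_has_derivative[OF bounded_linear_scale_vec]] by simp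

text \<open>Homogeneity of the total derivative under complex scalars makes its restriction to a
  line multiplication by the number \<open>F' v\<close>.\<close>

lemma holomorphic_several_line:
  assumes F: "holomorphic_several F S" and T: "open T" "\<And>u. u \<in> T \<Longrightarrow> z + u *s v \<in> S"
  shows "(\<lambda>u. F (z + u *s v)) holomorphic_on T"
  unfolding holomorphic_on_open[OF T(1)]
proof
  fix u assume u: "u \<in> T"
  obtain F' where F': "(F has_derivative F') (at (z + u *s v))" "\<And>c v. F' (c *s v) = c * F' v"
    using F T(2)[OF u] unfolding holomorphic_several_def by blast
  have "((\<lambda>u. F (z + u *s v)) has_derivative (\<lambda>h. F' (h *s v))) (at u)"
    by (rule has_derivative_compose[OF line_has_derivative F'(1)])
  moreover have "(\<lambda>h. F' (h *s v)) = (*) (F' v)" by (simp add: fun_eq_iff F'(2) mult.commute)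
  ultimately show "\<exists>f'. ((\<lambda>u. F (z + u *s v)) has_field_derivative f') (at u)"
    unfolding has_field_derivative_def by auto
qed

lemma holomorphic_several_continuous: "holomorphic_several F S \<Longrightarrow> continuous_on S F"
  unfolding holomorphic_several_def
  by (meson continuous_at_imp_continuous_on has_derivative_continuous)

lemma mpoly_eval_bound:
  fixes Q :: "('d::finite \<Rightarrow> nat) \<Rightarrow> real"
  assumes "is_mpoly Q"
  shows "\<exists>C K. C \<ge> 0 \<and> (\<forall>z. (\<forall>i. \<bar>Im (z $ i)\<bar> \<le> 1) \<longrightarrow> norm (mpoly_eval_c Q (\<i> *s z)) \<le> C * japanese_prod (Re_vec z) ^ K)"
proof -
  let ?S = "{\<alpha>. Q \<alpha> \<noteq> 0}"
  \<comment> \<open>A crude common bound for the degrees; the size of the exponent is immaterial,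
    since \<open>m\<close> is chosen afterwards.\<close>
  define K where "K = (\<Sum>\<alpha>\<in>?S. mindex_abs \<alpha>)"
  define C where "C = (\<Sum>\<alpha>\<in>?S. \<bar>Q \<alpha>\<bar>)"
  have fin: "finite ?S" using assms by (simp add: is_mpoly_def)
  have "norm (mpoly_eval_c Q (\<i> *s z)) \<le> C * japanese_prod (Re_vec z) ^ K" if z: "\<And>i. \<bar>Im (z $ i)\<bar> \<le> 1" for z
  proof -
    let ?B = "japanese_prod (Re_vec z)"
    have "norm (complex_of_real (Q \<alpha>) * (\<Prod>i\<in>UNIV. ((\<i> *s z) $ i) ^ \<alpha> i)) \<le> \<bar>Q \<alpha>\<bar> * ?B ^ K" if \<alpha>: "\<alpha> \<in> ?S" for \<alpha>
    proof -
      have "norm ((\<Prod>i\<in>UNIV. ((\<i> *s z) $ i) ^ \<alpha> i)) = (\<Prod>i\<in>UNIV. norm (z $ i) ^ \<alpha> i)"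
        by (simp add: prod_norm[symmetric] norm_power norm_mult)
      also have "\<dots> \<le> (\<Prod>i\<in>UNIV. ?B ^ \<alpha> i)"
      proof (rule prod_mono)
        fix i
        have "norm (z $ i) \<le> 1 + \<bar>Re (z $ i)\<bar>" using cmod_le[of "z $ i"] z[of i] by linarith
        also have "\<dots> \<le> ?B" using japanese_prod_ge(2)[of "Re_vec z" i] by simp
        finally show "0 \<le> norm (z $ i) ^ \<alpha> i \<and> norm (z $ i) ^ \<alpha> i \<le> ?B ^ \<alpha> i" by (auto intro: power_mono)
      qed
      also have "\<dots> = ?B ^ mindex_abs \<alpha>" by (simp add: mindex_abs_def power_sum)
      also have "\<dots> \<le> ?B ^ K"
        by (rule power_increasing) (use fin \<alpha> in \<open>auto simp: K_def japanese_prod_ge intro: member_le_sum\<close>)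
      finally show ?thesis by (simp add: norm_mult mult_left_mono)
    qed
    then show ?thesis unfolding mpoly_eval_c_def C_def sum_distrib_right by (rule sum_norm_le)
  qed
  moreover have "C \<ge> 0" unfolding C_def by (simp add: sum_nonneg)
  ultimately show ?thesis by blast
qed

lemma japanese_prod_add_le:
  fixes x y :: "real^'d::finite"
  assumes "\<And>i. \<bar>y $ i\<bar> \<le> 1"
  shows "japanese_prod (x + y) \<le> 2 ^ CARD('d) * japanese_prod x"
proof -
  have "japanese_prod (x + y) \<le> (\<Prod>i\<in>UNIV. 2 * (1 + \<bar>x $ i\<bar>))"
    unfolding japanese_prod_def
  proof (rule prod_mono)
    fix i
    show "0 \<le> 1 + \<bar>(x + y) $ i\<bar> \<and> 1 + \<bar>(x + y) $ i\<bar> \<le> 2 * (1 + \<bar>x $ i\<bar>)" using assms[of i] by auto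
  qed
  then show ?thesis unfolding japanese_prod_def by (simp only: prod.distrib prod_constant card_UNIV_unit)
qed

section \<open>The symbol of the pure operator near the real space\<close>

definition pure_symbol :: "nat \<Rightarrow> complex^'d::finite \<Rightarrow> complex" where
  "pure_symbol m z = 1 + (\<Sum>i\<in>UNIV. (z $ i) ^ m)"

text \<open>A difference of powers contains the factor \<open>z - Re z\<close>, of modulus at most
  \<open>\<tau>\<close>; each term of the cofactor is bounded by a power of
  \<open>1 + \<bar>Re z\<bar>\<close>.\<close>

lemma norm_power_diff_le:
  fixes z :: complex
  assumes "\<bar>Im z\<bar> \<le> \<tau>" "\<tau> \<le> 1" "even m"
  shows "norm (z ^ m - complex_of_real (Re z) ^ m) \<le> \<tau> * m * 2 ^ m * (1 + Re z ^ m)"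
proof -
  have \<tau>: "\<tau> \<ge> 0" using assms by simp
  have d: "norm (z - complex_of_real (Re z)) \<le> \<tau>"
  proof -
    have "z - complex_of_real (Re z) = \<i> * complex_of_real (Im z)" by (simp add: complex_eq_iff)
    then show ?thesis using assms(1) by (simp add: norm_mult)
  qed
  have nz: "norm z \<le> 1 + \<bar>Re z\<bar>" using cmod_le[of z] assms by linarith
  have p: "(1 + \<bar>Re z\<bar>) ^ m \<le> 2 ^ m * (1 + Re z ^ m)"
  proof -
    have "(1 + \<bar>Re z\<bar>) ^ m \<le> (2 * max 1 \<bar>Re z\<bar>) ^ m" by (intro power_mono) auto
    also have "\<dots> = 2 ^ m * (max 1 \<bar>Re z\<bar>) ^ m" by (simp add: power_mult_distrib)
    also have "\<dots> \<le> 2 ^ m * (1 + \<bar>Re z\<bar> ^ m)" by (intro mult_left_mono) (auto simp: max_def)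
    finally show ?thesis using assms by (simp add: power_even_abs)
  qed
  have "norm (\<Sum>k<m. complex_of_real (Re z) ^ (m - Suc k) * z ^ k) \<le> (\<Sum>k<m. (1 + \<bar>Re z\<bar>) ^ m)"
  proof (rule sum_norm_le)
    fix k assume k: "k \<in> {..<m}"
    have "norm (complex_of_real (Re z) ^ (m - Suc k) * z ^ k) \<le> (1 + \<bar>Re z\<bar>) ^ (m - Suc k) * (1 + \<bar>Re z\<bar>) ^ k"
      unfolding norm_mult norm_power using nz by (intro mult_mono power_mono) auto
    also have "\<dots> = (1 + \<bar>Re z\<bar>) ^ (m - 1)" using k by (simp add: power_add[symmetric])
    also have "\<dots> \<le> (1 + \<bar>Re z\<bar>) ^ m" by (rule power_increasing) auto
    finally show "norm (complex_of_real (Re z) ^ (m - Suc k) * z ^ k) \<le> (1 + \<bar>Re z\<bar>) ^ m" .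
  qed
  then have s: "norm (\<Sum>k<m. complex_of_real (Re z) ^ (m - Suc k) * z ^ k) \<le> m * (2 ^ m * (1 + Re z ^ m))"
    using mult_left_mono[OF p, of "real m"] by simp
  have "norm (z ^ m - complex_of_real (Re z) ^ m) = norm (z - complex_of_real (Re z)) * norm (\<Sum>k<m. complex_of_real (Re z) ^ (m - Suc k) * z ^ k)"
    unfolding power_diff_sumr2 norm_mult by simp
  also have "\<dots> \<le> \<tau> * (m * (2 ^ m * (1 + Re z ^ m)))" by (rule mult_mono[OF d s \<tau>]) simp
  finally show ?thesis by (simp add: mult.assoc)
qed

text \<open>On a narrow strip the symbol differs from its value at the real part by at most half of
  that value, so it cannot vanish and keeps the same growth.\<close>

lemma pure_symbol_lower_bound:
  fixes z :: "complex^'d::finite" and \<tau> :: real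
  assumes "\<And>i. \<bar>Im (z $ i)\<bar> \<le> \<tau>" "\<tau> \<le> 1" "even m" "\<tau> * m * 2 ^ m * CARD('d) \<le> 1 / 2"
  shows "1 + (\<Sum>i\<in>UNIV. Re (z $ i) ^ m) \<le> 2 * norm (pure_symbol m z)"
proof -
  let ?s = "\<Sum>i\<in>UNIV. Re (z $ i) ^ m"
  define c where "c = \<tau> * m * 2 ^ m"
  have \<tau>: "\<tau> \<ge> 0" using assms(1) abs_ge_zero order_trans by blast
  have c: "c \<ge> 0" "c * CARD('d) \<le> 1 / 2" using \<tau> assms(4) by (auto simp: c_def)
  have s: "?s \<ge> 0" by (intro sum_nonneg zero_le_even_power assms)
  have "norm (pure_symbol m z - complex_of_real (1 + ?s)) = norm (\<Sum>i\<in>UNIV. (z $ i) ^ m - complex_of_real (Re (z $ i)) ^ m)"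
    by (simp add: pure_symbol_def sum_subtractf)
  also have "\<dots> \<le> (\<Sum>i\<in>UNIV. c * (1 + Re (z $ i) ^ m))"
    unfolding c_def by (intro sum_norm_le norm_power_diff_le assms)
  also have "\<dots> = c * CARD('d) + c * ?s" by (simp add: algebra_simps sum.distrib sum_distrib_left)
  also have "\<dots> \<le> 1 / 2 + (1/2) * ?s"
  proof (intro add_mono mult_right_mono s)
    have "c * 1 \<le> c * CARD('d)" using c by (intro mult_left_mono) (auto simp: Suc_le_eq)
    then show "c \<le> 1 / 2" using c by simp
  qed (use c in auto)
  finally have 1: "norm (pure_symbol m z - complex_of_real (1 + ?s)) \<le> (1 + ?s) / 2" by simp
  have "norm (complex_of_real (1 + ?s)) = 1 + ?s" unfolding norm_of_real using s by simp
  then have "1 + ?s \<le> norm (pure_symbol m z) + norm (pure_symbol m z - complex_of_real (1 + ?s))"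
    using norm_triangle_ineq4[of "pure_symbol m z" "pure_symbol m z - complex_of_real (1 + ?s)"] by simp
  then show ?thesis using 1 by simp
qed

section \<open>Growth and decay of the quotient symbol\<close>

context
  fixes P Q :: "('d::finite \<Rightarrow> nat) \<Rightarrow> real" and \<epsilon> :: real and F :: "complex^'d \<Rightarrow> complex"
  assumes P: "is_mpoly P" "P \<noteq> (\<lambda>_. 0)" and Q: "is_mpoly Q" and \<epsilon>: "\<epsilon> > 0"
    and F: "holomorphic_several F (strip \<epsilon>)"
    and FPQ: "\<And>z. z \<in> strip \<epsilon> \<Longrightarrow> mpoly_eval_c P (\<i> *s z) \<noteq> 0 \<Longrightarrow> F z = mpoly_eval_c Q (\<i> *s z) / mpoly_eval_c P (\<i> *s z)"
begin

text \<open>On the unit circle of a disc along a noncharacteristic direction, the product of p and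
  \<open>F\<close> is bounded by the values of q, hence polynomially.
  \<open>lead_coeff_mult_le_circle_bound\<close> transfers this to \<open>F z\<close>, with a
  leading coefficient \<open>A\<close> that does not depend on \<open>z\<close>.\<close>

lemma symbol_polynomial_bound:
  "\<exists>C K r. C \<ge> 0 \<and> 0 < r \<and> r \<le> 1/2 \<and> r \<le> \<epsilon> \<and> (\<forall>z. norm (Im_vec z) < r \<longrightarrow> norm (F z) \<le> C * japanese_prod (Re_vec z) ^ K)"
proof -
  obtain C K where C: "C \<ge> 0" and
    K: "\<And>z. (\<And>i. \<bar>Im (z $ i)\<bar> \<le> 1) \<Longrightarrow> norm (mpoly_eval_c Q (\<i> *s z)) \<le> C * japanese_prod (Re_vec z) ^ K"
    using mpoly_eval_bound[OF Q] by metis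
  \<comment> \<open>Discs of radius 2 along a direction of norm at most \<open>r\<close> leave
    imaginary parts at most \<open>3 * r\<close>, which is below both \<open>\<epsilon>\<close> and
    1.\<close>
  define r where "r = min (\<epsilon> / 4) (1 / 4)"
  have r: "r > 0" using \<epsilon> by (simp add: r_def)
  obtain v :: "real^'d" and n A where v: "norm v \<le> r" "A \<noteq> 0"
    and lp: "\<And>z. degree (line_poly P z (complexify v)) \<le> n" "\<And>z. coeff (line_poly P z (complexify v)) n = A"
    using mpoly_noncharacteristic_direction[OF P r] by metis
  have "norm (F z) \<le> (C * (2 ^ CARD('d)) ^ K / norm A) * japanese_prod (Re_vec z) ^ K" if z: "norm (Im_vec z) < r" for z
  proof -
    let ?l = "\<lambda>u. z + u *s complexify v"
    have im: "norm (Im_vec (?l u)) \<le> 3 * r" if "u \<in> ball 0 2" for u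
    proof -
      have "\<bar>Im u\<bar> \<le> 2" using that abs_Im_le_cmod[of u] by simp
      then have "\<bar>Im u\<bar> * norm v \<le> 2 * r" using v r by (intro mult_mono) auto
      then show ?thesis using norm_Im_vec_line[of z u v] z by linarith
    qed
    have st: "?l u \<in> strip \<epsilon>" if "u \<in> ball 0 2" for u
      using im[OF that] r \<epsilon> unfolding strip_iff r_def by (auto simp: min_def split: if_splits)
    have hol: "(\<lambda>u. F (?l u)) holomorphic_on ball 0 2"
      by (rule holomorphic_several_line[OF F _ st]) auto
    have bd: "norm (poly (line_poly P z (complexify v)) u * F (?l u)) \<le> C * (2 ^ CARD('d) * japanese_prod (Re_vec z)) ^ K"
      if u: "norm u = 1" for u
    proof -
      have u2: "u \<in> ball 0 2" using u by simp
      \<comment> \<open>At a zero of p the left side is 0, so the estimate holds there although the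
        quotient formula is silent.\<close>
      have "norm (mpoly_eval_c P (\<i> *s ?l u) * F (?l u)) \<le> norm (mpoly_eval_c Q (\<i> *s ?l u))"
        using FPQ[OF st[OF u2]] by (cases "mpoly_eval_c P (\<i> *s ?l u) = 0") auto
      also have "\<dots> \<le> C * japanese_prod (Re_vec (?l u)) ^ K"
      proof (rule K)
        fix i
        have "\<bar>Im (?l u $ i)\<bar> \<le> norm (Im_vec (?l u))" using component_le_norm_cart[of "Im_vec (?l u)" i] by simp
        also have "\<dots> \<le> 3 * r" by (rule im[OF u2])
        also have "\<dots> \<le> 1" by (simp add: r_def min_def)
        finally show "\<bar>Im (?l u $ i)\<bar> \<le> 1" .
      qed
      also have "\<dots> \<le> C * (2 ^ CARD('d) * japanese_prod (Re_vec z)) ^ K"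
      proof (intro mult_left_mono power_mono)
        show "japanese_prod (Re_vec (?l u)) \<le> 2 ^ CARD('d) * japanese_prod (Re_vec z)"
          unfolding Re_vec_line
        proof (rule japanese_prod_add_le)
          fix i
          have "\<bar>Re u\<bar> * \<bar>v $ i\<bar> \<le> 1 * 1"
            using u abs_Re_le_cmod[of u] component_le_norm_cart[of v i] v(1)
            by (intro mult_mono) (auto simp: r_def min_def split: if_splits)
          then show "\<bar>(Re u *\<^sub>R v) $ i\<bar> \<le> 1" by (simp add: abs_mult)
        qed
        show "0 \<le> japanese_prod (Re_vec (?l u))" using japanese_prod_ge(1) order_trans zero_le_one by blast
      qed (rule C)
      finally show ?thesis unfolding poly_line_poly .
    qed
    have "norm (coeff (line_poly P z (complexify v)) n) * norm (F (?l 0)) \<le> C * (2 ^ CARD('d) * japanese_prod (Re_vec z)) ^ K"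
      by (rule lead_coeff_mult_le_circle_bound[OF hol]) (use lp bd in auto)
    then have "norm A * norm (F z) \<le> C * (2 ^ CARD('d) * japanese_prod (Re_vec z)) ^ K"
      unfolding lp by simp
    then show ?thesis using v(2) by (simp add: power_mult_distrib field_simps)
  qed
  moreover have "C * (2 ^ CARD('d)) ^ K / norm A \<ge> 0" using C by simp
  moreover have "r \<le> 1/2" "r \<le> \<epsilon>" using \<epsilon> by (auto simp: r_def min_def)
  ultimately show ?thesis using r by blast
qed

text \<open>At zeros of p the quotient formula says nothing. On a line in a noncharacteristic
  direction p has finitely many zeros, so the product identity holds near the point and extends to
  it by continuity.\<close>

lemma symbol_mult_eq: "F (complexify \<xi>) * mpoly_eval_c P (\<i> *s complexify \<xi>) = mpoly_eval_c Q (\<i> *s complexify \<xi>)"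
proof -
  let ?z = "complexify \<xi>"
  obtain v :: "real^'d" and n A where v: "norm v \<le> 1" "A \<noteq> 0"
    and lp: "\<And>z. coeff (line_poly P z (complexify v)) n = A"
    using mpoly_noncharacteristic_direction[OF P zero_less_one] by metis
  let ?v = "complexify v"
  let ?T = "ball (0::complex) \<epsilon>"
  have st: "?z + u *s ?v \<in> strip \<epsilon>" if "u \<in> ?T" for u
  proof -
    have "\<bar>Im u\<bar> * norm v \<le> norm u * 1" using v(1) abs_Im_le_cmod by (intro mult_mono) auto
    then show ?thesis unfolding strip_iff using norm_Im_vec_line[of ?z u v] that by (simp add: Im_vec_complexify)
  qed
  have cont: "continuous_on ?T (\<lambda>u. F (?z + u *s ?v))"
    by (rule holomorphic_on_imp_continuous_on[OF holomorphic_several_line[OF F _ st]]) auto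
  define h where "h u = F (?z + u *s ?v) * poly (line_poly P ?z ?v) u - poly (line_poly Q ?z ?v) u" for u
  have "continuous_on ?T h" unfolding h_def by (intro continuous_intros cont)
  then have lim: "(h \<longlongrightarrow> h 0) (at 0)"
    using \<epsilon> by (simp add: continuous_on_eq_continuous_at isCont_def)
  have "line_poly P ?z ?v \<noteq> 0" using lp[of ?z] v(2) by auto
  then have "\<not> 0 islimpt {u. poly (line_poly P ?z ?v) u = 0}"
    using poly_roots_finite islimpt_finite by blast
  then have "\<forall>\<^sub>F u in at 0. poly (line_poly P ?z ?v) u \<noteq> 0" unfolding islimpt_iff_eventually by simp
  moreover have "\<forall>\<^sub>F u in at 0. u \<in> ?T" by (rule eventually_at_in_open') (use \<epsilon> in auto)
  ultimately have "\<forall>\<^sub>F u in at 0. h u = 0"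
  proof eventually_elim
    case (elim u)
    then show ?case unfolding h_def poly_line_poly using FPQ[OF st[of u]] by simp
  qed
  then have "(h \<longlongrightarrow> 0) (at 0)" by (rule tendsto_eventually)
  then have "h 0 = 0" using lim tendsto_unique[OF at_neq_bot] by blast
  then show ?thesis unfolding h_def poly_line_poly by simp
qed

lemma symbol_decay:
  "\<exists>m r C. 4 dvd m \<and> 0 < r \<and> r \<le> 1 \<and> C \<ge> 0 \<and> (\<forall>z. norm (Im_vec z) < r \<longrightarrow>
     z \<in> strip \<epsilon> \<and> pure_symbol m z \<noteq> 0 \<and> norm (F z / pure_symbol m z) \<le> C / japanese_prod (Re_vec z) ^ 2)"
proof -
  obtain C K r where C: "C \<ge> 0" and r: "0 < r" "r \<le> 1/2" "r \<le> \<epsilon>"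
    and FB: "\<And>z. norm (Im_vec z) < r \<Longrightarrow> norm (F z) \<le> C * japanese_prod (Re_vec z) ^ K"
    using symbol_polynomial_bound by metis
  \<comment> \<open>\<open>K\<close> absorbs the growth of \<open>F\<close>, the summand 2 leaves an
    integrable inverse square, and the factor 4 gives \<open>4 dvd m\<close>.\<close>
  define s where "s = 4 * (K + 2)"
  define m where "m = CARD('d) * s"
  have m4: "4 dvd m" unfolding m_def s_def by (metis dvd_mult dvd_triv_left)
  then have ev: "even m" by (meson dvd_trans even_numeral)
  \<comment> \<open>The width depends on \<open>m\<close>: it is the smallness that
    \<open>pure_symbol_lower_bound\<close> demands, with 1 added to keep the denominator
    positive.\<close>
  define \<tau> where "\<tau> = min r (1 / (2 * (1 + m * 2 ^ m * CARD('d))))"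
  have \<tau>: "0 < \<tau>" "\<tau> \<le> r" unfolding \<tau>_def using r by (auto simp: add_pos_nonneg)
  have \<tau>m: "\<tau> * m * 2 ^ m * CARD('d) \<le> 1/2"
  proof -
    let ?X = "m * 2 ^ m * real CARD('d)"
    have X: "?X \<ge> 0" by simp
    have "\<tau> \<le> 1 / (2 * (1 + ?X))" unfolding \<tau>_def by simp
    then have "\<tau> * ?X \<le> 1 / (2 * (1 + ?X)) * ?X" using X by (rule mult_right_mono)
    also have "\<dots> = 1/2 * (?X / (1 + ?X))" by simp
    also have "\<dots> \<le> 1/2 * 1" using X by (intro mult_left_mono) (auto simp: divide_le_eq_1 add_pos_nonneg)
    finally show ?thesis by (simp add: mult.assoc)
  qed
  define E where "E = C * (2 * (2 ^ m * CARD('d)))"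
  have E: "E \<ge> 0" using C by (simp add: E_def)
  have "z \<in> strip \<epsilon> \<and> pure_symbol m z \<noteq> 0 \<and> norm (F z / pure_symbol m z) \<le> E / japanese_prod (Re_vec z) ^ 2"
    if z: "norm (Im_vec z) < \<tau>" for z
  proof (intro conjI)
    let ?J = "japanese_prod (Re_vec z)" and ?R = "1 + (\<Sum>i\<in>UNIV. Re (z $ i) ^ m)"
    have J: "?J \<ge> 1" by (rule japanese_prod_ge)
    show "z \<in> strip \<epsilon>" using z \<tau> r unfolding strip_iff by linarith
    have R1: "?R \<ge> 1" using ev by (simp add: sum_nonneg zero_le_even_power)
    have lb: "?R \<le> 2 * norm (pure_symbol m z)"
    proof (rule pure_symbol_lower_bound[OF _ _ ev \<tau>m])
      show "\<bar>Im (z $ i)\<bar> \<le> \<tau>" for i using component_le_norm_cart[of "Im_vec z" i] z by simp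
      show "\<tau> \<le> 1" using \<tau> r by linarith
    qed
    then show "pure_symbol m z \<noteq> 0" using R1 by auto
    have "?J ^ K * ?J ^ 2 \<le> ?J ^ s" unfolding power_add[symmetric] using J by (intro power_increasing) (auto simp: s_def)
    also have "\<dots> \<le> 2 ^ m * CARD('d) * ?R"
      using japanese_prod_power_le[of s "Re_vec z"] ev by (simp add: m_def)
    also have "\<dots> \<le> (2 ^ m * CARD('d)) * (2 * norm (pure_symbol m z))" using lb by (intro mult_left_mono) auto
    finally have JJ: "?J ^ K * ?J ^ 2 \<le> (2 * (2 ^ m * CARD('d))) * norm (pure_symbol m z)" by (simp add: mult_ac)
    have "norm (F z) * ?J ^ 2 \<le> (C * ?J ^ K) * ?J ^ 2" using FB[of z] z \<tau> by (intro mult_right_mono) auto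
    also have "\<dots> = C * (?J ^ K * ?J ^ 2)" by simp
    also have "\<dots> \<le> C * ((2 * (2 ^ m * CARD('d))) * norm (pure_symbol m z))" by (rule mult_left_mono[OF JJ C])
    finally have "norm (F z) * ?J ^ 2 \<le> E * norm (pure_symbol m z)" by (simp add: E_def mult.assoc)
    moreover have "0 < norm (pure_symbol m z)" using lb R1 by linarith
    moreover have "0 < ?J ^ 2" using J by simp
    ultimately show "norm (F z / pure_symbol m z) \<le> E / ?J ^ 2"
      by (simp only: norm_divide pos_divide_le_eq pos_le_divide_eq times_divide_eq_left mult.commute)
  qed
  then show ?thesis using m4 \<tau> r E by (intro exI[of _ m] exI[of _ \<tau>] exI[of _ E]) auto
qed

end

section \<open>Contour shift and the convolution kernel\<close>

text \<open>Cauchy's estimate bounds the difference quotients by the dominating function, so one may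
  differentiate under the integral.\<close>
lemma holomorphic_integral:
  fixes h :: "'a \<Rightarrow> complex \<Rightarrow> complex"
  assumes U: "open U" and hol: "\<And>\<xi>. h \<xi> holomorphic_on U"
    and ms: "\<And>w. w \<in> U \<Longrightarrow> (\<lambda>\<xi>. h \<xi> w) \<in> borel_measurable M"
    and dom: "\<And>\<xi> w. w \<in> U \<Longrightarrow> norm (h \<xi> w) \<le> D \<xi>" and D: "integrable M D"
  shows "(\<lambda>w. LINT \<xi>|M. h \<xi> w) holomorphic_on U"
  unfolding holomorphic_on_open[OF U]
proof
  fix w0 assume w0: "w0 \<in> U"
  obtain r where r: "r > 0" "cball w0 r \<subseteq> U" using U w0 open_contains_cball by blast
  have int: "integrable M (\<lambda>\<xi>. h \<xi> w)" if "w \<in> U" for w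
    by (rule Bochner_Integration.integrable_bound[OF D ms[OF that]]) (use dom[OF that] in \<open>auto intro!: AE_I2 order_trans[OF _ abs_ge_self]\<close>)
  have der: "(h \<xi> has_field_derivative deriv (h \<xi>) w) (at w)" if "w \<in> U" for \<xi> w
    using holomorphic_derivI[OF hol U that] .
  \<comment> \<open>Half of the radius is reserved for the Cauchy circle about \<open>w\<close>,
    which therefore stays inside \<open>cball w0 r\<close>.\<close>
  have dbound: "norm (deriv (h \<xi>) w) \<le> D \<xi> / (r/2)" if w: "w \<in> cball w0 (r/2)" for \<xi> w
  proof -
    have sub: "cball w (r/2) \<subseteq> U" using w r(2) by (auto simp: cball_def subset_eq) (smt (verit) dist_triangle)
    have "norm ((deriv ^^ 1) (h \<xi>) w) \<le> fact 1 * D \<xi> / (r/2) ^ 1"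
    proof (rule Cauchy_inequality)
      show "h \<xi> holomorphic_on ball w (r/2)" by (rule holomorphic_on_subset[OF hol]) (use sub ball_subset_cball in blast)
      show "continuous_on (cball w (r/2)) (h \<xi>)"
        by (rule continuous_on_subset[OF holomorphic_on_imp_continuous_on[OF hol] sub])
      show "norm (h \<xi> x) \<le> D \<xi>" if "norm (w - x) = r/2" for x
        using that sub by (intro dom) (auto simp: dist_norm)
    qed (use r in simp)
    then show ?thesis by simp
  qed
  have qbound: "norm ((h \<xi> w - h \<xi> w0) / (w - w0)) \<le> D \<xi> / (r/2)" if w: "w \<in> cball w0 (r/2)" "w \<noteq> w0" for \<xi> w
  proof -
    have "norm (h \<xi> w - h \<xi> w0) \<le> D \<xi> / (r/2) * norm (w - w0)"
    proof (rule field_differentiable_bound)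
      show "convex (cball w0 (r/2))" by simp
      show "(h \<xi> has_field_derivative deriv (h \<xi>) z) (at z within cball w0 (r/2))" if "z \<in> cball w0 (r/2)" for z
      proof (rule has_field_derivative_at_within[OF der])
        show "z \<in> U" using r by (intro subsetD[OF r(2)]) (use that in auto)
      qed
      show "norm (deriv (h \<xi>) z) \<le> D \<xi> / (r/2)" if "z \<in> cball w0 (r/2)" for z by (rule dbound[OF that])
    qed (use w r in auto)
    then show ?thesis using w(2) by (simp add: norm_divide pos_divide_le_eq)
  qed
  have "((\<lambda>w. ((LINT \<xi>|M. h \<xi> w) - (LINT \<xi>|M. h \<xi> w0)) / (w - w0)) \<longlongrightarrow> (LINT \<xi>|M. deriv (h \<xi>) w0)) (at w0)"
    unfolding tendsto_at_iff_sequentially comp_def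
  proof (intro allI impI)
    fix X assume X0: "\<forall>i. X i \<in> UNIV - {w0}" and X: "X \<longlonglongrightarrow> w0"
    have "\<forall>\<^sub>F n in sequentially. X n \<in> ball w0 (r/2)" by (rule topological_tendstoD[OF X]) (use r in auto)
    then obtain N where N: "\<And>n. n \<ge> N \<Longrightarrow> X n \<in> ball w0 (r/2)" by (auto simp: eventually_sequentially)
    define Y where "Y n = X (n + N)" for n
    have Y: "Y n \<in> cball w0 (r/2)" "Y n \<noteq> w0" "Y n \<in> U" for n
      using N[of "n + N"] X0 r by (auto simp: Y_def)
    have Yl: "Y \<longlonglongrightarrow> w0" unfolding Y_def using X by (rule LIMSEQ_ignore_initial_segment)
    have lim: "(\<lambda>n. (h \<xi> (Y n) - h \<xi> w0) / (Y n - w0)) \<longlonglongrightarrow> deriv (h \<xi>) w0" for \<xi>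
    proof -
      have "((\<lambda>w. (h \<xi> w - h \<xi> w0) / (w - w0)) \<longlongrightarrow> deriv (h \<xi>) w0) (at w0)"
        using der[OF w0, of \<xi>] by (simp add: has_field_derivative_iff)
      then show ?thesis by (rule filterlim_compose) (use Yl Y in \<open>auto simp: filterlim_at\<close>)
    qed
    have msq: "(\<lambda>\<xi>. (h \<xi> (Y n) - h \<xi> w0) / (Y n - w0)) \<in> borel_measurable M" for n
      by (intro borel_measurable_divide borel_measurable_diff borel_measurable_const ms Y w0)
    have "(\<lambda>n. LINT \<xi>|M. (h \<xi> (Y n) - h \<xi> w0) / (Y n - w0)) \<longlonglongrightarrow> (LINT \<xi>|M. deriv (h \<xi>) w0)"
    proof (rule integral_dominated_convergence[where w="\<lambda>\<xi>. D \<xi> / (r/2)"])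
      show "(\<lambda>\<xi>. deriv (h \<xi>) w0) \<in> borel_measurable M"
        by (rule borel_measurable_LIMSEQ_metric[OF msq lim])
      show "integrable M (\<lambda>\<xi>. D \<xi> / (r/2))" by (intro integrable_divide D)
      show "AE \<xi> in M. norm ((h \<xi> (Y n) - h \<xi> w0) / (Y n - w0)) \<le> D \<xi> / (r/2)" for n
        by (intro AE_I2 qbound Y)
    qed (use msq lim in auto)
    moreover have "(LINT \<xi>|M. (h \<xi> (Y n) - h \<xi> w0) / (Y n - w0)) = ((LINT \<xi>|M. h \<xi> (Y n)) - (LINT \<xi>|M. h \<xi> w0)) / (Y n - w0)" for n
      unfolding integral_divide_zero by (subst Bochner_Integration.integral_diff) (auto intro: int Y w0)
    ultimately have "(\<lambda>n. ((LINT \<xi>|M. h \<xi> (Y n)) - (LINT \<xi>|M. h \<xi> w0)) / (Y n - w0)) \<longlonglongrightarrow> (LINT \<xi>|M. deriv (h \<xi>) w0)" by (simp only:)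
    then show "(\<lambda>n. ((LINT \<xi>|M. h \<xi> (X n)) - (LINT \<xi>|M. h \<xi> w0)) / (X n - w0)) \<longlonglongrightarrow> (LINT \<xi>|M. deriv (h \<xi>) w0)"
      unfolding Y_def by (rule LIMSEQ_offset)
  qed
  then show "\<exists>f'. ((\<lambda>w. LINT \<xi>|M. h \<xi> w) has_field_derivative f') (at w0)"
    unfolding has_field_derivative_iff by blast
qed

text \<open>Translation invariance makes the integral constant on real parameters, hence constant.\<close>
lemma contour_shift:
  fixes k :: "complex^'d::finite \<Rightarrow> complex" and \<eta> :: "real^'d"
  assumes hol: "\<And>\<xi>. (\<lambda>w. k (complexify \<xi> + w *s complexify \<eta>)) holomorphic_on ball 0 2"
    and ms: "\<And>w. w \<in> ball 0 2 \<Longrightarrow> (\<lambda>\<xi>. k (complexify \<xi> + w *s complexify \<eta>)) \<in> borel_measurable borel"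
    and dom: "\<And>\<xi> w. w \<in> ball 0 2 \<Longrightarrow> norm (k (complexify \<xi> + w *s complexify \<eta>)) \<le> D \<xi>" and D: "integrable lborel D"
  shows "(LINT \<xi>|lborel. k (complexify \<xi> + \<i> *s complexify \<eta>)) = (LINT \<xi>|lborel. k (complexify \<xi>))"
proof -
  define J where "J w = (LINT \<xi>|lborel. k (complexify \<xi> + w *s complexify \<eta>))" for w
  have J: "J holomorphic_on ball 0 2" unfolding J_def[abs_def]
    by (rule holomorphic_integral[OF open_ball hol _ dom D]) (use ms in auto)
  have real: "J (complex_of_real t) = J 0" for t
  proof -
    have c: "complexify \<xi> + complex_of_real t *s complexify \<eta> = complexify (t *\<^sub>R \<eta> + \<xi>)" for \<xi>
      by (simp add: complexify_def vec_eq_iff)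
    have "(\<lambda>\<xi>. k (complexify \<xi>)) \<in> borel_measurable borel" using ms[of 0] by simp
    from lborel_integral_shift[OF this, of "t *\<^sub>R \<eta>"] show ?thesis by (simp add: J_def c)
  qed
  \<comment> \<open>The real points accumulate at 0, so the identity theorem applies on the whole
    disc; radius 2 leaves room for the point \<open>\<i>\<close>.\<close>
  have "J \<i> - J 0 = 0"
  proof (rule analytic_continuation[where f="\<lambda>w. J w - J 0" and S="ball 0 2" and U="complex_of_real ` {0<..<1}" and \<xi>=0])
    show "(\<lambda>w. J w - J 0) holomorphic_on ball 0 2" by (intro holomorphic_intros J)
    show "complex_of_real ` {0<..<1} \<subseteq> ball 0 2" by auto
    show "0 islimpt complex_of_real ` {0<..<1}"
      unfolding islimpt_approachable
    proof (intro allI impI)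
      fix e :: real assume "e > 0"
      then show "\<exists>x'\<in>complex_of_real ` {0<..<1}. x' \<noteq> 0 \<and> dist x' 0 < e"
        by (intro bexI[of _ "complex_of_real (min (1/2) (e/2))"]) auto
    qed
    show "J z - J 0 = 0" if "z \<in> complex_of_real ` {0<..<1}" for z using that real by auto
  qed auto
  then show ?thesis by (simp add: J_def)
qed

section \<open>Construction and decay of the kernel\<close>

lemma lborel_integral_reflect:
  fixes g :: "'a::euclidean_space \<Rightarrow> 'b::{banach,second_countable_topology}"
  assumes [measurable]: "g \<in> borel_measurable borel"
  shows "(LINT x|lborel. g (t - x)) = (LINT x|lborel. g x)"
proof -
  have "(LINT x|lborel. g x) = (LINT x|density (distr lborel borel (\<lambda>x. t + (-1) *\<^sub>R x)) (\<lambda>_. ennreal (\<bar>-1\<bar> ^ DIM('a))). g x)"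
    using lborel_affine[of "-1" t] by simp
  also have "\<dots> = (LINT x|lborel. g (t - x))"
    by (subst integral_density, simp, simp, simp, simp, subst integral_distr) auto
  finally show ?thesis by simp
qed

text \<open>The bilinear extension of the inner product, not the Hermitian one, so that it is
  holomorphic in \<open>z\<close>.\<close>

definition cdot :: "complex^'d::finite \<Rightarrow> real^'d \<Rightarrow> complex" where
  "cdot z y = (\<Sum>i\<in>UNIV. z $ i * complex_of_real (y $ i))"

lemma cdot_line: "cdot (z + w *s v) y = cdot z y + w * cdot v y"
  by (simp add: cdot_def sum.distrib sum_distrib_left algebra_simps)

lemma cdot_complexify: "cdot (complexify x) y = complex_of_real (x \<bullet> y)"
  by (simp add: cdot_def complexify_def inner_vec_def)

lemma continuous_on_complexify: "continuous_on S (\<lambda>\<xi>. complexify \<xi> + c)"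
proof (rule continuous_on_add[OF _ continuous_on_const])
  show "continuous_on S complexify"
    unfolding complexify_def[abs_def]
    by (rule continuous_on_vec_lambda) (intro continuous_intros)
qed

lemma imag_vec_complexify: "imag_vec \<xi> = \<i> *s complexify \<xi>"
  by (simp add: imag_vec_def complexify_def vec_eq_iff)

text \<open>The inverse transform \<open>gc\<close> may be complex, but the test functions and the
  right-hand side are real, so its real part represents the same function. The normalization
  \<open>N\<close> is the constant of Fourier inversion.\<close>

lemma kernel_exists:
  fixes P Q :: "('d::finite \<Rightarrow> nat) \<Rightarrow> real" and \<epsilon> :: real and F :: "complex^'d \<Rightarrow> complex"
  assumes P: "is_mpoly P" "P \<noteq> (\<lambda>_. 0)" and Q: "is_mpoly Q" and \<epsilon>: "\<epsilon> > 0"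
    and F: "holomorphic_several F (strip \<epsilon>)"
    and FPQ: "\<And>z. z \<in> strip \<epsilon> \<Longrightarrow> mpoly_eval_c P (\<i> *s z) \<noteq> 0 \<Longrightarrow> F z = mpoly_eval_c Q (\<i> *s z) / mpoly_eval_c P (\<i> *s z)"
  shows "\<exists>m (g :: real^'d \<Rightarrow> real) C \<delta>. continuous_on UNIV g \<and> \<delta> > 0 \<and> (\<forall>y. \<bar>g y\<bar> \<le> C * exp (- \<delta> * l1norm y)) \<and>
    (\<forall>f x. test_function f \<longrightarrow> (LINT y|lborel. g y * pure_op m (diff_op_neg P f) (x - y)) = diff_op_neg Q f x)"
proof -
  obtain m r C where mrC: "4 dvd m \<and> 0 < r \<and> r \<le> 1 \<and> C \<ge> 0 \<and> (\<forall>z. norm (Im_vec z) < r \<longrightarrow>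
     z \<in> strip \<epsilon> \<and> pure_symbol m z \<noteq> 0 \<and> norm (F z / pure_symbol m z) \<le> C / japanese_prod (Re_vec z) ^ 2)"
  proof -
    have "\<exists>m r C. 4 dvd m \<and> 0 < r \<and> r \<le> 1 \<and> C \<ge> 0 \<and> (\<forall>z. norm (Im_vec z) < r \<longrightarrow>
       z \<in> strip \<epsilon> \<and> pure_symbol m z \<noteq> 0 \<and> norm (F z / pure_symbol m z) \<le> C / japanese_prod (Re_vec z) ^ 2)"
      by (rule symbol_decay[OF P Q \<epsilon> F]) (rule FPQ)
    then show ?thesis by (elim exE) (rule that)
  qed
  have FP: "F (complexify \<xi>) * mpoly_eval_c P (\<i> *s complexify \<xi>) = mpoly_eval_c Q (\<i> *s complexify \<xi>)" for \<xi>
    by (rule symbol_mult_eq[OF P Q \<epsilon> F]) (rule FPQ)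
  from mrC have m: "4 dvd m" and r: "0 < r" "r \<le> 1" and C: "C \<ge> 0" by simp_all
  have H: "z \<in> strip \<epsilon>" "pure_symbol m z \<noteq> 0" "norm (F z / pure_symbol m z) \<le> C / japanese_prod (Re_vec z) ^ 2"
    if "norm (Im_vec z) < r" for z
    using mrC that by blast+
  \<comment> \<open>Vectors with entries at most \<open>\<delta>\<close> have norm at most
    \<open>r / 4\<close>, and for \<open>\<bar>Im w\<bar> \<le> 2\<close> the shift stays within
    \<open>r / 2\<close>.\<close>
  define \<delta> where "\<delta> = r / (4 * CARD('d))"
  have \<delta>: "\<delta> > 0" using r by (simp add: \<delta>_def)
  have \<delta>le: "2 * \<delta> \<le> 1"
  proof -
    have "1 \<le> real CARD('d)" by (simp add: Suc_le_eq)
    then have "r \<le> real CARD('d) * 2" using r by linarith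
    then show ?thesis by (simp add: \<delta>_def field_simps)
  qed
  define G where "G z = F z / pure_symbol m z" for z
  define k where "k y z = G z * exp (- \<i> * cdot z y)" for y z
  have inr: "norm (Im_vec (complexify \<xi> + w *s complexify \<eta>)) < r"
    if "w \<in> ball 0 2" and \<eta>: "\<And>i. \<bar>\<eta> $ i\<bar> \<le> \<delta>" for \<xi> \<eta> :: "real^'d" and w
  proof -
    have "norm \<eta> \<le> (\<Sum>i\<in>UNIV. \<bar>\<eta> $ i\<bar>)" by (rule norm_le_l1_cart)
    also have "\<dots> \<le> (\<Sum>i\<in>(UNIV::'d set). \<delta>)" by (intro sum_mono \<eta>)
    also have "\<dots> = r / 4" by (simp add: \<delta>_def)
    finally have "norm \<eta> \<le> r / 4" .
    moreover have "\<bar>Im w\<bar> \<le> 2" using that(1) abs_Im_le_cmod[of w] by simp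
    ultimately have "\<bar>Im w\<bar> * norm \<eta> \<le> 2 * (r / 4)" by (intro mult_mono) auto
    then show ?thesis using norm_Im_vec_line[of "complexify \<xi>" w \<eta>] r by (simp add: Im_vec_complexify)
  qed
  \<comment> \<open>The real part moves by at most \<open>2 * \<delta> \<le> 1\<close> in each
    coordinate, which changes \<open>japanese_prod\<close> by a bounded factor. So one function of
    \<open>\<xi>\<close> dominates for all \<open>w\<close> and \<open>\<eta>\<close>.\<close>
  have Gbound: "norm (G (complexify \<xi> + w *s complexify \<eta>)) \<le> C * (2 ^ CARD('d)) ^ 2 * (1 / japanese_prod \<xi> ^ 2)"
    if w: "w \<in> ball 0 2" and \<eta>: "\<And>i. \<bar>\<eta> $ i\<bar> \<le> \<delta>" for \<xi> \<eta> :: "real^'d" and w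
  proof -
    let ?x = "\<xi> + Re w *\<^sub>R \<eta>"
    have "japanese_prod (?x + (- Re w *\<^sub>R \<eta>)) \<le> 2 ^ CARD('d) * japanese_prod ?x"
    proof (rule japanese_prod_add_le)
      fix i
      have "\<bar>Re w\<bar> * \<bar>\<eta> $ i\<bar> \<le> 2 * \<delta>" using w abs_Re_le_cmod[of w] \<eta>[of i] by (intro mult_mono) auto
      then show "\<bar>(- Re w *\<^sub>R \<eta>) $ i\<bar> \<le> 1" using \<delta>le by (simp add: abs_mult)
    qed
    then have "japanese_prod \<xi> \<le> 2 ^ CARD('d) * japanese_prod ?x" by simp
    then have sq: "japanese_prod \<xi> ^ 2 \<le> (2 ^ CARD('d)) ^ 2 * japanese_prod ?x ^ 2"
      unfolding power_mult_distrib[symmetric] using japanese_prod_ge(1)[of \<xi>] by (intro power_mono) auto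
    have pos: "japanese_prod \<xi> ^ 2 > 0" "japanese_prod ?x ^ 2 > 0"
      using japanese_prod_ge(1)[of \<xi>] japanese_prod_ge(1)[of ?x] by auto
    have "norm (G (complexify \<xi> + w *s complexify \<eta>)) \<le> C / japanese_prod ?x ^ 2"
      unfolding G_def using H(3)[OF inr[OF w \<eta>], of \<xi>] unfolding Re_vec_line Re_vec_complexify .
    also have "1 / japanese_prod ?x ^ 2 \<le> (2 ^ CARD('d)) ^ 2 * (1 / japanese_prod \<xi> ^ 2)"
      using sq pos by (simp add: field_simps)
    from mult_left_mono[OF this C] have "C / japanese_prod ?x ^ 2 \<le> C * ((2 ^ CARD('d)) ^ 2 * (1 / japanese_prod \<xi> ^ 2))"
      by simp
    finally show ?thesis by (simp add: mult.assoc)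
  qed
  have Gcont: "continuous_on {z. norm (Im_vec z) < r} G" unfolding G_def
  proof (rule continuous_on_divide)
    show "continuous_on {z. norm (Im_vec z) < r} F"
      by (rule continuous_on_subset[OF holomorphic_several_continuous[OF F]]) (use H in auto)
    show "continuous_on {z. norm (Im_vec z) < r} (pure_symbol m)" unfolding pure_symbol_def[abs_def]
      by (intro continuous_intros)
  qed (use H in auto)
  have Gcont': "continuous_on UNIV (\<lambda>\<xi>. G (complexify \<xi> + w *s complexify \<eta>))"
    if w: "w \<in> ball 0 2" and \<eta>: "\<And>i. \<bar>\<eta> $ i\<bar> \<le> \<delta>" for \<eta> :: "real^'d" and w
    by (rule continuous_on_compose2[OF Gcont continuous_on_complexify]) (use inr[OF w \<eta>] in auto)
  have Ghol: "(\<lambda>w. G (complexify \<xi> + w *s complexify \<eta>)) holomorphic_on ball 0 2"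
    if \<eta>: "\<And>i. \<bar>\<eta> $ i\<bar> \<le> \<delta>" for \<xi> \<eta> :: "real^'d"
    unfolding G_def
  proof (rule holomorphic_on_divide)
    show "(\<lambda>w. F (complexify \<xi> + w *s complexify \<eta>)) holomorphic_on ball 0 2"
      by (rule holomorphic_several_line[OF F open_ball]) (use inr[OF _ \<eta>] H in auto)
    show "(\<lambda>w. pure_symbol m (complexify \<xi> + w *s complexify \<eta>)) holomorphic_on ball 0 2"
      unfolding pure_symbol_def by (auto intro!: holomorphic_intros)
  qed (use inr[OF _ \<eta>] H in auto)
  define D where "D \<xi> = C * (2 ^ CARD('d)) ^ 2 * (1 / japanese_prod \<xi> ^ 2)" for \<xi> :: "real^'d"
  have Dint: "integrable lborel D" unfolding D_def by (intro integrable_mult_right japanese_prod_integrable)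
  have D0: "D \<xi> \<ge> 0" for \<xi> unfolding D_def using C by simp
  have expn: "norm (exp (- \<i> * cdot (complexify \<xi> + w *s complexify \<eta>) y)) = exp (Im w * (\<eta> \<bullet> y))" for \<xi> \<eta> y :: "real^'d" and w
    unfolding norm_exp_eq_Re cdot_line cdot_complexify by simp
  define gc where "gc y = (LINT \<xi>|lborel. k y (complexify \<xi>))" for y
  have k0: "k y (complexify \<xi>) = cis (- (\<xi> \<bullet> y)) * G (complexify \<xi>)" for \<xi> y
    unfolding k_def cdot_complexify by (simp add: cis_conv_exp)
  have G0: "norm (G (complexify \<xi>)) \<le> D \<xi>" for \<xi>
    using Gbound[of 0 0 \<xi>] \<delta> by (simp add: D_def)
  have Gm[measurable]: "(\<lambda>\<xi>. G (complexify \<xi>)) \<in> borel_measurable borel"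
    using Gcont'[of 0 0] \<delta> by (intro borel_measurable_continuous_onI) simp
  have gbound: "norm (gc y) \<le> (LINT \<xi>|lborel. D \<xi>) * exp (- \<delta> * l1norm y)" for y
  proof -
    \<comment> \<open>Each \<open>y\<close> gets its own shift, against the sign of every
      coordinate; at \<open>w = \<i>\<close> the exponential then has modulus
      \<open>exp (- \<delta> * l1norm y)\<close>, while the dominating \<open>D\<close> is the same
      for all \<open>y\<close>.\<close>
    define \<eta> :: "real^'d" where "\<eta> = (\<chi> i. - \<delta> * sgn (y $ i))"
    have \<eta>: "\<bar>\<eta> $ i\<bar> \<le> \<delta>" for i using \<delta> by (simp add: \<eta>_def abs_mult sgn_if)
    have ey: "\<eta> \<bullet> y = - \<delta> * l1norm y"
      by (simp add: \<eta>_def l1norm_def inner_vec_def sum_distrib_left sum_negf abs_sgn mult_ac)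
    have kb: "norm (k y (complexify \<xi> + w *s complexify \<eta>)) \<le> D \<xi> * exp (Im w * (\<eta> \<bullet> y))" if "w \<in> ball 0 2" for \<xi> w
      unfolding k_def norm_mult expn D_def by (intro mult_right_mono Gbound that \<eta>) simp
    have "gc y = (LINT \<xi>|lborel. k y (complexify \<xi> + \<i> *s complexify \<eta>))"
      unfolding gc_def
    proof (rule contour_shift[symmetric])
      show "(\<lambda>w. k y (complexify \<xi> + w *s complexify \<eta>)) holomorphic_on ball 0 2" for \<xi>
        unfolding k_def cdot_line by (intro holomorphic_intros Ghol \<eta>)
      show "(\<lambda>\<xi>. k y (complexify \<xi> + w *s complexify \<eta>)) \<in> borel_measurable borel" if "w \<in> ball 0 2" for w
        unfolding k_def cdot_line cdot_complexify
        by (intro borel_measurable_continuous_onI continuous_intros Gcont' that \<eta>)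
      show "norm (k y (complexify \<xi> + w *s complexify \<eta>)) \<le> D \<xi> * exp (2 * \<bar>\<eta> \<bullet> y\<bar>)" if "w \<in> ball 0 2" for \<xi> w
      proof -
        have "\<bar>Im w\<bar> \<le> 2" using that abs_Im_le_cmod[of w] by simp
        then have "\<bar>Im w * (\<eta> \<bullet> y)\<bar> \<le> 2 * \<bar>\<eta> \<bullet> y\<bar>" unfolding abs_mult by (rule mult_right_mono) simp
        then have "Im w * (\<eta> \<bullet> y) \<le> 2 * \<bar>\<eta> \<bullet> y\<bar>" by linarith
        then show ?thesis by (intro order_trans[OF kb[OF that, of \<xi>]] mult_left_mono D0) simp
      qed
      show "integrable lborel (\<lambda>\<xi>. D \<xi> * exp (2 * \<bar>\<eta> \<bullet> y\<bar>))" by (intro integrable_mult_left Dint)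
    qed
    also have "norm \<dots> \<le> (LINT \<xi>|lborel. D \<xi> * exp (Im \<i> * (\<eta> \<bullet> y)))"
      by (rule norm_integral_le) (use kb[of \<i>] Dint in auto)
    finally show ?thesis by (simp add: ey)
  qed
  have gcont: "continuous_on UNIV gc"
    unfolding continuous_on_sequentially comp_def gc_def
  proof (intro allI ballI impI, elim conjE)
    fix X and y :: "real^'d" assume X: "X \<longlonglongrightarrow> y"
    show "(\<lambda>n. LINT \<xi>|lborel. k (X n) (complexify \<xi>)) \<longlonglongrightarrow> (LINT \<xi>|lborel. k y (complexify \<xi>))"
      unfolding k0
    proof (rule integral_dominated_convergence[where w=D])
      show "AE \<xi> in lborel. (\<lambda>n. cis (- (\<xi> \<bullet> X n)) * G (complexify \<xi>)) \<longlonglongrightarrow> cis (- (\<xi> \<bullet> y)) * G (complexify \<xi>)"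
        unfolding cis_conv_exp by (intro AE_I2 tendsto_intros X)
      show "AE \<xi> in lborel. norm (cis (- (\<xi> \<bullet> X n)) * G (complexify \<xi>)) \<le> D \<xi>" for n
        using G0 by (simp add: norm_mult)
    qed (auto simp: Dint)
  qed
  define N where "N = (2 * pi) ^ CARD('d)"
  have N: "N > 0" by (simp add: N_def)
  define g where "g y = Re (gc y) / N" for y
  have rep: "(LINT y|lborel. gc y * complex_of_real (pure_op m (diff_op_neg P f) (x - y))) = complex_of_real (N * diff_op_neg Q f x)"
    if f: "test_function f" for f x
  proof -
    have Pf: "test_function (diff_op_neg P f)" and Qf: "test_function (diff_op_neg Q f)"
      using test_function_diff_op_neg P Q f by auto
    define \<phi> where "\<phi> = pure_op m (diff_op_neg P f)"
    have \<phi>: "test_function \<phi>" unfolding \<phi>_def by (rule test_function_pure_op[OF Pf])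
    have \<phi>m[measurable]: "\<phi> \<in> borel_measurable borel" by (rule test_function_measurable[OF \<phi>])
    have \<phi>i: "integrable lborel (\<lambda>y. \<phi> (x - y))"
    proof -
      obtain a b where ab: "{x. \<phi> x \<noteq> 0} \<subseteq> cbox a b" using test_function_cbox[OF \<phi>] .
      then have "{y. \<phi> (x - y) \<noteq> 0} \<subseteq> cbox (x - b) (x - a)"
        unfolding subset_eq mem_box by (fastforce simp: inner_diff_left algebra_simps)
      then show ?thesis
        by (rule compact_support_integrable[rotated])
          (intro continuous_on_compose2[OF smooth_fun_continuous[OF test_function_smooth[OF \<phi>], of UNIV]] continuous_intros, auto)
    qed
    let ?K = "\<lambda>y \<xi>. k y (complexify \<xi>) * complex_of_real (\<phi> (x - y))"
    have int: "integrable (lborel \<Otimes>\<^sub>M lborel) (\<lambda>(y, \<xi>). ?K y \<xi>)"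
    proof (rule lborel_pair.Fubini_integrable)
      show "(\<lambda>(y, \<xi>). ?K y \<xi>) \<in> borel_measurable (lborel \<Otimes>\<^sub>M lborel)" unfolding k0 by measurable
      have n: "norm (?K y \<xi>) = \<bar>\<phi> (x - y)\<bar> * norm (G (complexify \<xi>))" for y \<xi> by (simp add: norm_mult k0)
      show "integrable lborel (\<lambda>y. LINT \<xi>|lborel. norm (case (y, \<xi>) of (y, \<xi>) \<Rightarrow> ?K y \<xi>))"
        unfolding split n using \<phi>i by simp
      have Gi: "integrable lborel (\<lambda>\<xi>. G (complexify \<xi>))"
        by (rule Bochner_Integration.integrable_bound[OF Dint]) (use G0 D0 in auto)
      show "AE y in lborel. integrable lborel (\<lambda>\<xi>. case (y, \<xi>) of (y, \<xi>) \<Rightarrow> ?K y \<xi>)"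
        unfolding split
      proof (intro AE_I2 integrable_mult_left)
        fix y
        show "integrable lborel (\<lambda>\<xi>. k y (complexify \<xi>))" unfolding k0
          by (rule Bochner_Integration.integrable_bound[OF Gi]) (auto simp: norm_mult)
      qed
    qed
    have "(LINT y|lborel. gc y * complex_of_real (\<phi> (x - y))) = (LINT y|lborel. LINT \<xi>|lborel. ?K y \<xi>)"
      unfolding gc_def by (simp only: integral_mult_left_zero)
    also have "\<dots> = (LINT \<xi>|lborel. LINT y|lborel. ?K y \<xi>)"
      by (rule lborel_pair.Fubini_integral[OF int, symmetric])
    also have "\<dots> = (LINT \<xi>|lborel. fourier (diff_op_neg Q f) \<xi> * cis (- (\<xi> \<bullet> x)))"
    proof (rule Bochner_Integration.integral_cong[OF refl])
      fix \<xi> :: "real^'d"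
      let ?c = "cis (- (\<xi> \<bullet> x)) * G (complexify \<xi>)"
      have "?K y \<xi> = ?c * (cis (\<xi> \<bullet> (x - y)) * complex_of_real (\<phi> (x - y)))" for y
      proof -
        \<comment> \<open>Splitting the phase at \<open>x\<close> turns the integral over
          \<open>y\<close> into a Fourier transform of \<open>\<phi>\<close> after
          reflection.\<close>
        have "cis (- (\<xi> \<bullet> y)) = cis (- (\<xi> \<bullet> x)) * cis (\<xi> \<bullet> (x - y))" by (simp add: cis_mult inner_diff_right)
        then show ?thesis unfolding k0 by simp
      qed
      then have "(LINT y|lborel. ?K y \<xi>) = ?c * (LINT y|lborel. cis (\<xi> \<bullet> (x - y)) * complex_of_real (\<phi> (x - y)))"
        by (simp only: integral_mult_right_zero)
      also have "(LINT y|lborel. cis (\<xi> \<bullet> (x - y)) * complex_of_real (\<phi> (x - y))) = fourier \<phi> \<xi>"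
        unfolding fourier_def by (rule lborel_integral_reflect[where g="\<lambda>u. cis (\<xi> \<bullet> u) * complex_of_real (\<phi> u)"]) measurable
      also have "fourier \<phi> \<xi> = pure_symbol m (complexify \<xi>) * (mpoly_eval_c P (\<i> *s complexify \<xi>) * fourier f \<xi>)"
        unfolding \<phi>_def fourier_pure_op[OF Pf m] fourier_diff_op_neg[OF P(1) f] imag_vec_complexify
        by (simp add: pure_symbol_def complexify_def)
      \<comment> \<open>The factor \<open>pure_symbol m\<close> cancels the denominator of
        \<open>G\<close>; what remains is the product of \<open>F\<close> and p, which equals q at
        every real frequency.\<close>
      also have "?c * \<dots> = cis (- (\<xi> \<bullet> x)) * ((F (complexify \<xi>) * mpoly_eval_c P (\<i> *s complexify \<xi>)) * fourier f \<xi>)"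
        using H(2)[of "complexify \<xi>"] r unfolding G_def by (simp add: Im_vec_complexify)
      also have "\<dots> = cis (- (\<xi> \<bullet> x)) * fourier (diff_op_neg Q f) \<xi>"
        unfolding FP fourier_diff_op_neg[OF Q f] imag_vec_complexify ..
      finally show "(LINT y|lborel. ?K y \<xi>) = fourier (diff_op_neg Q f) \<xi> * cis (- (\<xi> \<bullet> x))" by (simp only: mult.commute)
    qed
    also have "\<dots> = complex_of_real (N * diff_op_neg Q f x)"
    proof -
      obtain B where B: "\<And>x. \<bar>diff_op_neg Q f x\<bar> \<le> B" using test_function_bounded[OF Qf] by blast
      show ?thesis
        using fourier_inversion[OF test_function_integrable[OF Qf] smooth_fun_continuous[OF test_function_smooth[OF Qf]] B fourier_integrable[OF Qf], of x]
        by (simp add: N_def)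
    qed
    finally show ?thesis unfolding \<phi>_def .
  qed
  show ?thesis
  proof (intro exI conjI allI impI)
    show "continuous_on UNIV g" unfolding g_def using N by (intro continuous_intros gcont) auto
    show "\<delta> > 0" by (rule \<delta>)
    show "\<bar>g y\<bar> \<le> ((LINT \<xi>|lborel. D \<xi>) / N) * exp (- \<delta> * l1norm y)" for y
    proof -
      have "\<bar>g y\<bar> \<le> norm (gc y) / N" unfolding g_def using N abs_Re_le_cmod[of "gc y"] by (simp add: divide_right_mono)
      also have "\<dots> \<le> (LINT \<xi>|lborel. D \<xi>) * exp (- \<delta> * l1norm y) / N" using gbound[of y] N by (simp add: divide_right_mono)
      finally show ?thesis by simp
    qed
    fix f x assume f: "test_function (f :: real^'d \<Rightarrow> real)"
    let ?h0 = "\<lambda>y. pure_op m (diff_op_neg P f) (x - y)"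
    have "diff_op_neg Q f x = Re (LINT y|lborel. gc y * complex_of_real (?h0 y)) / N"
      unfolding rep[OF f] using N by simp
    \<comment> \<open>The real part passes under the integral because the integrand is integrable:
      \<open>gc\<close> decays exponentially and the test function is bounded.\<close>
    also have "Re (LINT y|lborel. gc y * complex_of_real (?h0 y)) = (LINT y|lborel. Re (gc y * complex_of_real (?h0 y)))"
    proof (cases "integrable lborel (\<lambda>y. gc y * complex_of_real (?h0 y))")
      case True then show ?thesis by (rule integral_Re[symmetric])
    next
      case False
      have [measurable]: "gc \<in> borel_measurable borel" by (rule borel_measurable_continuous_onI[OF gcont])
      have \<phi>': "test_function (pure_op m (diff_op_neg P f))" using test_function_pure_op test_function_diff_op_neg P f by blast
      have [measurable]: "pure_op m (diff_op_neg P f) \<in> borel_measurable borel" by (rule test_function_measurable[OF \<phi>'])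
      obtain B where B: "\<And>x. \<bar>pure_op m (diff_op_neg P f) x\<bar> \<le> B" using test_function_bounded[OF \<phi>'] by blast
      let ?E = "LINT \<xi>|lborel. D \<xi>"
      have "integrable lborel (\<lambda>y. gc y * complex_of_real (?h0 y))"
      proof (rule Bochner_Integration.integrable_bound)
        show "integrable lborel (\<lambda>y::real^'d. (?E * B) * exp (- \<delta> * l1norm y))"
          by (intro integrable_mult_right integrable_exp_l1norm \<delta>)
        have "norm (gc y * complex_of_real (?h0 y)) \<le> (?E * exp (- \<delta> * l1norm y)) * B" for y
          unfolding norm_mult norm_of_real by (intro mult_mono gbound B order_trans[OF norm_ge_zero gbound]) auto
        then show "AE y in lborel. norm (gc y * complex_of_real (?h0 y)) \<le> norm ((?E * B) * exp (- \<delta> * l1norm y))"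
          by (intro AE_I2) (simp add: mult_ac order_trans[OF _ abs_ge_self])
      qed measurable
      with False show ?thesis by blast
    qed
    finally have *: "diff_op_neg Q f x = (LINT y|lborel. Re (gc y * complex_of_real (?h0 y))) / N" .
    have "g y * ?h0 y = Re (gc y * complex_of_real (?h0 y)) / N" for y by (simp add: g_def)
    then show "(LINT y|lborel. g y * ?h0 y) = diff_op_neg Q f x"
      unfolding * by (simp only: integral_divide_zero)
  qed
qed

section \<open>Convolution with the kernel\<close>

text \<open>Puts a target test function under an envelope of the same shape as that of the truncated
  convolutions; the weight is bounded on the compact support.\<close>

lemma test_function_decay:
  fixes f :: "real^'d::finite \<Rightarrow> real"
  assumes f: "test_function f"
  shows "\<exists>B. \<forall>x. \<bar>f x\<bar> \<le> B * exp (- \<delta> * l1norm x)"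
proof -
  let ?K = "closure {x. f x \<noteq> 0}" and ?w = "\<lambda>x. exp (\<delta> * l1norm x) * f x"
  have "compact (?w ` ?K)"
    using f smooth_fun_continuous[OF test_function_smooth[OF f]]
    by (intro compact_continuous_image continuous_intros) (auto simp: test_function_def)
  then obtain B where B: "\<And>x. x \<in> ?K \<Longrightarrow> \<bar>?w x\<bar> \<le> B" using compact_imp_bounded by (force simp: bounded_iff)
  have "\<bar>f x\<bar> \<le> max B 0 * exp (- \<delta> * l1norm x)" for x
  proof (cases "f x = 0")
    case False
    then have "x \<in> {x. f x \<noteq> 0}" by simp
    then have "x \<in> ?K" by (rule subsetD[OF closure_subset])
    then have "exp (\<delta> * l1norm x) * \<bar>f x\<bar> \<le> max B 0" using B[of x] by (simp add: abs_mult)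
    then show ?thesis by (simp add: exp_minus divide_inverse[symmetric] pos_le_divide_eq mult.commute)
  qed simp
  then show ?thesis by blast
qed

lemma pure_op_support:
  assumes "closed K" "{x. f x \<noteq> 0} \<subseteq> K"
  shows "{x. pure_op m f x \<noteq> 0} \<subseteq> K"
proof -
  have it: "{x. iter_partial js f x \<noteq> 0} \<subseteq> K" for js
  proof (induction js)
    case (Cons i js)
    have "closure {x. iter_partial js f x \<noteq> 0} \<subseteq> K" using Cons assms(1) by (rule closure_minimal)
    then show ?case using partial_support[of i "iter_partial js f"] by simp
  qed (simp add: assms)
  show ?thesis
  proof
    fix x assume "x \<in> {x. pure_op m f x \<noteq> 0}"
    then have "f x \<noteq> 0 \<or> (\<exists>i. iter_partial (replicate m i) f x \<noteq> 0)"
      unfolding pure_op_def by (auto intro: ccontr)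
    then show "x \<in> K" using it[of "replicate m i" for i] assms(2) by blast
  qed
qed

context
  fixes g :: "real^'d::finite \<Rightarrow> real" and C \<delta> :: real
  assumes gc: "continuous_on UNIV g" and \<delta>: "\<delta> > 0" and gb: "\<And>y. \<bar>g y\<bar> \<le> C * exp (- \<delta> * l1norm y)"
begin

lemma kernel_constant_nonneg: "C \<ge> 0"
  using gb[of 0] abs_ge_zero[of "g 0"] by (simp add: l1norm_def)

text \<open>A weighted \<open>L1\<close> norm, the factor through which \<open>f\<close> enters the
  envelope of its convolution with \<open>g\<close>.\<close>

definition exp_weight :: "(real^'d \<Rightarrow> real) \<Rightarrow> real" where
  "exp_weight f = (LINT u|lborel. exp (\<delta> * l1norm u) * \<bar>f u\<bar>)"

text \<open>The triangle inequality moves the decay from \<open>y\<close> to \<open>x\<close>, at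
  the price of a growing weight on \<open>f (x - y)\<close>, which compact support makes
  harmless.\<close>

lemma kernel_times_bound: "\<bar>g y * f (x - y)\<bar> \<le> C * exp (- \<delta> * l1norm x) * (exp (\<delta> * l1norm (x - y)) * \<bar>f (x - y)\<bar>)"
proof -
  have "l1norm x \<le> l1norm y + l1norm (x - y)" using l1norm_triangle[of y "x - y"] by simp
  then have "\<delta> * l1norm x \<le> \<delta> * (l1norm y + l1norm (x - y))" using \<delta> by (intro mult_left_mono) auto
  then have "- \<delta> * l1norm y \<le> - \<delta> * l1norm x + \<delta> * l1norm (x - y)" by (simp add: algebra_simps)
  then have "exp (- \<delta> * l1norm y) \<le> exp (- \<delta> * l1norm x) * exp (\<delta> * l1norm (x - y))"
    by (simp add: exp_add[symmetric])
  then have "C * exp (- \<delta> * l1norm y) \<le> C * (exp (- \<delta> * l1norm x) * exp (\<delta> * l1norm (x - y)))"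
    by (rule mult_left_mono) (rule kernel_constant_nonneg)
  then have "\<bar>g y\<bar> \<le> C * (exp (- \<delta> * l1norm x) * exp (\<delta> * l1norm (x - y)))" using gb[of y] by linarith
  then have "\<bar>g y\<bar> * \<bar>f (x - y)\<bar> \<le> C * (exp (- \<delta> * l1norm x) * exp (\<delta> * l1norm (x - y))) * \<bar>f (x - y)\<bar>"
    by (rule mult_right_mono) simp
  then show ?thesis by (simp add: abs_mult mult.assoc)
qed

lemma integrable_weight_reflect:
  assumes f: "test_function f"
  shows "integrable lborel (\<lambda>y. exp (\<delta> * l1norm (x - y)) * \<bar>f (x - y)\<bar>)"
proof -
  have "smooth_fun f" by (rule test_function_smooth[OF f])
  obtain a b where ab: "{x. f x \<noteq> 0} \<subseteq> cbox a b" using test_function_cbox[OF f] .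
  have "{y. exp (\<delta> * l1norm (x - y)) * \<bar>f (x - y)\<bar> \<noteq> 0} \<subseteq> cbox (x - b) (x - a)"
  proof
    fix y assume "y \<in> {y. exp (\<delta> * l1norm (x - y)) * \<bar>f (x - y)\<bar> \<noteq> 0}"
    then have "x - y \<in> cbox a b" using ab by auto
    then show "y \<in> cbox (x - b) (x - a)" unfolding mem_box by (fastforce simp: inner_diff_left)
  qed
  then show ?thesis
    by (rule compact_support_integrable[rotated])
      (intro continuous_intros continuous_on_compose2[OF smooth_fun_continuous[OF \<open>smooth_fun f\<close>, of UNIV]], auto)
qed

text \<open>Passes from the gauge integral, used for differentiation, to the Lebesgue integral, used
  for estimates and limits.\<close>

lemma box_conv_lebesgue:
  assumes f: "test_function f"
  shows "box_conv c g f x = (LINT y|lborel. indicator (cbox (\<chi> i. - c) (\<chi> i. c)) y *\<^sub>R (g y * f (x - y)))"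
proof -
  have "continuous_on (cbox (\<chi> i. - c) (\<chi> i. c)) (\<lambda>y. g y * f (x - y))"
    by (intro continuous_intros continuous_on_subset[OF gc] continuous_on_compose2[OF smooth_fun_continuous[OF test_function_smooth[OF f], of UNIV]]) auto
  then have "set_integrable lborel (cbox (\<chi> i. - c) (\<chi> i. c)) (\<lambda>y. g y * f (x - y))"
    unfolding set_integrable_def by (intro borel_integrable_compact) auto
  from set_borel_integral_eq_integral(2)[OF this] show ?thesis
    unfolding box_conv_def set_lebesgue_integral_def by simp
qed

text \<open>The right-hand side is free of \<open>c\<close>; this uniformity puts all truncations
  under a single envelope.\<close>

lemma box_conv_bound:
  assumes f: "test_function f"
  shows "\<bar>box_conv c g f x\<bar> \<le> C * exp_weight f * exp (- \<delta> * l1norm x)"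
proof -
  have [measurable]: "f \<in> borel_measurable borel" by (rule test_function_measurable[OF f])
  let ?w = "\<lambda>u. exp (\<delta> * l1norm u) * \<bar>f u\<bar>"
  have "norm (box_conv c g f x) \<le> (LINT y|lborel. C * exp (- \<delta> * l1norm x) * ?w (x - y))"
    unfolding box_conv_lebesgue[OF f]
  proof (rule norm_integral_le)
    show "integrable lborel (\<lambda>y. C * exp (- \<delta> * l1norm x) * ?w (x - y))"
      by (intro integrable_mult_right integrable_weight_reflect f)
    show "norm (indicator (cbox (\<chi> i. - c) (\<chi> i. c)) y *\<^sub>R (g y * f (x - y))) \<le> C * exp (- \<delta> * l1norm x) * ?w (x - y)" for y
      using kernel_times_bound[of y f x] order_trans[OF abs_ge_zero kernel_times_bound[of y f x]]
      by (cases "y \<in> cbox (\<chi> i. - c) (\<chi> i. c)") simp_all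
  qed
  also have "\<dots> = C * exp (- \<delta> * l1norm x) * (LINT y|lborel. ?w (x - y))" by (rule integral_mult_right_zero)
  also have "(LINT y|lborel. ?w (x - y)) = exp_weight f"
    unfolding exp_weight_def by (rule lborel_integral_reflect[where g="?w"]) measurable
  finally show ?thesis by (simp add: mult_ac)
qed

lemma box_conv_tendsto:
  assumes f: "test_function f"
  shows "(\<lambda>n. box_conv (real n) g f x) \<longlonglongrightarrow> (LINT y|lborel. g y * f (x - y))"
  unfolding box_conv_lebesgue[OF f]
proof (rule integral_dominated_convergence[where w="\<lambda>y. C * exp (- \<delta> * l1norm x) * (exp (\<delta> * l1norm (x - y)) * \<bar>f (x - y)\<bar>)"])
  have [measurable]: "f \<in> borel_measurable borel" by (rule test_function_measurable[OF f])
  have [measurable]: "g \<in> borel_measurable borel" by (rule borel_measurable_continuous_onI[OF gc])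
  show "(\<lambda>y. g y * f (x - y)) \<in> borel_measurable lborel" by measurable
  show "(\<lambda>y. indicator (cbox (\<chi> i. - real n) (\<chi> i. real n)) y *\<^sub>R (g y * f (x - y))) \<in> borel_measurable lborel" for n by measurable
  show "integrable lborel (\<lambda>y. C * exp (- \<delta> * l1norm x) * (exp (\<delta> * l1norm (x - y)) * \<bar>f (x - y)\<bar>))"
    by (intro integrable_mult_right integrable_weight_reflect f)
  show "AE y in lborel. norm (indicator (cbox (\<chi> i. - real n) (\<chi> i. real n)) y *\<^sub>R (g y * f (x - y)))
      \<le> C * exp (- \<delta> * l1norm x) * (exp (\<delta> * l1norm (x - y)) * \<bar>f (x - y)\<bar>)" for n
  proof (rule AE_I2)
    fix y
    show "norm (indicator (cbox (\<chi> i. - real n) (\<chi> i. real n)) y *\<^sub>R (g y * f (x - y)))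
      \<le> C * exp (- \<delta> * l1norm x) * (exp (\<delta> * l1norm (x - y)) * \<bar>f (x - y)\<bar>)"
      using kernel_times_bound[of y f x] order_trans[OF abs_ge_zero kernel_times_bound[of y f x]]
      by (cases "y \<in> cbox (\<chi> i. - real n) (\<chi> i. real n)") simp_all
  qed
  show "AE y in lborel. (\<lambda>n. indicator (cbox (\<chi> i. - real n) (\<chi> i. real n)) y *\<^sub>R (g y * f (x - y))) \<longlonglongrightarrow> g y * f (x - y)"
  proof (rule AE_I2)
    fix y :: "real^'d"
    obtain N :: nat where N: "l1norm y \<le> real N" using real_arch_simple by blast
    have "y \<in> cbox (\<chi> i. - real n) (\<chi> i. real n)" if "n \<ge> N" for n
    proof -
      have "\<bar>y $ i\<bar> \<le> real n" for i using component_le_l1norm[of y i] N that by linarith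
      then show ?thesis unfolding mem_box_cart by (simp add: abs_le_iff) (metis minus_le_iff)
    qed
    then have "\<forall>\<^sub>F n in sequentially. indicator (cbox (\<chi> i. - real n) (\<chi> i. real n)) y *\<^sub>R (g y * f (x - y)) = g y * f (x - y)"
      unfolding eventually_sequentially by (intro exI[of _ N]) simp
    then show "(\<lambda>n. indicator (cbox (\<chi> i. - real n) (\<chi> i. real n)) y *\<^sub>R (g y * f (x - y))) \<longlonglongrightarrow> g y * f (x - y)"
      by (rule tendsto_eventually)
  qed
qed

text \<open>On a common compact set the exponential weight is integrable, so uniform convergence
  suffices.\<close>

lemma exp_weight_tendsto:
  assumes tf: "\<And>k. test_function (f k)" and K: "compact K" "\<And>k. {x. f k x \<noteq> 0} \<subseteq> K"
    and u: "uniform_limit UNIV f (\<lambda>_. 0) sequentially"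
  shows "(\<lambda>k. exp_weight (f k)) \<longlonglongrightarrow> 0"
proof -
  define V where "V = (LINT u|lborel. indicator K u * exp (\<delta> * l1norm u))"
  have Vi: "integrable lborel (\<lambda>u. indicator K u * exp (\<delta> * l1norm u))"
  proof -
    have "continuous_on K (\<lambda>u. exp (\<delta> * l1norm u))" by (intro continuous_intros)
    from borel_integrable_compact[OF K(1) this] show ?thesis by simp
  qed
  have V: "V \<ge> 0" unfolding V_def by (intro Bochner_Integration.integral_nonneg) simp
  have nn: "exp_weight (f k) \<ge> 0" for k unfolding exp_weight_def by (intro Bochner_Integration.integral_nonneg) simp
  show ?thesis
  proof (rule LIMSEQ_I)
    fix e :: real assume e: "e > 0"
    define e' where "e' = e / (1 + V)"
    have e': "e' > 0" using e V by (simp add: e'_def)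
    have "\<forall>e>0. \<exists>N. \<forall>k\<ge>N. \<forall>x. \<bar>f k x\<bar> < e"
      using u unfolding uniform_limit_iff eventually_sequentially by simp
    then obtain N where N: "\<And>k x. k \<ge> N \<Longrightarrow> \<bar>f k x\<bar> < e'" using e' by meson
    have "exp_weight (f k) < e" if k: "k \<ge> N" for k
    proof -
      have "exp_weight (f k) \<le> (LINT u|lborel. e' * (indicator K u * exp (\<delta> * l1norm u)))"
        unfolding exp_weight_def
      proof (rule integral_mono)
        show "integrable lborel (\<lambda>u. exp (\<delta> * l1norm u) * \<bar>f k u\<bar>)" by (rule test_function_weight_integrable[OF tf])
        show "integrable lborel (\<lambda>u. e' * (indicator K u * exp (\<delta> * l1norm u)))" by (intro integrable_mult_right Vi)
        show "exp (\<delta> * l1norm u) * \<bar>f k u\<bar> \<le> e' * (indicator K u * exp (\<delta> * l1norm u))" for u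
        proof (cases "f k u = 0")
          case False
          then have "u \<in> K" using K(2) by blast
          then show ?thesis using N[OF k, of u] by simp
        qed (use e' in simp)
      qed
      also have "\<dots> = e' * V" unfolding V_def by (rule integral_mult_right_zero)
      also have "\<dots> < e"
      proof -
        have "e * V < e * (1 + V)" using e by (intro mult_strict_left_mono) auto
        then show ?thesis using V by (simp add: e'_def pos_divide_less_eq)
      qed
      finally show ?thesis .
    qed
    then show "\<exists>no. \<forall>k\<ge>no. norm (exp_weight (f k) - 0) < e" using nn by (intro exI[of _ N]) auto
  qed
qed

end

section \<open>The CARMA process\<close>

lemma levy_white_noiseD:
  assumes "levy_white_noise M a \<gamma> \<nu> L"
  shows "a \<ge> 0" "levy_measure \<nu>"
    and "test_function f \<Longrightarrow> L f \<in> borel_measurable M"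
    and "test_function f \<Longrightarrow> test_function h \<Longrightarrow> AE w in M. L (\<lambda>x. b * f x + c * h x) w = b * L f w + c * L h w"
    and "test_function f \<Longrightarrow> (LINT w|M. cis (L f w)) = exp (LINT x|lborel. levy_exponent a \<gamma> \<nu> (f x))"
  using assms unfolding levy_white_noise_def gen_random_process_def by auto

lemma gen_random_process_sum:
  fixes k :: nat and f :: "nat \<Rightarrow> real^'d::finite \<Rightarrow> real"
  assumes lin: "\<And>f h b c. test_function f \<Longrightarrow> test_function h \<Longrightarrow> AE w in M. s (\<lambda>x. b * f x + c * h x) w = b * s f w + c * s h w"
    and f: "\<And>j. j < k \<Longrightarrow> test_function (f j)"
  shows "AE w in M. s (\<lambda>x. \<Sum>j<k. c j * f j x) w = (\<Sum>j<k. c j * s (f j) w)"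
  using f
proof (induction k)
  case 0
  \<comment> \<open>Zero coefficients show that the process vanishes almost surely at the zero
    function.\<close>
  show ?case using lin[OF test_function_zero test_function_zero, of 0 0] by simp
next
  case (Suc k)
  have t: "test_function (\<lambda>x. \<Sum>j<k. c j * f j x)"
    by (intro test_function_sum test_function_cmult Suc.prems) auto
  have "AE w in M. s (\<lambda>x. \<Sum>j<k. c j * f j x) w = (\<Sum>j<k. c j * s (f j) w)"
    by (rule Suc.IH) (use Suc.prems in auto)
  then show ?case using lin[OF t Suc.prems[of k], of 1 "c k"] by (auto elim!: eventually_elim2)
qed

lemma test_function_diff: "test_function f \<Longrightarrow> test_function h \<Longrightarrow> test_function (\<lambda>x. f x - h x)"
  using test_function_lincomb[of f h 1 "-1"] by simp

section \<open>Limits of the noise along truncated convolutions\<close>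

context
  fixes M :: "'w measure" and L :: "(real^'d::finite \<Rightarrow> real) \<Rightarrow> 'w \<Rightarrow> real" and a \<gamma> :: real and \<nu> :: "real measure"
    and g :: "real^'d \<Rightarrow> real" and C \<delta> :: real and m :: nat
  assumes M: "prob_space M" and L: "levy_white_noise M a \<gamma> \<nu> L"
    and lm: "(\<integral>\<^sup>+ r. ennreal (indicator {r. \<bar>r\<bar> > 1} r * (ln \<bar>r\<bar>) ^ CARD('d)) \<partial>\<nu>) < \<infinity>"
    and gc: "continuous_on UNIV g" and \<delta>: "\<delta> > 0" and gb: "\<And>y. \<bar>g y\<bar> \<le> C * exp (- \<delta> * l1norm y)"
begin

interpretation prob_space M by (rule M)

lemmas Lm = levy_white_noiseD(3)[OF L]
lemmas Llin = levy_white_noiseD(4)[OF L]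
lemmas Lchar = levy_white_noiseD(5)[OF L]

text \<open>Common source of the limits in probability below: the characteristic function of
  \<open>L (h n)\<close> at \<open>z\<close> is the exponential of an integrated Levy exponent,
  which tends to 0 under the envelope.\<close>

lemma noise_conv_zero:
  assumes h: "\<And>n. test_function (h n)" and bnd: "\<And>n x. \<bar>h n x\<bar> \<le> B * exp (- \<delta> * l1norm x)"
    and lim: "\<And>x. (\<lambda>n. h n x) \<longlonglongrightarrow> 0"
  shows "conv_in_prob M (\<lambda>n. L (h n)) (\<lambda>_. 0)"
proof (rule conv_in_prob_zero_of_char)
  show "L (h n) \<in> borel_measurable M" for n by (rule Lm[OF h])
  fix z :: real
  have "(LINT w|M. cis (z * L (h n) w)) = exp (LINT x|lborel. levy_exponent a \<gamma> \<nu> (z * h n x))" for n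
  proof -
    have "AE w in M. L (\<lambda>x. z * h n x) w = z * L (h n) w" using Llin[OF h[of n] h[of n], of z 0] by simp
    then have "(LINT w|M. cis (z * L (h n) w)) = (LINT w|M. cis (L (\<lambda>x. z * h n x) w))"
      using Lm[OF h, of n] Lm[OF test_function_cmult[OF h], of z n] by (intro integral_cong_AE) auto
    also have "\<dots> = exp (LINT x|lborel. levy_exponent a \<gamma> \<nu> (z * h n x))"
      by (rule Lchar[OF test_function_cmult[OF h]])
    finally show ?thesis .
  qed
  moreover have "(\<lambda>n. exp (LINT x|lborel. levy_exponent a \<gamma> \<nu> (z * h n x))) \<longlonglongrightarrow> exp 0"
  proof (intro tendsto_exp levy_exponent_integral_tendsto[OF levy_white_noiseD(2)[OF L] levy_white_noiseD(1)[OF L] lm \<delta>])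
    show "(\<lambda>x. z * h n x) \<in> borel_measurable borel" for n by (rule test_function_measurable[OF test_function_cmult[OF h]])
    show "\<bar>z * h n x\<bar> \<le> (\<bar>z\<bar> * B) * exp (- \<delta> * l1norm x)" for n x
      using mult_left_mono[OF bnd[of n x], of "\<bar>z\<bar>"] by (simp add: abs_mult)
    show "(\<lambda>n. z * h n x) \<longlonglongrightarrow> 0" for x using tendsto_mult_left[OF lim[of x], of z] by simp
  qed
  ultimately show "(\<lambda>n. LINT w|M. cis (z * L (h n) w)) \<longlonglongrightarrow> 1" by simp
qed

definition approx :: "nat \<Rightarrow> (real^'d \<Rightarrow> real) \<Rightarrow> real^'d \<Rightarrow> real" where
  "approx n f = box_conv (real n) g (pure_op m f)"

lemma approx_test: "test_function f \<Longrightarrow> test_function (approx n f)"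
  unfolding approx_def by (intro test_function_box_conv test_function_pure_op gc)

lemma approx_bound: "test_function f \<Longrightarrow> \<bar>approx n f x\<bar> \<le> C * exp_weight \<delta> (pure_op m f) * exp (- \<delta> * l1norm x)"
  unfolding approx_def by (rule box_conv_bound[OF gc \<delta> gb test_function_pure_op])

lemma approx_tendsto: "test_function f \<Longrightarrow> (\<lambda>n. approx n f x) \<longlonglongrightarrow> (LINT y|lborel. g y * pure_op m f (x - y))"
  unfolding approx_def by (rule box_conv_tendsto[OF gc \<delta> gb test_function_pure_op])

lemma approx_lincomb:
  assumes "test_function f" "test_function h"
  shows "approx n (\<lambda>x. b * f x + c * h x) = (\<lambda>x. b * approx n f x + c * approx n h x)"
  unfolding approx_def pure_op_lincomb[OF test_function_smooth[OF assms(1)] test_function_smooth[OF assms(2)]]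
  by (rule box_conv_lincomb[OF test_function_smooth[OF test_function_pure_op[OF assms(1)]] test_function_smooth[OF test_function_pure_op[OF assms(2)]] gc])

lemma approx_translate: "test_function f \<Longrightarrow> approx n (\<lambda>x. f (x - t)) = (\<lambda>x. approx n f (x - t))"
  unfolding approx_def by (simp add: pure_op_translate test_function_smooth box_conv_translate fun_eq_iff)

text \<open>A limit in probability is fixed only up to null sets, so a representative is chosen for
  each \<open>f\<close> and relations between representatives come from
  \<open>conv_in_prob_unique\<close>.\<close>

definition carma :: "(real^'d \<Rightarrow> real) \<Rightarrow> 'w \<Rightarrow> real" where
  "carma f = (SOME Y. Y \<in> borel_measurable M \<and> conv_in_prob M (\<lambda>n. L (approx n f)) Y)"

lemma prob_dist_noise_diff:
  assumes "test_function f" "test_function h"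
  shows "prob_dist M (L f) (L h) = prob_dist M (L (\<lambda>x. f x - h x)) (\<lambda>_. 0)"
proof (rule prob_dist_AE_cong)
  show "AE w in M. \<bar>L f w - L h w\<bar> = \<bar>L (\<lambda>x. f x - h x) w - 0\<bar>"
    using Llin[OF assms, of 1 "-1"] by auto
qed (auto intro: Lm assms test_function_diff)

text \<open>If the Cauchy property failed, index sequences \<open>i\<close> and \<open>j\<close>
  tending to infinity would keep a distance of at least \<open>e\<close>. Their differences form one
  sequence of test functions with a common envelope and pointwise limit 0, contradicting
  \<open>noise_conv_zero\<close>.\<close>

lemma carma_exists:
  assumes f: "test_function f"
  shows "\<exists>Y\<in>borel_measurable M. conv_in_prob M (\<lambda>n. L (approx n f)) Y"
proof (rule prob_Cauchy_convergent)
  show "L (approx n f) \<in> borel_measurable M" for n by (rule Lm[OF approx_test[OF f]])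
  fix e :: real assume e: "e > 0"
  show "\<exists>N. \<forall>i\<ge>N. \<forall>j\<ge>N. prob_dist M (L (approx i f)) (L (approx j f)) < e"
  proof (rule ccontr)
    assume "\<not> ?thesis"
    then have "\<forall>N. \<exists>i j. i \<ge> N \<and> j \<ge> N \<and> e \<le> prob_dist M (L (approx i f)) (L (approx j f))" by (meson not_less)
    then obtain i j where ij: "\<And>N. i N \<ge> N" "\<And>N. j N \<ge> N" "\<And>N. e \<le> prob_dist M (L (approx (i N) f)) (L (approx (j N) f))" by metis
    define h where "h N = (\<lambda>x. approx (i N) f x - approx (j N) f x)" for N :: nat
    have h: "test_function (h N)" for N unfolding h_def by (intro test_function_diff approx_test f)
    have "conv_in_prob M (\<lambda>N. L (h N)) (\<lambda>_. 0)"
    proof (rule noise_conv_zero[OF h])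
      show "\<bar>h N x\<bar> \<le> 2 * (C * exp_weight \<delta> (pure_op m f)) * exp (- \<delta> * l1norm x)" for N x
        unfolding h_def using approx_bound[OF f, of "i N" x] approx_bound[OF f, of "j N" x] by linarith
      have inf: "filterlim i sequentially sequentially" "filterlim j sequentially sequentially"
        using ij(1,2) by (auto intro: filterlim_at_top_mono[OF filterlim_ident])
      show "(\<lambda>N. h N x) \<longlonglongrightarrow> 0" for x
        unfolding h_def
        using tendsto_diff[OF filterlim_compose[OF approx_tendsto[OF f, of x] inf(1)] filterlim_compose[OF approx_tendsto[OF f, of x] inf(2)]]
        by simp
    qed
    then have "(\<lambda>N. prob_dist M (L (h N)) (\<lambda>_. 0)) \<longlonglongrightarrow> 0" by (subst (asm) conv_in_prob_iff) (auto intro: Lm h)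
    then have "\<forall>\<^sub>F N in sequentially. prob_dist M (L (h N)) (\<lambda>_. 0) < e" using e by (rule order_tendstoD)
    then obtain N where "prob_dist M (L (h N)) (\<lambda>_. 0) < e" by (auto simp: eventually_sequentially)
    moreover have "prob_dist M (L (approx (i N) f)) (L (approx (j N) f)) = prob_dist M (L (h N)) (\<lambda>_. 0)"
      unfolding h_def by (intro prob_dist_noise_diff approx_test f)
    ultimately show False using ij(3)[of N] by simp
  qed
qed

lemma carma_props:
  assumes "test_function f"
  shows "carma f \<in> borel_measurable M" "conv_in_prob M (\<lambda>n. L (approx n f)) (carma f)"
proof -
  have "\<exists>Y. Y \<in> borel_measurable M \<and> conv_in_prob M (\<lambda>n. L (approx n f)) Y"
    using carma_exists[OF assms] by blast
  from someI_ex[OF this] show "carma f \<in> borel_measurable M" "conv_in_prob M (\<lambda>n. L (approx n f)) (carma f)"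
    unfolding carma_def by blast+
qed

lemma carma_linear:
  assumes f: "test_function f" and h: "test_function h"
  shows "AE w in M. carma (\<lambda>x. b * f x + c * h x) w = b * carma f w + c * carma h w"
proof (rule conv_in_prob_unique)
  let ?k = "\<lambda>x. b * f x + c * h x"
  have k: "test_function ?k" by (rule test_function_lincomb[OF f h])
  note [measurable] = carma_props(1)[OF f] carma_props(1)[OF h] carma_props(1)[OF k]
    Lm[OF approx_test[OF f]] Lm[OF approx_test[OF h]] Lm[OF approx_test[OF k]]
  show "L (approx n ?k) \<in> borel_measurable M" for n by measurable
  show "carma ?k \<in> borel_measurable M" by measurable
  show "(\<lambda>w. b * carma f w + c * carma h w) \<in> borel_measurable M" by measurable
  show "conv_in_prob M (\<lambda>n. L (approx n ?k)) (carma ?k)" by (rule carma_props(2)[OF k])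
  show "conv_in_prob M (\<lambda>n. L (approx n ?k)) (\<lambda>w. b * carma f w + c * carma h w)"
  proof (rule conv_in_prob_AE_cong)
    show "conv_in_prob M (\<lambda>n w. b * L (approx n f) w + c * L (approx n h) w) (\<lambda>w. b * carma f w + c * carma h w)"
      by (rule conv_in_prob_lincomb) (use carma_props(2)[OF f] carma_props(2)[OF h] in measurable)
    show "AE w in M. b * L (approx n f) w + c * L (approx n h) w = L (approx n ?k) w" for n
      unfolding approx_lincomb[OF f h] using Llin[OF approx_test[OF f, of n] approx_test[OF h, of n], of b c] by auto
  qed measurable
qed

lemma carma_char:
  assumes f: "test_function f"
  shows "(\<lambda>n. exp (LINT x|lborel. levy_exponent a \<gamma> \<nu> (approx n f x))) \<longlonglongrightarrow> (LINT w|M. cis (carma f w))"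
  using conv_in_prob_char[OF Lm[OF approx_test[OF f]] carma_props[OF f]]
  unfolding Lchar[OF approx_test[OF f]] .

text \<open>Lebesgue measure is translation invariant, so the characteristic functions of the
  approximations agree before the limit is taken.\<close>

lemma carma_char_translate:
  assumes f: "test_function f"
  shows "(LINT w|M. cis (carma (\<lambda>x. f (x - t)) w)) = (LINT w|M. cis (carma f w))"
proof -
  have "(LINT x|lborel. levy_exponent a \<gamma> \<nu> (approx n f (x - t))) = (LINT x|lborel. levy_exponent a \<gamma> \<nu> (approx n f x))" for n
  proof -
    have [measurable]: "approx n f \<in> borel_measurable borel" by (rule test_function_measurable[OF approx_test[OF f]])
    note [measurable] = levy_exponent_measurable[OF levy_white_noiseD(2)[OF L] levy_white_noiseD(1)[OF L]]
    show ?thesis using lborel_integral_shift[of "\<lambda>x. levy_exponent a \<gamma> \<nu> (approx n f x)" "- t"] by simp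
  qed
  then show ?thesis
    using carma_char[OF test_function_translate[OF f, of t]] carma_char[OF f]
    unfolding approx_translate[OF f] by (auto intro: LIMSEQ_unique)
qed

text \<open>As in the Cramer-Wold device, linearity reduces a joint characteristic function to that
  of \<open>carma\<close> at the single test function \<open>\<Sum>j<k. c j * f j\<close>.\<close>

lemma carma_stationary: "stationary_grp M carma"
  unfolding stationary_grp_def
proof (intro allI impI)
  fix t :: "real^'d" and k and f :: "nat \<Rightarrow> real^'d \<Rightarrow> real"
  assume "\<forall>j<k. test_function (f j)"
  then have f: "\<And>j. j < k \<Longrightarrow> test_function (f j)" by blast
  have ft: "test_function (\<lambda>x. f j (x - t))" if "j < k" for j by (rule test_function_translate[OF f[OF that]])
  have sum: "(LINT w|M. cis (\<Sum>j<k. c j * carma (h j) w)) = (LINT w|M. cis (carma (\<lambda>x. \<Sum>j<k. c j * h j x) w))"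
    if h: "\<And>j. j < k \<Longrightarrow> test_function (h j)" for h :: "nat \<Rightarrow> real^'d \<Rightarrow> real" and c
  proof (rule integral_cong_AE)
    have t: "test_function (\<lambda>x. \<Sum>j<k. c j * h j x)" by (intro test_function_sum test_function_cmult h) auto
    show "(\<lambda>w. cis (carma (\<lambda>x. \<Sum>j<k. c j * h j x) w)) \<in> borel_measurable M"
      using carma_props(1)[OF t] by measurable
    show "(\<lambda>w. cis (\<Sum>j<k. c j * carma (h j) w)) \<in> borel_measurable M"
      by (intro cis_measurable borel_measurable_sum borel_measurable_times borel_measurable_const carma_props(1) h) auto
    show "AE w in M. cis (\<Sum>j<k. c j * carma (h j) w) = cis (carma (\<lambda>x. \<Sum>j<k. c j * h j x) w)"
    proof -
      have "AE w in M. carma (\<lambda>x. \<Sum>j<k. c j * h j x) w = (\<Sum>j<k. c j * carma (h j) w)"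
        by (rule gen_random_process_sum) (fact carma_linear h)+
      then show ?thesis by eventually_elim simp
    qed
  qed
  show "distr M (Pi\<^sub>M {..<k} (\<lambda>_. borel)) (\<lambda>w. \<lambda>j\<in>{..<k}. carma (\<lambda>x. f j (x - t)) w)
      = distr M (Pi\<^sub>M {..<k} (\<lambda>_. borel)) (\<lambda>w. \<lambda>j\<in>{..<k}. carma (f j) w)"
  proof (rule joint_char_unique[OF M, of k "\<lambda>j. carma (\<lambda>x. f j (x - t))" "\<lambda>j. carma (f j)"])
    show "carma (\<lambda>x. f j (x - t)) \<in> borel_measurable M" "carma (f j) \<in> borel_measurable M" if "j < k" for j
      by (rule carma_props(1)[OF ft[OF that]], rule carma_props(1)[OF f[OF that]])
    fix c
    have t: "test_function (\<lambda>x. \<Sum>j<k. c j * f j x)" by (intro test_function_sum test_function_cmult f) auto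
    show "(LINT w|M. cis (\<Sum>j<k. c j * carma (\<lambda>x. f j (x - t)) w)) = (LINT w|M. cis (\<Sum>j<k. c j * carma (f j) w))"
    proof (rule trans[OF _ trans[OF carma_char_translate[OF t]]])
      show "(LINT w|M. cis (\<Sum>j<k. c j * carma (\<lambda>x. f j (x - t)) w)) = (LINT w|M. cis (carma (\<lambda>x. \<Sum>j<k. c j * f j (x - t)) w))"
        by (rule sum) (rule ft)
      show "(LINT w|M. cis (carma (\<lambda>x. \<Sum>j<k. c j * f j x) w)) = (LINT w|M. cis (\<Sum>j<k. c j * carma (f j) w))"
        by (rule sum[symmetric]) (rule f)
    qed
  qed
qed

text \<open>A diagonal argument: for each difference \<open>d k\<close> an index \<open>n k\<close>
  brings the truncated value within \<open>1 / (k + 1)\<close> of \<open>carma (d k)\<close>, with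
  no uniformity in \<open>n\<close>. The functions \<open>approx (n k) (d k)\<close> lie under
  envelopes whose constants tend to 0, so their noise values vanish in the limit.\<close>

lemma carma_continuous:
  assumes tc: "test_conv f h"
  shows "conv_in_prob M (\<lambda>k. carma (f k)) (carma h)"
proof -
  have f: "test_function (f k)" and h: "test_function h" for k using tc by (auto simp: test_conv_def)
  obtain K where K: "compact K" "\<And>k. {x. f k x \<noteq> 0} \<subseteq> K" "{x. h x \<noteq> 0} \<subseteq> K"
    using tc unfolding test_conv_def by blast
  define d where "d k = (\<lambda>x. f k x - h x)" for k
  have d: "test_function (d k)" for k unfolding d_def by (intro test_function_diff f h)
  have pd: "pure_op m (d k) = (\<lambda>x. pure_op m (f k) x - pure_op m h x)" for k
    unfolding d_def using pure_op_lincomb[OF test_function_smooth[OF f[of k]] test_function_smooth[OF h], of m 1 "-1"] by simp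
  \<comment> \<open>The case \<open>j = 0\<close> is the convergence of the functions themselves;
    with \<open>j = m\<close> it covers all terms of \<open>pure_op m\<close>.\<close>
  have u: "uniform_limit UNIV (\<lambda>k. iter_partial (replicate j i) (f k)) (iter_partial (replicate j i) h) sequentially" for i j
    using tc unfolding test_conv_def Dmulti_single[symmetric] by blast
  have usum: "uniform_limit UNIV (\<lambda>k x. \<Sum>i\<in>A. iter_partial (replicate m i) (f k) x) (\<lambda>x. \<Sum>i\<in>A. iter_partial (replicate m i) h x) sequentially"
    if "finite A" for A :: "'d set"
    using that by (induction A rule: finite_induct) (auto intro!: uniform_limit_intros u)
  have "uniform_limit UNIV (\<lambda>k x. f k x + (\<Sum>i\<in>UNIV. iter_partial (replicate m i) (f k) x))
     (\<lambda>x. h x + (\<Sum>i\<in>UNIV. iter_partial (replicate m i) h x)) sequentially"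
    using u[of 0] by (intro uniform_limit_add usum) auto
  then have "uniform_limit UNIV (\<lambda>k x. pure_op m (f k) x - pure_op m h x) (\<lambda>x. pure_op m h x - pure_op m h x) sequentially"
    unfolding pure_op_def by (rule uniform_limit_minus[OF _ uniform_limit_const])
  then have ud: "uniform_limit UNIV (\<lambda>k. pure_op m (d k)) (\<lambda>_. 0) sequentially" unfolding pd by simp
  have supp: "{x. pure_op m (d k) x \<noteq> 0} \<subseteq> K" for k
  proof (rule pure_op_support[OF compact_imp_closed[OF K(1)]])
    show "{x. d k x \<noteq> 0} \<subseteq> K" using K(2)[of k] K(3) unfolding d_def by force
  qed
  have W: "(\<lambda>k. exp_weight \<delta> (pure_op m (d k))) \<longlonglongrightarrow> 0"
    by (rule exp_weight_tendsto[OF gc \<delta> gb test_function_pure_op[OF d] K(1) supp ud])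
  then obtain B where B: "\<And>k. \<bar>exp_weight \<delta> (pure_op m (d k))\<bar> \<le> B"
    using convergent_imp_Bseq[OF convergentI[OF W]] by (auto simp: Bseq_def)
  have C0: "C \<ge> 0" by (rule kernel_constant_nonneg[OF gc \<delta> gb])
  have "\<exists>n. prob_dist M (L (approx n (d k))) (carma (d k)) < inverse (real (Suc k))" for k
  proof -
    have "(\<lambda>n. prob_dist M (L (approx n (d k))) (carma (d k))) \<longlonglongrightarrow> 0"
      using carma_props[OF d] by (subst conv_in_prob_iff[symmetric]) (auto intro: Lm approx_test d)
    then have "\<forall>\<^sub>F n in sequentially. prob_dist M (L (approx n (d k))) (carma (d k)) < inverse (real (Suc k))"
      by (rule order_tendstoD) simp
    then show ?thesis by (auto simp: eventually_sequentially)
  qed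
  then obtain n where n: "\<And>k. prob_dist M (L (approx (n k) (d k))) (carma (d k)) < inverse (real (Suc k))" by metis
  have bnd: "\<bar>approx (n k) (d k) x\<bar> \<le> C * exp_weight \<delta> (pure_op m (d k)) * exp (- \<delta> * l1norm x)" for k x
    by (rule approx_bound[OF d])
  have "conv_in_prob M (\<lambda>k. L (approx (n k) (d k))) (\<lambda>_. 0)"
  proof (rule noise_conv_zero[OF approx_test[OF d]])
    show "\<bar>approx (n k) (d k) x\<bar> \<le> (C * B) * exp (- \<delta> * l1norm x)" for k x
    proof (rule order_trans[OF bnd], intro mult_right_mono mult_left_mono C0)
      show "exp_weight \<delta> (pure_op m (d k)) \<le> B" using B[of k] by linarith
    qed simp
    show "(\<lambda>k. approx (n k) (d k) x) \<longlonglongrightarrow> 0" for x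
    proof (rule Lim_null_comparison)
      show "\<forall>\<^sub>F k in sequentially. norm (approx (n k) (d k) x) \<le> C * exp_weight \<delta> (pure_op m (d k)) * exp (- \<delta> * l1norm x)"
        using bnd by simp
      have "(\<lambda>k. C * exp_weight \<delta> (pure_op m (d k)) * exp (- \<delta> * l1norm x)) \<longlonglongrightarrow> C * 0 * exp (- \<delta> * l1norm x)"
        by (rule tendsto_mult[OF tendsto_mult[OF tendsto_const W] tendsto_const])
      then show "(\<lambda>k. C * exp_weight \<delta> (pure_op m (d k)) * exp (- \<delta> * l1norm x)) \<longlonglongrightarrow> 0" by simp
    qed
  qed
  then have l0: "(\<lambda>k. prob_dist M (L (approx (n k) (d k))) (\<lambda>_. 0)) \<longlonglongrightarrow> 0"
    by (subst (asm) conv_in_prob_iff) (auto intro: Lm approx_test d)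
  have "(\<lambda>k. inverse (real (Suc k)) + prob_dist M (L (approx (n k) (d k))) (\<lambda>_. 0)) \<longlonglongrightarrow> 0 + 0"
    by (rule tendsto_add[OF LIMSEQ_inverse_real_of_nat l0])
  moreover have "prob_dist M (carma (f k)) (carma h) \<le> inverse (real (Suc k)) + prob_dist M (L (approx (n k) (d k))) (\<lambda>_. 0)" for k
  proof -
    have "prob_dist M (carma (f k)) (carma h) = prob_dist M (carma (d k)) (\<lambda>_. 0)"
    proof (rule prob_dist_AE_cong)
      show "AE w in M. \<bar>carma (f k) w - carma h w\<bar> = \<bar>carma (d k) w - 0\<bar>"
        using carma_linear[OF f[of k] h, of 1 "-1"] unfolding d_def by auto
    qed (auto intro: carma_props f h d)
    also have "\<dots> \<le> prob_dist M (carma (d k)) (L (approx (n k) (d k))) + prob_dist M (L (approx (n k) (d k))) (\<lambda>_. 0)"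
      by (rule prob_dist_triangle) (auto intro: carma_props Lm approx_test d)
    finally show ?thesis using n[of k] prob_dist_commute[of "carma (d k)"] by simp
  qed
  ultimately have "(\<lambda>k. prob_dist M (carma (f k)) (carma h)) \<longlonglongrightarrow> 0"
    by (rule tendsto_zero_upper) (auto simp: prob_dist_nonneg)
  then show ?thesis by (subst conv_in_prob_iff) (auto intro: carma_props f h)
qed

lemma carma_gen_random_process: "gen_random_process M carma"
  unfolding gen_random_process_def using carma_props(1) carma_linear carma_continuous by blast

text \<open>Used with \<open>f\<close> and \<open>h\<close> the images of one test function under
  the two adjoint operators. Both \<open>approx n f\<close> and \<open>h\<close> decay
  exponentially, so \<open>L (approx n f)\<close> tends to \<open>L h\<close> as well as to
  \<open>carma f\<close>.\<close>

lemma carma_equation: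
  assumes f: "test_function f" and h: "test_function h"
    and eq: "\<And>x. (LINT y|lborel. g y * pure_op m f (x - y)) = h x"
  shows "AE w in M. carma f w = L h w"
proof (rule conv_in_prob_unique[OF Lm[OF approx_test[OF f]] carma_props(1)[OF f] Lm[OF h] carma_props(2)[OF f]])
  define d where "d n = (\<lambda>x. approx n f x - h x)" for n
  have d: "test_function (d n)" for n unfolding d_def by (intro test_function_diff approx_test f h)
  obtain B where B: "\<And>x. \<bar>h x\<bar> \<le> B * exp (- \<delta> * l1norm x)" using test_function_decay[OF h] by metis
  have "conv_in_prob M (\<lambda>n. L (d n)) (\<lambda>_. 0)"
  proof (rule noise_conv_zero[OF d])
    show "\<bar>d n x\<bar> \<le> (C * exp_weight \<delta> (pure_op m f) + B) * exp (- \<delta> * l1norm x)" for n x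
      unfolding d_def distrib_right using approx_bound[OF f, of n x] B[of x] by linarith
    show "(\<lambda>n. d n x) \<longlonglongrightarrow> 0" for x
      unfolding d_def using tendsto_diff[OF approx_tendsto[OF f, of x, unfolded eq] tendsto_const[of "h x"]] by simp
  qed
  then have "(\<lambda>n. prob_dist M (L (d n)) (\<lambda>_. 0)) \<longlonglongrightarrow> 0"
    by (subst (asm) conv_in_prob_iff) (auto intro: Lm d)
  then show "conv_in_prob M (\<lambda>n. L (approx n f)) (L h)"
    unfolding d_def prob_dist_noise_diff[OF approx_test[OF f] h, symmetric]
    by (subst conv_in_prob_iff) (auto intro: Lm approx_test f h)
qed

end

theorem theorem4p3:
  fixes P Q :: "('d::finite \<Rightarrow> nat) \<Rightarrow> real"
    and M :: "'w measure"
    and L :: "(real^'d \<Rightarrow> real) \<Rightarrow> 'w \<Rightarrow> real"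
    and a \<gamma> :: real and \<nu> :: "real measure"
  assumes "prob_space M"
    and "is_mpoly P" and "is_mpoly Q" and "P \<noteq> (\<lambda>_. 0)"
    and "\<exists>\<epsilon>>0. \<exists>F. holomorphic_several F (strip \<epsilon>) \<and>
           (\<forall>z\<in>strip \<epsilon>. mpoly_eval_c P (\<i> *s z) \<noteq> 0 \<longrightarrow>
              F z = mpoly_eval_c Q (\<i> *s z) / mpoly_eval_c P (\<i> *s z))"
    and "levy_white_noise M a \<gamma> \<nu> L"
    and "(\<integral>\<^sup>+ r. ennreal (indicator {r. \<bar>r\<bar> > 1} r * (ln \<bar>r\<bar>) ^ CARD('d)) \<partial>\<nu>) < \<infinity>"
  shows "\<exists>s. gen_random_process M s \<and> stationary_grp M s \<and>
           (\<forall>\<phi>. test_function \<phi> \<longrightarrow>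
              (AE w in M. s (diff_op_neg P \<phi>) w = L (diff_op_neg Q \<phi>) w))"
proof -
  obtain \<epsilon> F where F: "\<epsilon> > 0" "holomorphic_several F (strip \<epsilon>)"
    and FPQ: "\<And>z. z \<in> strip \<epsilon> \<Longrightarrow> mpoly_eval_c P (\<i> *s z) \<noteq> 0 \<Longrightarrow>
      F z = mpoly_eval_c Q (\<i> *s z) / mpoly_eval_c P (\<i> *s z)"
    using assms(5) by blast
  have "\<exists>m (g :: real^'d \<Rightarrow> real) C \<delta>. continuous_on UNIV g \<and> \<delta> > 0 \<and> (\<forall>y. \<bar>g y\<bar> \<le> C * exp (- \<delta> * l1norm y)) \<and>
    (\<forall>f x. test_function f \<longrightarrow> (LINT y|lborel. g y * pure_op m (diff_op_neg P f) (x - y)) = diff_op_neg Q f x)"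
    by (rule kernel_exists[OF assms(2,4,3) F]) (rule FPQ)
  then obtain m and g :: "real^'d \<Rightarrow> real" and C \<delta> where g: "continuous_on UNIV g" "\<delta> > 0" "\<And>y. \<bar>g y\<bar> \<le> C * exp (- \<delta> * l1norm y)"
    and rep: "\<And>f x. test_function f \<Longrightarrow> (LINT y|lborel. g y * pure_op m (diff_op_neg P f) (x - y)) = diff_op_neg Q f x"
    by blast
  note prem = assms(1,6,7) g
  show ?thesis
  proof (intro exI conjI allI impI)
    show "gen_random_process M (carma M L g m)" by (rule carma_gen_random_process[OF prem])
    show "stationary_grp M (carma M L g m)" by (rule carma_stationary[OF prem])
    fix \<phi> :: "real^'d \<Rightarrow> real" assume \<phi>: "test_function \<phi>"
    show "AE w in M. carma M L g m (diff_op_neg P \<phi>) w = L (diff_op_neg Q \<phi>) w"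
      by (rule carma_equation[OF prem]) (use \<phi> assms(2,3) rep in \<open>auto intro: test_function_diff_op_neg\<close>)
  qed
qed

end
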